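(* Let $x^*\in J^*$. Then $x^*$ is an extreme point of the closed unit ball $B_{J^*}$ of $J^*$ if and only if there exist a family of intervals $\{I_i\}_{i\in F}$ of $\mathbb N$ and nonzero real numbers $(\alpha_i)_{i\in F}$ such that $x^*(x)=\sum_{i\in F}\alpha_i I_i^*(x)$ for all $x\in J$, and (1) $\sum_{i\in F}\alpha_i e_i$ is an extreme point of $B_J$, and (2) $\bigcup_{i\in F}I_i$ is an interval of $\mathbb N$.
   Context: For a real sequence $x=(x(n))_{n\in\mathbb N}$ let $\|x\|_J=\sup\bigl(\sum_{i=1}^n|\sum_{k\in I_i}x(k)|^2\bigr)^{1/2}$, the supremum taken over all $n\in\mathbb N$ and all families $I_1,\dots,I_n$ of pairwise disjoint intervals of $\mathbb N$ (an interval of $\mathbb N$ is a nonempty set of consecutive positive integers, possibly infinite). The James space is $J=\{x:\|x\|_J<\infty\}$ with this norm; $(e_n)$ is the unit vector basis, $B_J$ the closed unit ball. For $x\in J$ and any interval $I$ the series $\sum_{k\in I}x(k)$ converges, and $I^*\in J^*$ denotes the norm-one functional $I^*(x)=\sum_{n\in I}x(n)$. A family of intervals $\{I_i\}_{i\in F}$ means: $F=\{1,\dots,k\}$ for some $k\in\mathbb N$ or $F=\mathbb N$, each $I_i$ is an interval of $\mathbb N$, and $\max I_i<\min I_{i+1}$ whenever $i+1\in F$. *)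

theory Defs
  imports "HOL-Analysis.Analysis"
begin

text \<open>Convention: the positive integers 1,2,3,... are re-indexed as 0,1,2,... (type nat).\<close>

definition nat_interval :: "nat set \<Rightarrow> bool" where
  "nat_interval I \<longleftrightarrow> I \<noteq> {} \<and> (\<forall>a\<in>I. \<forall>c\<in>I. \<forall>b. a \<le> b \<and> b \<le> c \<longrightarrow> b \<in> I)"

definition isum :: "(nat \<Rightarrow> real) \<Rightarrow> nat set \<Rightarrow> real" where
  "isum x I = (\<Sum>k. if k \<in> I then x k else 0)"

definition jvals :: "(nat \<Rightarrow> real) \<Rightarrow> real set" where
  "jvals x = {(\<Sum>I\<in>\<I>. (isum x I)\<^sup>2) | \<I>. finite \<I> \<and> \<I> \<noteq> {} \<and>
      (\<forall>I\<in>\<I>. nat_interval I) \<and> disjoint \<I>}"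

definition James :: "(nat \<Rightarrow> real) set" where
  "James = {x. (\<forall>I. nat_interval I \<longrightarrow> summable (\<lambda>k. if k \<in> I then x k else 0))
                \<and> bdd_above (jvals x)}"

definition jnorm :: "(nat \<Rightarrow> real) \<Rightarrow> real" where
  "jnorm x = sqrt (Sup (jvals x))"

definition James_ball :: "(nat \<Rightarrow> real) set" where
  "James_ball = {x \<in> James. jnorm x \<le> 1}"

text \<open>Continuous linear functionals on J, represented extensionally (value 0 outside J).\<close>
definition James_dual :: "((nat \<Rightarrow> real) \<Rightarrow> real) set" where
  "James_dual = {f.
     (\<forall>x\<in>James. \<forall>y\<in>James. f (\<lambda>k. x k + y k) = f x + f y) \<and>
     (\<forall>x\<in>James. \<forall>c. f (\<lambda>k. c * x k) = c * f x) \<and>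
     (\<exists>C. \<forall>x\<in>James. \<bar>f x\<bar> \<le> C * jnorm x) \<and>
     (\<forall>x. x \<notin> James \<longrightarrow> f x = 0)}"

definition dual_norm :: "((nat \<Rightarrow> real) \<Rightarrow> real) \<Rightarrow> real" where
  "dual_norm f = Sup {\<bar>f x\<bar> | x. x \<in> James_ball}"

definition James_dual_ball :: "((nat \<Rightarrow> real) \<Rightarrow> real) set" where
  "James_dual_ball = {f \<in> James_dual. dual_norm f \<le> 1}"

definition extreme_pt :: "('a \<Rightarrow> real) \<Rightarrow> ('a \<Rightarrow> real) set \<Rightarrow> bool" where
  "extreme_pt z S \<longleftrightarrow> z \<in> S \<and>
     (\<forall>a\<in>S. \<forall>b\<in>S. \<forall>t::real. 0 < t \<and> t < 1 \<and> z = (\<lambda>k. t * a k + (1 - t) * b k) \<longrightarrow> a = b)"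

text \<open>A family of intervals indexed by F, where F = {1..k} (here {..<k}, k \<ge> 1) or F = N.\<close>
definition interval_family :: "nat set \<Rightarrow> (nat \<Rightarrow> nat set) \<Rightarrow> bool" where
  "interval_family F I \<longleftrightarrow> (F = UNIV \<or> (\<exists>k\<ge>1. F = {..<k})) \<and>
     (\<forall>i\<in>F. nat_interval (I i)) \<and>
     (\<forall>i. Suc i \<in> F \<longrightarrow> (\<forall>a\<in>I i. \<forall>b\<in>I (Suc i). a < b))"

end

theory Submission
  imports Defs "HOL-Computational_Algebra.Polynomial"
begin

text \<open>A functional in the dual unit ball is determined by its values on the unit vectors, and the norm
  of the James space is the supremum over the set \<open>W\<close> of functionals \<open>\<Sum> \<alpha>\<^sub>i I\<^sub>i\<^sup>*\<close> with
  \<open>\<Sum> \<alpha>\<^sub>i\<^sup>2 \<le> 1\<close>. As \<open>W\<close> is closed under pointwise limits, every extreme point of the dual ball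
  lies in \<open>W\<close> (Milman's converse): it is constant on successive runs. It almost attains its norm
  on finitely supported vectors \<open>x\<close> of norm at most \<open>1\<close>, and the sequence of sums of \<open>x\<close> over the
  runs is again in the ball and is forced to be close to \<open>\<alpha>\<close>. Hence \<open>\<alpha>\<close> lies in the ball with
  \<open>\<Sum> \<alpha>\<^sub>i\<^sup>2 = 1\<close>, which characterises the extreme points of the James ball. A zero run between two
  others could be merged with either neighbour, whose values have opposite signs, and this
  would exhibit the functional as a proper convex combination.

  Conversely, let \<open>x\<close> carry the entry \<open>\<alpha>\<^sub>i\<close> at one chosen point of each \<open>I\<^sub>i\<close>. The entries alternate
  in sign, and the functional attains its norm at \<open>x\<close>. Differentiating the norm at \<open>x\<close> in directions
  close to \<open>sgn x\<close> shows that the two members of a convex representation agree with the functional on the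
  chosen points, and these can be any points of the \<open>I\<^sub>i\<close>.\<close>

text \<open>The description of the extreme points of the James ball rests on one perturbation:
  adding \<open>s\<close> to entry \<open>p\<close> and subtracting it from entry
  \<open>Suc p\<close> alters only blocks that contain exactly one of the two. Extremality therefore
  makes families that respect the gap between \<open>p\<close> and \<open>Suc p\<close> norming, for
  each \<open>p\<close> separately. The obstacle is to cut at all gaps at once; a sign argument at
  two neighbouring gaps isolates one entry at a time.

  Condition (2) provides directions at positions where \<open>x\<close> vanishes. Since the signs
  alternate, \<open>sgn x\<close> has sum -1, 0 or 1 over every block. If all nonzero entries lie on
  one side of \<open>j\<close>, a unit of the right sign at \<open>j\<close> keeps these sums
  between -1 and 1; between two entries of opposite sign, either choice produces a block with sum 2
  or -2.

  In the Milman argument sequences are tested only against finitely supported vectors.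
  \<open>W\<close> is closed under pointwise limits because runs may merge in a limit, while no new
  start of a run can appear.\<close>

definition block :: "nat set \<Rightarrow> bool" where
  "block A \<longleftrightarrow> finite A \<and> (\<forall>a\<in>A. \<forall>c\<in>A. \<forall>b. a \<le> b \<and> b \<le> c \<longrightarrow> b \<in> A)"

definition families :: "nat set \<Rightarrow> nat set set set" where
  "families B = {\<I>. finite \<I> \<and> (\<forall>I\<in>\<I>. block I) \<and> disjoint \<I> \<and> \<Union>\<I> \<subseteq> B}"

definition qsum :: "(nat \<Rightarrow> real) \<Rightarrow> nat set set \<Rightarrow> real" where
  "qsum x \<I> = (\<Sum>I\<in>\<I>. (sum x I)\<^sup>2)"

text \<open>\<open>sqbd x c\<close> says that the square of the James norm of \<open>x\<close> is at most \<open>c\<close>: finite blocks suffice,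
  since infinite intervals are limits of them. Empty blocks are allowed.\<close>

definition sqbd :: "(nat \<Rightarrow> real) \<Rightarrow> real \<Rightarrow> bool" where
  "sqbd x c \<longleftrightarrow> (\<forall>\<I>\<in>families UNIV. qsum x \<I> \<le> c)"

text \<open>For an interval \<open>B\<close> this is the squared norm of the part of
  \<open>x\<close> on \<open>B\<close>. Other sets occur after a block has been removed from an
  interval.\<close>

definition vari :: "(nat \<Rightarrow> real) \<Rightarrow> nat set \<Rightarrow> real" where
  "vari x B = Sup (qsum x ` families B)"

subsection \<open>Finite block families\<close>

lemma block_finite: "block A \<Longrightarrow> finite A"
  by (simp add: block_def)

lemma block_convex: "block A \<Longrightarrow> a \<in> A \<Longrightarrow> c \<in> A \<Longrightarrow> a \<le> b \<Longrightarrow> b \<le> c \<Longrightarrow> b \<in> A"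
  by (meson block_def)

lemma blockI:
  assumes "finite A" "\<And>a b c. a \<in> A \<Longrightarrow> c \<in> A \<Longrightarrow> a \<le> b \<Longrightarrow> b \<le> c \<Longrightarrow> b \<in> A"
  shows "block A"
  unfolding block_def by (intro conjI ballI allI impI assms(1)) (erule conjE, rule assms(2))

lemma block_simps [simp]: "block {}" "block {k}" "block {..<n}" "block {m..<n}"
  by (auto simp: block_def)

lemma block_Int_lessThan: "nat_interval I \<Longrightarrow> block (I \<inter> {..<n})"
  unfolding block_def nat_interval_def by auto

lemma block_Int: "block A \<Longrightarrow> block B \<Longrightarrow> block (A \<inter> B)"
proof (rule blockI)
  assume A: "block A" and B: "block B"
  show "finite (A \<inter> B)" by (rule finite_Int) (rule disjI1, rule block_finite[OF A])
  fix a b c assume "a \<in> A \<inter> B" "c \<in> A \<inter> B" "a \<le> b" "b \<le> c"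
  then show "b \<in> A \<inter> B" by (meson IntD1 IntD2 IntI block_convex[OF A] block_convex[OF B])
qed

lemma block_nat_interval: "block A \<Longrightarrow> A \<noteq> {} \<Longrightarrow> nat_interval A"
  unfolding block_def nat_interval_def by (rule conjI) (assumption, erule conjunct2)

lemma familiesI:
  "finite \<I> \<Longrightarrow> (\<And>I. I \<in> \<I> \<Longrightarrow> block I) \<Longrightarrow> disjoint \<I> \<Longrightarrow> \<Union>\<I> \<subseteq> B \<Longrightarrow> \<I> \<in> families B"
  by (simp add: families_def)

lemma familiesD:
  assumes "\<I> \<in> families B"
  shows "finite \<I>" "\<And>I. I \<in> \<I> \<Longrightarrow> block I" "disjoint \<I>" "\<Union>\<I> \<subseteq> B"
  using assms by (simp_all add: families_def)

lemma empty_in_families [simp]: "{} \<in> families B"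
  by (simp add: families_def)

lemma families_mono: "B \<subseteq> C \<Longrightarrow> families B \<subseteq> families C"
  by (auto simp: families_def)

lemma singleton_in_families: "block A \<Longrightarrow> A \<subseteq> B \<Longrightarrow> {A} \<in> families B"
  by (simp add: families_def)

lemma qsum_empty [simp]: "qsum x {} = 0"
  by (simp add: qsum_def)

lemma qsum_nonneg: "0 \<le> qsum x \<I>"
  by (simp add: qsum_def sum_nonneg)

lemma families_Un:
  assumes "\<I> \<in> families B" "\<J> \<in> families C" "B \<inter> C = {}"
  shows "\<I> \<union> \<J> \<in> families (B \<union> C)" "qsum x (\<I> \<union> \<J>) = qsum x \<I> + qsum x \<J>"
proof -
  note I = familiesD[OF assms(1)] and J = familiesD[OF assms(2)]
  have cross: "a \<inter> b = {}" if "a \<in> \<I>" "b \<in> \<J>" for a b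
    using that I(4) J(4) assms(3) by blast
  show "\<I> \<union> \<J> \<in> families (B \<union> C)"
  proof (rule familiesI)
    show "disjoint (\<I> \<union> \<J>)"
    proof (unfold disjoint_def, intro ballI impI)
      fix a b assume ab: "a \<in> \<I> \<union> \<J>" "b \<in> \<I> \<union> \<J>" "a \<noteq> b"
      then consider "a \<in> \<I>" "b \<in> \<I>" | "a \<in> \<J>" "b \<in> \<J>" | "a \<in> \<I>" "b \<in> \<J>" | "b \<in> \<I>" "a \<in> \<J>"
        by blast
      then show "a \<inter> b = {}"
        by cases (use disjointD[OF I(3)] disjointD[OF J(3)] cross Int_commute[of a b] ab(3) in simp_all)
    qed
    show "\<Union>(\<I> \<union> \<J>) \<subseteq> B \<union> C" using I(4) J(4) by blast
    show "block I" if "I \<in> \<I> \<union> \<J>" for I using I(2) J(2) that by blast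
  qed (use I(1) J(1) in simp)
  have "\<I> \<inter> \<J> \<subseteq> {{}}" using cross by blast
  then have "(\<Sum>I\<in>\<I> \<inter> \<J>. (sum x I)\<^sup>2) = 0"
    by (intro sum.neutral) auto
  then show "qsum x (\<I> \<union> \<J>) = qsum x \<I> + qsum x \<J>"
    unfolding qsum_def using sum.union_inter[OF I(1) J(1), of "\<lambda>I. (sum x I)\<^sup>2"] by simp
qed

text \<open>\<open>T\<close> need not be injective: members with equal images have disjoint images,
  so the common image is empty and contributes nothing to the sum.\<close>

lemma qsum_image_family:
  assumes fin: "finite \<I>" and bl: "\<And>I. I \<in> \<I> \<Longrightarrow> block (T I)"
    and disj: "\<And>I J. I \<in> \<I> \<Longrightarrow> J \<in> \<I> \<Longrightarrow> I \<noteq> J \<Longrightarrow> T I \<inter> T J = {}"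
    and sub: "\<And>I. I \<in> \<I> \<Longrightarrow> T I \<subseteq> B"
  shows "T ` \<I> \<in> families B" "qsum x (T ` \<I>) = (\<Sum>I\<in>\<I>. (sum x (T I))\<^sup>2)"
proof -
  show "T ` \<I> \<in> families B"
  proof (rule familiesI)
    show "disjoint (T ` \<I>)"
      unfolding disjoint_def using disj by (metis imageE)
  qed (use fin bl sub in auto)
  have "(sum x (T I))\<^sup>2 = 0" if "I \<in> \<I>" "J \<in> \<I>" "I \<noteq> J" "T I = T J" for I J
    using disj[OF that(1-3)] that(4) by simp
  then show "qsum x (T ` \<I>) = (\<Sum>I\<in>\<I>. (sum x (T I))\<^sup>2)"
    unfolding qsum_def using sum.reindex_nontrivial[OF fin, of T "\<lambda>A. (sum x A)\<^sup>2"]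
    by (simp add: o_def)
qed

lemma sqbdD: "sqbd x c \<Longrightarrow> \<I> \<in> families B \<Longrightarrow> qsum x \<I> \<le> c"
  unfolding sqbd_def using families_mono[of B UNIV] by blast

lemma sqbd_nonneg: "sqbd x c \<Longrightarrow> 0 \<le> c"
  using sqbdD[of x c "{}" UNIV] by simp

lemma sqbd_mono: "sqbd x c \<Longrightarrow> c \<le> d \<Longrightarrow> sqbd x d"
  unfolding sqbd_def by force

lemma sqbd_block: "sqbd x c \<Longrightarrow> block A \<Longrightarrow> (sum x A)\<^sup>2 \<le> c"
  using sqbdD[of x c "{A}" UNIV] singleton_in_families[of A UNIV] by (simp add: qsum_def)

lemma sqbd_1_abs: "sqbd x 1 \<Longrightarrow> block A \<Longrightarrow> \<bar>sum x A\<bar> \<le> 1"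
  using sqbd_block[of x 1 A] by (simp add: abs_square_le_1)

lemma sqbd_scale: "sqbd x c \<Longrightarrow> sqbd (\<lambda>k. t * x k) (t\<^sup>2 * c)"
  unfolding sqbd_def qsum_def
  by (auto simp flip: sum_distrib_left simp: power_mult_distrib mult_left_mono)

text \<open>\<open>T\<close> pulls a block family for \<open>y\<close> back to one for
  \<open>x\<close> with the same sum of squares. Truncations and sums over the fibres of monotone
  maps are instances.\<close>

lemma sqbd_transfer:
  assumes x: "sqbd x c"
    and bl: "\<And>C. block C \<Longrightarrow> block (T C)"
    and disj: "\<And>C D. C \<inter> D = {} \<Longrightarrow> T C \<inter> T D = {}"
    and sums: "\<And>C. block C \<Longrightarrow> sum y C = sum x (T C)"
  shows "sqbd y c"
  unfolding sqbd_def
proof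
  fix \<I> assume "\<I> \<in> families UNIV"
  note I = familiesD[OF this]
  have bT: "block (T I)" if "I \<in> \<I>" for I using bl I(2)[OF that] by blast
  have dT: "T I \<inter> T J = {}" if "I \<in> \<I>" "J \<in> \<I>" "I \<noteq> J" for I J
    using disj I(3) that unfolding disjoint_def by blast
  have "qsum y \<I> = (\<Sum>I\<in>\<I>. (sum x (T I))\<^sup>2)"
    unfolding qsum_def by (intro sum.cong refl) (metis I(2) sums)
  also have "\<dots> = qsum x (T ` \<I>)"
    by (rule qsum_image_family(2)[symmetric, OF I(1) bT dT subset_UNIV])
  also have "\<dots> \<le> c"
    by (rule sqbdD[OF x], rule qsum_image_family(1)[OF I(1) bT dT subset_UNIV])
  finally show "qsum y \<I> \<le> c" .
qed

text \<open>The image of \<open>x\<close>, restricted to \<open>D\<close> and read as a signed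
  measure, under \<open>\<rho>\<close>.\<close>

definition push :: "(nat \<Rightarrow> nat) \<Rightarrow> nat set \<Rightarrow> (nat \<Rightarrow> real) \<Rightarrow> nat \<Rightarrow> real" where
  "push \<rho> D x i = sum x {k \<in> D. \<rho> k = i}"

lemma sum_push:
  assumes "finite {k \<in> D. \<rho> k \<in> C}" "finite C"
  shows "sum (push \<rho> D x) C = sum x {k \<in> D. \<rho> k \<in> C}"
proof -
  have "sum x {k \<in> D. \<rho> k \<in> C} = (\<Sum>i\<in>C. sum x {k \<in> {k \<in> D. \<rho> k \<in> C}. \<rho> k = i})"
    using assms by (intro sum.group[symmetric]) auto
  also have "\<dots> = sum (push \<rho> D x) C"
    unfolding push_def by (intro sum.cong arg_cong[of _ _ "sum x"]) auto
  finally show ?thesis by simp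
qed

text \<open>Adding up neighbouring entries does not increase the norm, since the preimages of
  disjoint blocks under a monotone map are disjoint blocks.\<close>

lemma sqbd_push:
  assumes x: "sqbd x c" and mono: "mono_on D \<rho>"
    and conv: "\<And>a b d. a \<in> D \<Longrightarrow> d \<in> D \<Longrightarrow> a \<le> b \<Longrightarrow> b \<le> d \<Longrightarrow> b \<in> D"
    and fin: "\<And>C. finite C \<Longrightarrow> finite {k \<in> D. \<rho> k \<in> C}"
  shows "sqbd (push \<rho> D x) c"
proof (rule sqbd_transfer[OF x])
  fix C assume C: "block C"
  then show "sum (push \<rho> D x) C = sum x {k \<in> D. \<rho> k \<in> C}"
    by (intro sum_push fin block_finite)
  have "b \<in> D \<and> \<rho> b \<in> C" if "a \<in> D" "\<rho> a \<in> C" "d \<in> D" "\<rho> d \<in> C" "a \<le> b" "b \<le> d" for a b d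
  proof -
    have "b \<in> D" using conv that by blast
    moreover have "\<rho> a \<le> \<rho> b" "\<rho> b \<le> \<rho> d"
      using that \<open>b \<in> D\<close> monotone_onD[OF mono] by auto
    ultimately show ?thesis using block_convex[OF C that(2,4)] by blast
  qed
  then show "block {k \<in> D. \<rho> k \<in> C}"
    by (intro blockI fin block_finite[OF C]) auto
qed auto

lemma sqbd_lim:
  assumes lim: "\<And>i. (\<lambda>n. y n i) \<longlonglongrightarrow> x i" and bd: "\<And>n. sqbd (y n) c"
  shows "sqbd x c"
  unfolding sqbd_def
proof
  fix \<I> assume I: "\<I> \<in> families UNIV"
  have "(\<lambda>n. qsum (y n) \<I>) \<longlonglongrightarrow> qsum x \<I>"
    unfolding qsum_def by (intro tendsto_intros lim)
  then show "qsum x \<I> \<le> c"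
    by (rule LIMSEQ_le_const2) (use sqbdD[OF bd I] in auto)
qed

lemma sqbd_cutoff:
  assumes "sqbd x c"
  shows "sqbd (\<lambda>k. if k < n then x k else 0) c"
proof (rule sqbd_transfer[OF assms, of "\<lambda>C. C \<inter> {..<n}"])
  fix C assume "block C"
  then show "block (C \<inter> {..<n})" by (simp add: block_Int)
  show "(\<Sum>k\<in>C. if k < n then x k else 0) = sum x (C \<inter> {..<n})"
    using \<open>block C\<close> by (simp add: sum.inter_restrict[OF block_finite])
qed auto

subsection \<open>Variation on a set of positions\<close>

lemma vari_upper:
  assumes "sqbd x c" "\<I> \<in> families B"
  shows "qsum x \<I> \<le> vari x B"
  unfolding vari_def
  by (intro cSUP_upper assms(2) bdd_aboveI2[where M = c] sqbdD[OF assms(1)])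

lemma vari_least:
  assumes "\<And>\<I>. \<I> \<in> families B \<Longrightarrow> qsum x \<I> \<le> c"
  shows "vari x B \<le> c"
  unfolding vari_def by (rule cSUP_least[OF _ assms]) (metis empty_in_families empty_iff)

lemma vari_le: "sqbd x c \<Longrightarrow> vari x B \<le> c"
  by (rule vari_least, rule sqbdD)

lemma vari_nonneg: "sqbd x c \<Longrightarrow> 0 \<le> vari x B"
  using vari_upper[of x c "{}" B] by simp

lemma vari_approx:
  assumes "0 < e"
  obtains \<I> where "\<I> \<in> families B" "vari x B - e < qsum x \<I>"
proof -
  have "\<exists>\<I>\<in>families B. vari x B - e < qsum x \<I>"
  proof (rule ccontr)
    assume "\<not> ?thesis"
    then have "vari x B \<le> vari x B - e" by (intro vari_least) (meson not_le_imp_less)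
    then show False using assms by simp
  qed
  then show ?thesis using that by blast
qed

lemma vari_mono: "sqbd x c \<Longrightarrow> B \<subseteq> C \<Longrightarrow> vari x B \<le> vari x C"
  by (rule vari_least, rule vari_upper[of x c], assumption, rule subsetD[OF families_mono])

text \<open>Nearly optimal families for \<open>B\<close> and \<open>C\<close> can be united. Nearly
  all later estimates of variations come down to this inequality.\<close>

lemma vari_superadd:
  assumes x: "sqbd x c" and "B \<inter> C = {}" "B \<union> C \<subseteq> E"
  shows "vari x B + vari x C \<le> vari x E"
proof (rule field_le_epsilon)
  fix e :: real assume "0 < e"
  then have e: "0 < e/2" by simp
  obtain \<I> where I: "\<I> \<in> families B" "vari x B - e/2 < qsum x \<I>"
    using vari_approx[OF e] .
  obtain \<J> where J: "\<J> \<in> families C" "vari x C - e/2 < qsum x \<J>"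
    using vari_approx[OF e] .
  have "qsum x \<I> + qsum x \<J> \<le> vari x (B \<union> C)"
    unfolding families_Un(2)[OF I(1) J(1) assms(2), symmetric]
    by (rule vari_upper[OF x families_Un(1)[OF I(1) J(1) assms(2)]])
  also have "\<dots> \<le> vari x E" using vari_mono[OF x assms(3)] .
  finally show "vari x B + vari x C \<le> vari x E + e" using I J by linarith
qed

lemma vari_block:
  assumes "sqbd x c" "block A" "A \<subseteq> B"
  shows "(sum x A)\<^sup>2 \<le> vari x B"
  using vari_upper[OF assms(1) singleton_in_families[OF assms(2,3)]] by (simp add: qsum_def)

lemma vari_initial:
  assumes "sqbd x c" "0 < e"
  obtains m where "vari x UNIV - e < vari x {..<m}"
proof -
  obtain \<I> where I: "\<I> \<in> families UNIV" "vari x UNIV - e < qsum x \<I>"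
    using vari_approx[OF assms(2)] .
  have "finite (\<Union>\<I>)" using familiesD(1,2)[OF I(1)] block_finite by blast
  then obtain m where "\<Union>\<I> \<subseteq> {..<m}" using finite_nat_bounded by blast
  then have "\<I> \<in> families {..<m}" using familiesD(1-3)[OF I(1)] by (intro familiesI)
  from vari_upper[OF assms(1) this] I(2) show ?thesis by (intro that[of m]) linarith
qed

text \<open>A nearly optimal family occupies only finitely many positions, and by superadditivity
  little is left for the positions beyond it. The convergence of all series below has this
  source.\<close>

lemma vari_tail_small:
  assumes x: "sqbd x c" and e: "0 < e"
  obtains m where "\<And>n. m \<le> n \<Longrightarrow> vari x {n..} < e"
proof -
  obtain m where m: "vari x UNIV - e < vari x {..<m}" using vari_initial[OF x e] .
  have "vari x {n..} < e" if "m \<le> n" for n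
  proof -
    have "vari x {..<m} + vari x {n..} \<le> vari x UNIV"
      using that by (intro vari_superadd[OF x]) auto
    then show ?thesis using m by linarith
  qed
  then show ?thesis using that by blast
qed

subsection \<open>The James norm in terms of finite blocks\<close>

lemma isum_tendsto:
  assumes "summable (\<lambda>k. if k \<in> I then x k else 0)"
  shows "(\<lambda>n. sum x (I \<inter> {..<n})) \<longlonglongrightarrow> isum x I"
proof -
  have "(\<Sum>k<n. if k \<in> I then x k else 0) = sum x (I \<inter> {..<n})" for n
    by (simp add: sum.inter_restrict[of "{..<n}" x I, symmetric] Int_commute)
  then show ?thesis using summable_LIMSEQ[OF assms] by (simp add: isum_def)
qed

lemma isum_finite: "finite A \<Longrightarrow> isum x A = sum x A"
  unfolding isum_def using sums_If_finite_set[of A x] sums_unique by force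

lemma sqbd_summable:
  assumes x: "sqbd x c" and I: "nat_interval I"
  shows "summable (\<lambda>k. if k \<in> I then x k else 0)"
  unfolding summable_Cauchy
proof (intro allI impI)
  fix e :: real assume e: "0 < e"
  then obtain m where m: "\<And>n. m \<le> n \<Longrightarrow> vari x {n..} < e\<^sup>2"
    using vari_tail_small[OF x, of "e\<^sup>2"] by (metis zero_less_power)
  have "norm (\<Sum>k\<in>{p..<n}. if k \<in> I then x k else 0) < e" if "m \<le> p" for p n
  proof -
    have "block ({p..<n} \<inter> (I \<inter> {..<n}))"
      by (intro block_Int block_Int_lessThan I) simp
    then have "(sum x ({p..<n} \<inter> (I \<inter> {..<n})))\<^sup>2 \<le> vari x {p..}"
      by (intro vari_block[OF x]) auto
    also have "\<dots> < e\<^sup>2" using m[OF that] .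
    also have "{p..<n} \<inter> (I \<inter> {..<n}) = {p..<n} \<inter> I" by auto
    finally have "\<bar>sum x ({p..<n} \<inter> I)\<bar> < e"
      using e by (metis abs_of_pos abs_square_less_1 power2_less_imp_less power2_abs abs_ge_zero less_imp_le)
    then show ?thesis by (simp add: sum.inter_restrict)
  qed
  then show "\<exists>N. \<forall>p\<ge>N. \<forall>n. norm (\<Sum>k\<in>{p..<n}. if k \<in> I then x k else 0) < e" by blast
qed

lemma sqbd_isum:
  assumes x: "sqbd x c" and fin: "finite S" and I: "\<And>i. i \<in> S \<Longrightarrow> nat_interval (I i)"
    and disj: "\<And>i j. i \<in> S \<Longrightarrow> j \<in> S \<Longrightarrow> i \<noteq> j \<Longrightarrow> I i \<inter> I j = {}"
  shows "(\<Sum>i\<in>S. (isum x (I i))\<^sup>2) \<le> c"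
proof (rule LIMSEQ_le_const2)
  show "(\<lambda>n. \<Sum>i\<in>S. (sum x (I i \<inter> {..<n}))\<^sup>2) \<longlonglongrightarrow> (\<Sum>i\<in>S. (isum x (I i))\<^sup>2)"
    by (intro tendsto_intros isum_tendsto sqbd_summable[OF x] I)
  have "(\<Sum>i\<in>S. (sum x (I i \<inter> {..<n}))\<^sup>2) \<le> c" for n
  proof -
    let ?T = "\<lambda>i. I i \<inter> {..<n}"
    have d: "?T i \<inter> ?T j = {}" if "i \<in> S" "j \<in> S" "i \<noteq> j" for i j
      using disj[OF that] by blast
    have bl: "block (?T i)" if "i \<in> S" for i using block_Int_lessThan I that by blast
    have "qsum x (?T ` S) \<le> c"
      by (rule sqbdD[OF x], rule qsum_image_family(1)[OF fin bl d subset_UNIV])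
    also have "qsum x (?T ` S) = (\<Sum>i\<in>S. (sum x (?T i))\<^sup>2)"
      by (rule qsum_image_family(2)[OF fin bl d subset_UNIV])
    finally show ?thesis .
  qed
  then show "\<exists>N. \<forall>n\<ge>N. (\<Sum>i\<in>S. (sum x (I i \<inter> {..<n}))\<^sup>2) \<le> c" by blast
qed

lemma jvals_le:
  assumes "sqbd x c" "v \<in> jvals x"
  shows "v \<le> c"
proof -
  obtain \<I> where "v = (\<Sum>I\<in>\<I>. (isum x I)\<^sup>2)" "finite \<I>" "\<forall>I\<in>\<I>. nat_interval I" "disjoint \<I>"
    using assms(2) unfolding jvals_def by blast
  then show ?thesis using sqbd_isum[OF assms(1), of \<I> "\<lambda>I. I"] disjointD by blast
qed

lemma qsum_in_jvals:
  assumes I: "\<I> \<in> families UNIV"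
  shows "\<exists>v\<in>jvals x. qsum x \<I> \<le> v"
proof (cases "\<I> \<subseteq> {{}}")
  \<comment> \<open>\<open>jvals\<close> asks for a nonempty family of nonempty intervals; when
    every block is empty, \<open>{0}\<close> serves as a substitute.\<close>
  case True
  have "nat_interval {0}" by (simp add: nat_interval_def)
  then have "(isum x {0})\<^sup>2 \<in> jvals x"
    unfolding jvals_def by (intro CollectI exI[of _ "{{0}}"]) simp
  moreover have "qsum x \<I> = 0" unfolding qsum_def using True by (intro sum.neutral) auto
  ultimately show ?thesis by (metis zero_le_power2)
next
  case False
  note I' = familiesD[OF I]
  have "qsum x \<I> = (\<Sum>I\<in>\<I> - {{}}. (sum x I)\<^sup>2)"
    unfolding qsum_def using I'(1) by (intro sum.mono_neutral_right) auto
  also have "\<dots> = (\<Sum>I\<in>\<I> - {{}}. (isum x I)\<^sup>2)"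
    by (intro sum.cong refl) (simp add: isum_finite block_finite I'(2))
  also have "\<dots> \<in> jvals x"
    unfolding jvals_def using False I' block_nat_interval disjoint_def[of "\<I>"]
    by (intro CollectI exI[of _ "\<I> - {{}}"]) (auto simp: disjoint_def)
  finally show ?thesis by blast
qed

lemma jvals_nonempty: "jvals x \<noteq> {}"
  using qsum_in_jvals[of "{}" x] by auto

lemma sqbd_imp_James:
  assumes x: "sqbd x c"
  shows "x \<in> James" "(jnorm x)\<^sup>2 \<le> c"
proof -
  show "x \<in> James"
    unfolding James_def using sqbd_summable[OF x] jvals_le[OF x] by (auto intro!: bdd_aboveI)
  have "Sup (jvals x) \<le> c" using jvals_le[OF x] jvals_nonempty by (intro cSup_least)
  moreover obtain v where "v \<in> jvals x" "0 \<le> v"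
    using qsum_in_jvals[of "{}" x] by auto
  then have "0 \<le> Sup (jvals x)"
    using cSup_upper[of v "jvals x"] jvals_le[OF x] by (meson bdd_aboveI order_trans)
  ultimately show "(jnorm x)\<^sup>2 \<le> c" by (simp add: jnorm_def)
qed

lemma jnorm_sqbd:
  assumes "x \<in> James"
  shows "sqbd x ((jnorm x)\<^sup>2)" "0 \<le> jnorm x"
proof -
  have bdd: "bdd_above (jvals x)" using assms by (simp add: James_def)
  have le: "qsum x \<I> \<le> Sup (jvals x)" if "\<I> \<in> families UNIV" for \<I>
    using qsum_in_jvals[OF that, of x] cSup_upper[OF _ bdd] by (meson order_trans)
  have "0 \<le> Sup (jvals x)" using le[OF empty_in_families] by simp
  then show "sqbd x ((jnorm x)\<^sup>2)" "0 \<le> jnorm x"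
    using le by (simp_all add: sqbd_def jnorm_def)
qed

lemma James_ball_iff: "x \<in> James_ball \<longleftrightarrow> sqbd x 1"
proof
  assume "x \<in> James_ball"
  then have x: "x \<in> James" "jnorm x \<le> 1" by (simp_all add: James_ball_def)
  have "(jnorm x)\<^sup>2 \<le> 1" using jnorm_sqbd(2)[OF x(1)] x(2) by (simp add: power_le_one)
  then show "sqbd x 1" using sqbd_mono[OF jnorm_sqbd(1)[OF x(1)]] by blast
next
  assume "sqbd x 1"
  from sqbd_imp_James[OF this] show "x \<in> James_ball"
    by (simp add: James_ball_def) (metis abs_square_le_1 abs_le_D1)
qed

text \<open>The crude bound comes from
  \<open>(u + v)\<^sup>2 \<le> 2 * u\<^sup>2 + 2 * v\<^sup>2\<close>; its purpose is that
  \<open>James\<close> is closed under addition.\<close>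

lemma sqbd_add:
  assumes x: "sqbd x c" and y: "sqbd y d"
  shows "sqbd (\<lambda>k. x k + y k) (2 * c + 2 * d)"
  unfolding sqbd_def
proof
  fix \<I> assume I: "\<I> \<in> families UNIV"
  have "qsum (\<lambda>k. x k + y k) \<I> \<le> (\<Sum>I\<in>\<I>. 2 * (sum x I)\<^sup>2 + 2 * (sum y I)\<^sup>2)"
    unfolding qsum_def sum.distrib[of x y]
  proof (rule sum_mono)
    fix I
    have "0 \<le> (sum x I - sum y I)\<^sup>2" by simp
    then show "(sum x I + sum y I)\<^sup>2 \<le> 2 * (sum x I)\<^sup>2 + 2 * (sum y I)\<^sup>2"
      by (simp add: power2_sum power2_diff)
  qed
  also have "\<dots> = 2 * qsum x \<I> + 2 * qsum y \<I>"
    by (simp add: qsum_def sum.distrib sum_distrib_left)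
  also have "\<dots> \<le> 2 * c + 2 * d" using sqbdD[OF x I] sqbdD[OF y I] by linarith
  finally show "qsum (\<lambda>k. x k + y k) \<I> \<le> 2 * c + 2 * d" .
qed

lemma James_add: "x \<in> James \<Longrightarrow> y \<in> James \<Longrightarrow> (\<lambda>k. x k + y k) \<in> James"
  using sqbd_imp_James(1) sqbd_add jnorm_sqbd(1) by blast

lemma James_scale: "x \<in> James \<Longrightarrow> (\<lambda>k. t * x k) \<in> James"
  using sqbd_imp_James(1) sqbd_scale jnorm_sqbd(1) by blast

text \<open>At most one member of a disjoint family contains \<open>k\<close>.\<close>

lemma sum_families_point_le:
  assumes I: "\<I> \<in> families B" and c: "0 \<le> (c::real)"
  shows "(\<Sum>I\<in>\<I>. if k \<in> I then c else 0) \<le> c"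
proof -
  have fin: "finite {I \<in> \<I>. k \<in> I}" using familiesD(1)[OF I] by simp
  have "I = J" if "I \<in> \<I>" "k \<in> I" "J \<in> \<I>" "k \<in> J" for I J
    using disjointD[OF familiesD(3)[OF I] that(1,3)] that(2,4) by blast
  then have "card {I \<in> \<I>. k \<in> I} \<le> Suc 0"
    using fin by (simp add: card_le_Suc0_iff_eq)
  then have "real (card {I \<in> \<I>. k \<in> I}) * c \<le> 1 * c" using c by (intro mult_right_mono) auto
  then show ?thesis using familiesD(1)[OF I] by (simp flip: sum.inter_filter)
qed

definition unit_seq :: "nat \<Rightarrow> nat \<Rightarrow> real" where
  "unit_seq k = (\<lambda>i. if i = k then 1 else 0)"

lemma sqbd_unit_seq: "sqbd (unit_seq k) 1"
  unfolding sqbd_def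
proof
  fix \<I> assume I: "\<I> \<in> families UNIV"
  have "qsum (unit_seq k) \<I> = (\<Sum>I\<in>\<I>. if k \<in> I then 1 else 0)"
    unfolding qsum_def unit_seq_def
    by (intro sum.cong refl) (simp add: block_finite familiesD(2)[OF I])
  also have "\<dots> \<le> 1" by (rule sum_families_point_le[OF I]) simp
  finally show "qsum (unit_seq k) \<I> \<le> 1" .
qed

lemma unit_seq_James: "unit_seq k \<in> James"
  using sqbd_imp_James(1)[OF sqbd_unit_seq] .

lemma James_cutoff: "(\<lambda>k. if k < n then x k else 0) \<in> James"
proof (induction n)
  case 0
  have "(\<lambda>k. 0 * unit_seq 0 k) \<in> James" by (intro James_scale unit_seq_James)
  then show ?case by simp
next
  case (Suc n)
  have "(\<lambda>k. (if k < n then x k else 0) + x n * unit_seq n k) \<in> James"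
    by (intro James_add James_scale unit_seq_James Suc)
  also have "(\<lambda>k. (if k < n then x k else 0) + x n * unit_seq n k) = (\<lambda>k. if k < Suc n then x k else 0)"
    by (auto simp: unit_seq_def less_Suc_eq)
  finally show ?case .
qed

subsection \<open>Functionals on the James space\<close>

lemma James_dual_add:
  "f \<in> James_dual \<Longrightarrow> x \<in> James \<Longrightarrow> y \<in> James \<Longrightarrow> f (\<lambda>k. x k + y k) = f x + f y"
  by (simp add: James_dual_def)

lemma James_dual_scale: "f \<in> James_dual \<Longrightarrow> x \<in> James \<Longrightarrow> f (\<lambda>k. t * x k) = t * f x"
  by (simp add: James_dual_def)

lemma James_dual_cutoff:
  assumes f: "f \<in> James_dual"
  shows "f (\<lambda>k. if k < n then x k else 0) = (\<Sum>k<n. x k * f (unit_seq k))"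
proof (induction n)
  case 0
  show ?case using James_dual_scale[OF f unit_seq_James, of 0] by simp
next
  case (Suc n)
  have "f (\<lambda>k. if k < Suc n then x k else 0)
      = f (\<lambda>k. (if k < n then x k else 0) + x n * unit_seq n k)"
    by (rule arg_cong[of _ _ f]) (auto simp: unit_seq_def less_Suc_eq)
  also have "\<dots> = (\<Sum>k<Suc n. x k * f (unit_seq k))"
    using Suc by (simp add: James_dual_add[OF f James_cutoff James_scale[OF unit_seq_James]]
        James_dual_scale[OF f unit_seq_James])
  finally show ?case .
qed

lemma sqbd_tail:
  assumes x: "sqbd x c"
  shows "sqbd (\<lambda>k. if k < n then 0 else x k) (vari x {n..})"
  unfolding sqbd_def
proof
  fix \<I> assume I: "\<I> \<in> families UNIV"
  have bl: "block (I \<inter> {n..})" if "I \<in> \<I>" for I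
  proof (rule blockI)
    show "finite (I \<inter> {n..})" using familiesD(2)[OF I that] block_finite by simp
    fix a b c assume "a \<in> I \<inter> {n..}" "c \<in> I \<inter> {n..}" "a \<le> b" "b \<le> c"
    then show "b \<in> I \<inter> {n..}" using block_convex[OF familiesD(2)[OF I that], of a c b] by simp
  qed
  have disj: "(I \<inter> {n..}) \<inter> (J \<inter> {n..}) = {}" if "I \<in> \<I>" "J \<in> \<I>" "I \<noteq> J" for I J
    using disjointD[OF familiesD(3)[OF I] that] by blast
  have "qsum (\<lambda>k. if k < n then 0 else x k) \<I> = (\<Sum>I\<in>\<I>. (sum x (I \<inter> {n..}))\<^sup>2)"
    unfolding qsum_def
  proof (intro sum.cong refl)
    fix I assume "I \<in> \<I>"
    then have "finite I" using familiesD(2)[OF I] block_finite by blast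
    then have "(\<Sum>k\<in>I. if k < n then 0 else x k) = sum x (I \<inter> {n..})"
      by (subst sum.inter_restrict) (auto intro!: sum.cong)
    then show "(\<Sum>k\<in>I. if k < n then 0 else x k)\<^sup>2 = (sum x (I \<inter> {n..}))\<^sup>2" by simp
  qed
  also have "\<dots> = qsum x ((\<lambda>I. I \<inter> {n..}) ` \<I>)"
    by (rule qsum_image_family(2)[symmetric, OF familiesD(1)[OF I] bl disj subset_UNIV])
  also have "\<dots> \<le> vari x {n..}"
    by (rule vari_upper[OF x], rule qsum_image_family(1)[OF familiesD(1)[OF I] bl disj Int_lower2])
  finally show "qsum (\<lambda>k. if k < n then 0 else x k) \<I> \<le> vari x {n..}" .
qed

text \<open>The remainder of \<open>x\<close> from \<open>n\<close> on has squared norm at most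
  \<open>vari x {n..}\<close>, which tends to 0. Hence the unit vectors form a basis and their
  images determine a continuous functional.\<close>

lemma James_dual_expand:
  assumes f: "f \<in> James_dual" and x: "x \<in> James"
  shows "(\<lambda>n. \<Sum>k<n. x k * f (unit_seq k)) \<longlonglongrightarrow> f x"
proof (rule LIMSEQ_I)
  fix e :: real assume e: "0 < e"
  obtain C where C: "\<And>y. y \<in> James \<Longrightarrow> \<bar>f y\<bar> \<le> C * jnorm y"
    using f unfolding James_dual_def by blast
  note sx = jnorm_sqbd(1)[OF x]
  define d where "d = e / (\<bar>C\<bar> + 1)"
  have d: "0 < d" using e by (simp add: d_def)
  obtain m where m: "\<And>n. m \<le> n \<Longrightarrow> vari x {n..} < d\<^sup>2"
    using vari_tail_small[OF sx, of "d\<^sup>2"] d by (metis zero_less_power)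
  have "norm ((\<Sum>k<n. x k * f (unit_seq k)) - f x) < e" if "m \<le> n" for n
  proof -
    let ?y = "\<lambda>k. if k < n then 0 else x k"
    note sy = sqbd_tail[OF sx, of n]
    have yJ: "?y \<in> James" and y2: "(jnorm ?y)\<^sup>2 < d\<^sup>2"
      using sqbd_imp_James[OF sy] m[OF that] by auto
    have yd: "jnorm ?y < d" using y2 d by (meson power2_less_imp_less less_imp_le)
    have "f x = f (\<lambda>k. (if k < n then x k else 0) + ?y k)"
      by (rule arg_cong[of _ _ f]) auto
    also have "\<dots> = f (\<lambda>k. if k < n then x k else 0) + f ?y"
      by (rule James_dual_add[OF f James_cutoff yJ])
    finally have "f x = f (\<lambda>k. if k < n then x k else 0) + f ?y" .
    then have "f x - (\<Sum>k<n. x k * f (unit_seq k)) = f ?y"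
      by (simp add: James_dual_cutoff[OF f])
    moreover have "\<bar>f ?y\<bar> \<le> \<bar>C\<bar> * jnorm ?y"
      using C[OF yJ] jnorm_sqbd(2)[OF yJ] by (meson abs_ge_self mult_right_mono order_trans)
    moreover have "\<bar>C\<bar> * jnorm ?y \<le> \<bar>C\<bar> * d" using yd by (intro mult_left_mono) auto
    moreover have "\<bar>C\<bar> * d < e" using e by (simp add: d_def field_simps)
    ultimately show ?thesis by simp
  qed
  then show "\<exists>N. \<forall>n\<ge>N. norm ((\<Sum>k<n. x k * f (unit_seq k)) - f x) < e" by blast
qed

lemma James_dual_eqI:
  assumes "f \<in> James_dual" "g \<in> James_dual" "\<And>k. f (unit_seq k) = g (unit_seq k)"
  shows "f = g"
proof
  fix x show "f x = g x"
  proof (cases "x \<in> James")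
    case True
    show ?thesis
      using LIMSEQ_unique[OF James_dual_expand[OF assms(1) True]] James_dual_expand[OF assms(2) True]
      by (simp add: assms(3))
  next
    case False
    then show ?thesis using assms(1,2) by (simp add: James_dual_def)
  qed
qed

lemma James_dual_ball_sqbd:
  assumes f: "f \<in> James_dual_ball" and x: "sqbd x c"
  shows "(f x)\<^sup>2 \<le> c"
proof (rule field_le_epsilon)
  fix e :: real assume e: "0 < e"
  have fd: "f \<in> James_dual" and le: "dual_norm f \<le> 1"
    using f by (simp_all add: James_dual_ball_def)
  obtain C where C: "\<And>y. y \<in> James \<Longrightarrow> \<bar>f y\<bar> \<le> C * jnorm y"
    using fd unfolding James_dual_def by blast
  have "\<bar>f y\<bar> \<le> \<bar>C\<bar>" if "y \<in> James_ball" for y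
  proof -
    have y: "y \<in> James" "jnorm y \<le> 1" using that by (simp_all add: James_ball_def)
    have "\<bar>f y\<bar> \<le> \<bar>C\<bar> * jnorm y"
      using C[OF y(1)] jnorm_sqbd(2)[OF y(1)] by (meson abs_ge_self mult_right_mono order_trans)
    also have "\<dots> \<le> \<bar>C\<bar>" using y(2) by (simp add: mult_left_le)
    finally show ?thesis .
  qed
  then have bdd: "bdd_above {\<bar>f y\<bar> |y. y \<in> James_ball}" by (auto intro!: bdd_aboveI[of _ "\<bar>C\<bar>"])
  \<comment> \<open>The summand \<open>e\<close> keeps \<open>t\<close> positive when
    \<open>c = 0\<close>, so that dividing by \<open>t\<close> is possible.\<close>
  define t where "t = sqrt (c + e)"
  have t: "0 < t" "t\<^sup>2 = c + e" using e sqbd_nonneg[OF x] by (simp_all add: t_def)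
  have "sqbd (\<lambda>k. (1/t) * x k) ((1/t)\<^sup>2 * c)" by (rule sqbd_scale[OF x])
  then have "(\<lambda>k. (1/t) * x k) \<in> James_ball"
    unfolding James_ball_iff
    by (rule sqbd_mono) (use t e sqbd_nonneg[OF x] in \<open>simp add: power_divide divide_simps\<close>)
  then have "\<bar>f (\<lambda>k. (1/t) * x k)\<bar> \<le> dual_norm f"
    unfolding dual_norm_def by (intro cSup_upper bdd) blast
  then have "\<bar>(1/t) * f x\<bar> \<le> 1"
    using le James_dual_scale[OF fd sqbd_imp_James(1)[OF x], of "1/t"] by simp
  then have "\<bar>f x\<bar> \<le> \<bar>t\<bar>" using t by (simp add: abs_mult field_simps)
  then show "(f x)\<^sup>2 \<le> c + e" using t(2) by (metis abs_le_square_iff)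
qed

text \<open>A one-sided bound is enough, since the ball is symmetric and \<open>f\<close> is
  homogeneous.\<close>

lemma James_dual_ballI:
  assumes add: "\<And>x y. x \<in> James \<Longrightarrow> y \<in> James \<Longrightarrow> f (\<lambda>k. x k + y k) = f x + f y"
    and scale: "\<And>x c. x \<in> James \<Longrightarrow> f (\<lambda>k. c * x k) = c * f x"
    and bd: "\<And>x. sqbd x 1 \<Longrightarrow> f x \<le> 1"
    and zero: "\<And>x. x \<notin> James \<Longrightarrow> f x = 0"
  shows "f \<in> James_dual_ball"
proof -
  have le1: "\<bar>f x\<bar> \<le> 1" if "sqbd x 1" for x
  proof -
    have "sqbd (\<lambda>k. (-1) * x k) 1" using sqbd_scale[OF that, of "-1"] by simp
    from bd[OF this] scale[OF sqbd_imp_James(1)[OF that], of "-1"] bd[OF that]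
    show ?thesis by simp
  qed
  have "\<bar>f x\<bar> \<le> jnorm x" if x: "x \<in> James" for x
  proof (rule field_le_epsilon)
    fix e :: real assume e: "0 < e"
    define t where "t = jnorm x + e"
    have t: "0 < t" "jnorm x \<le> t" using jnorm_sqbd(2)[OF x] e by (simp_all add: t_def)
    have "(1/t)\<^sup>2 * (jnorm x)\<^sup>2 \<le> 1"
      using t jnorm_sqbd(2)[OF x] by (simp add: power_divide divide_simps power_mono)
    then have "sqbd (\<lambda>k. (1/t) * x k) 1"
      using sqbd_mono[OF sqbd_scale[OF jnorm_sqbd(1)[OF x]]] by blast
    from le1[OF this] have "\<bar>(1/t) * f x\<bar> \<le> 1" using scale[OF x, of "1/t"] by simp
    then show "\<bar>f x\<bar> \<le> jnorm x + e" using t by (simp add: abs_mult field_simps t_def)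
  qed
  then have "f \<in> James_dual"
    unfolding James_dual_def using add scale zero by (intro CollectI conjI exI[of _ 1]) auto
  moreover have "dual_norm f \<le> 1"
    unfolding dual_norm_def
  proof (rule cSup_least)
    show "{\<bar>f x\<bar> |x. x \<in> James_ball} \<noteq> {}" using sqbd_unit_seq James_ball_iff by blast
  qed (use le1 James_ball_iff in auto)
  ultimately show ?thesis by (simp add: James_dual_ball_def)
qed

subsection \<open>Extreme points of the unit ball of the James space\<close>

lemma extreme_ptD:
  assumes "extreme_pt z S" "a \<in> S" "b \<in> S" "0 < t" "t < 1" "\<And>k. z k = t * a k + (1 - t) * b k"
  shows "a = b"
proof -
  have "z = (\<lambda>k. t * a k + (1 - t) * b k)" using assms(6) by (rule ext)
  then show ?thesis using assms(1-5) unfolding extreme_pt_def by blast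
qed

lemma vari_squares:
  assumes x: "sqbd x c" and A: "finite A" "A \<subseteq> B"
  shows "(\<Sum>k\<in>A. (x k)\<^sup>2) \<le> vari x B"
proof -
  have bl: "block {k}" if "k \<in> A" for k by simp
  have d: "{i} \<inter> {j} = {}" if "i \<in> A" "j \<in> A" "i \<noteq> j" for i j using that by simp
  have sub: "{i} \<subseteq> B" if "i \<in> A" for i using that A(2) by blast
  have "qsum x ((\<lambda>k. {k}) ` A) \<le> vari x B"
    by (rule vari_upper[OF x], rule qsum_image_family(1)[OF A(1) bl d sub])
  also have "qsum x ((\<lambda>k. {k}) ` A) = (\<Sum>k\<in>A. (sum x {k})\<^sup>2)"
    by (rule qsum_image_family(2)[OF A(1) bl d sub])
  finally show ?thesis by simp
qed

lemma sqbd_squares: "sqbd x c \<Longrightarrow> finite A \<Longrightarrow> (\<Sum>k\<in>A. (x k)\<^sup>2) \<le> c"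
  using vari_squares[of x c A UNIV] vari_le[of x c UNIV] by simp

text \<open>Singletons form a block family, so the James ball lies in the unit ball of l2, and
  \<open>a\<close> is on the sphere of that strictly convex ball. In the expansion of
  \<open>(t * b + (1 - t) * c)\<^sup>2\<close> the term \<open>t * (1 - t) * (b - c)\<^sup>2\<close>
  measures the strictness.\<close>

lemma extreme_James_ball_if:
  assumes a: "sqbd a 1" and sums: "(\<lambda>i. (a i)\<^sup>2) sums 1"
  shows "extreme_pt a James_ball"
  unfolding extreme_pt_def James_ball_iff
proof (intro conjI a ballI allI impI)
  fix b c and t :: real
  assume "b \<in> James_ball" "c \<in> James_ball"
    and *: "0 < t \<and> t < 1 \<and> a = (\<lambda>k. t * b k + (1 - t) * c k)"
  then have b: "sqbd b 1" and c: "sqbd c 1" by (simp_all add: James_ball_iff)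
  have lim: "(\<lambda>n. \<Sum>i<n. (a i)\<^sup>2) \<longlonglongrightarrow> 1" using sums by (simp add: sums_def)
  show "b = c"
  proof
    fix j
    have le: "t * (1 - t) * (b j - c j)\<^sup>2 \<le> 1 - (\<Sum>i<n. (a i)\<^sup>2)" if "j < n" for n
    proof -
      have "(a i)\<^sup>2 = t * (b i)\<^sup>2 + (1 - t) * (c i)\<^sup>2 - t * (1 - t) * (b i - c i)\<^sup>2" for i
        using * by (simp add: power2_eq_square algebra_simps)
      then have "(\<Sum>i<n. (a i)\<^sup>2) = t * (\<Sum>i<n. (b i)\<^sup>2) + (1 - t) * (\<Sum>i<n. (c i)\<^sup>2)
          - t * (1 - t) * (\<Sum>i<n. (b i - c i)\<^sup>2)"
        by (simp add: sum.distrib sum_subtractf sum_distrib_left)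
      moreover have "t * (\<Sum>i<n. (b i)\<^sup>2) \<le> t * 1"
        using sqbd_squares[OF b, of "{..<n}"] * by (intro mult_left_mono) auto
      moreover have "(1 - t) * (\<Sum>i<n. (c i)\<^sup>2) \<le> (1 - t) * 1"
        using sqbd_squares[OF c, of "{..<n}"] * by (intro mult_left_mono) auto
      moreover have "t * (1 - t) * (b j - c j)\<^sup>2 \<le> t * (1 - t) * (\<Sum>i<n. (b i - c i)\<^sup>2)"
        using * that by (intro mult_left_mono member_le_sum) auto
      ultimately show ?thesis by simp
    qed
    have "(\<lambda>n. 1 - (\<Sum>i<n. (a i)\<^sup>2)) \<longlonglongrightarrow> 1 - 1" by (intro tendsto_intros lim)
    then have "t * (1 - t) * (b j - c j)\<^sup>2 \<le> 1 - 1"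
      by (rule LIMSEQ_le_const) (use le in \<open>auto intro!: exI[of _ "Suc j"]\<close>)
    moreover have "0 < t * (1 - t)" using * by simp
    ultimately have "(b j - c j)\<^sup>2 \<le> 0"
      by (metis diff_self linorder_not_le mult_pos_pos)
    then show "b j = c j" by simp
  qed
qed

text \<open>Moving \<open>s\<close> from entry \<open>Suc p\<close> to entry \<open>p\<close> changes no block that contains both.\<close>

lemma perturb_sqbd:
  assumes a: "sqbd a 1" and s: "vari a {..p} + vari a {Suc p..} + 2 * (2 * \<bar>s\<bar> + s\<^sup>2) \<le> 1"
  shows "sqbd (\<lambda>k. a k + s * (unit_seq p k - unit_seq (Suc p) k)) 1" (is "sqbd ?y 1")
  unfolding sqbd_def
proof
  fix \<I> assume I: "\<I> \<in> families UNIV"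
  have sumy: "sum ?y I = sum a I + s * ((if p \<in> I then 1 else 0) - (if Suc p \<in> I then 1 else 0))"
    if "I \<in> \<I>" for I
    using block_finite[OF familiesD(2)[OF I that]]
    by (simp add: sum.distrib sum_subtractf unit_seq_def flip: sum_distrib_left)
  show "qsum ?y \<I> \<le> 1"
  proof (cases "\<exists>J\<in>\<I>. p \<in> J \<and> Suc p \<in> J")
    case True
    then obtain J where J: "J \<in> \<I>" "p \<in> J" "Suc p \<in> J" by blast
    have "p \<in> I \<longleftrightarrow> Suc p \<in> I" if "I \<in> \<I>" for I
      using disjointD[OF familiesD(3)[OF I] that J(1)] J by blast
    then have "qsum ?y \<I> = qsum a \<I>"
      unfolding qsum_def by (intro sum.cong refl) (simp add: sumy)
    then show ?thesis using sqbdD[OF a I] by simp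
  next
    case False
    \<comment> \<open>No block contains both \<open>p\<close> and \<open>Suc p\<close>, so the
      family splits at the gap. Block sums of \<open>a\<close> are at most 1 in absolute value, so a
      square grows by at most \<open>?D\<close>, and at most two blocks are affected.\<close>
    let ?D = "2 * \<bar>s\<bar> + s\<^sup>2"
    let ?L = "{I \<in> \<I>. I \<subseteq> {..p}}"
    have fin: "finite \<I>" using familiesD(1)[OF I] .
    have right: "I \<subseteq> {Suc p..}" if II: "I \<in> \<I>" and nI: "\<not> I \<subseteq> {..p}" for I
    proof
      fix i assume i: "i \<in> I"
      obtain j where j: "j \<in> I" "Suc p \<le> j" using nI by (metis atMost_iff not_less_eq_eq subsetI)
      show "i \<in> {Suc p..}"
      proof (rule ccontr)
        assume "i \<notin> {Suc p..}"
        then have "i \<le> p" by simp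
        then have "p \<in> I" "Suc p \<in> I"
          using block_convex[OF familiesD(2)[OF I II] i j(1)] j(2) by simp_all
        then show False using False II by blast
      qed
    qed
    have fL: "?L \<in> families {..p}"
      using familiesD(1-3)[OF I] by (intro familiesI) (auto simp: disjoint_def)
    have "\<Union>(\<I> - ?L) \<subseteq> {Suc p..}" using right by blast
    then have fR: "\<I> - ?L \<in> families {Suc p..}"
      using familiesD(1-3)[OF I] by (intro familiesI) (auto simp: disjoint_def)
    have "qsum a \<I> = qsum a ?L + qsum a (\<I> - ?L)"
      unfolding qsum_def using sum.subset_diff[of ?L \<I> "\<lambda>I. (sum a I)\<^sup>2"] fin by simp
    then have qa: "qsum a \<I> \<le> vari a {..p} + vari a {Suc p..}"
      using vari_upper[OF a fL] vari_upper[OF a fR] by linarith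
    have "qsum ?y \<I> \<le> (\<Sum>I\<in>\<I>. (sum a I)\<^sup>2 + (if p \<in> I then ?D else 0) + (if Suc p \<in> I then ?D else 0))"
      unfolding qsum_def
    proof (rule sum_mono)
      fix I assume i: "I \<in> \<I>"
      have 1: "\<bar>sum a I\<bar> \<le> 1" using sqbd_1_abs[OF a familiesD(2)[OF I i]] .
      have "\<bar>s * sum a I\<bar> \<le> \<bar>s\<bar>" using 1 by (simp add: abs_mult mult_left_le)
      then have "(sum a I + s)\<^sup>2 \<le> (sum a I)\<^sup>2 + ?D" "(sum a I - s)\<^sup>2 \<le> (sum a I)\<^sup>2 + ?D"
        by (simp_all add: power2_sum power2_diff abs_le_iff algebra_simps)
      then show "(sum ?y I)\<^sup>2 \<le> (sum a I)\<^sup>2 + (if p \<in> I then ?D else 0) + (if Suc p \<in> I then ?D else 0)"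
        using False i by (auto simp: sumy[OF i])
    qed
    also have "\<dots> = qsum a \<I> + (\<Sum>I\<in>\<I>. if p \<in> I then ?D else 0) + (\<Sum>I\<in>\<I>. if Suc p \<in> I then ?D else 0)"
      by (simp add: qsum_def sum.distrib)
    also have "\<dots> \<le> qsum a \<I> + ?D + ?D"
      by (intro add_mono order_refl sum_families_point_le[OF I]) simp_all
    finally show ?thesis using qa s by simp
  qed
qed

text \<open>If cutting at the gap lost norm, there would be room to move a small mass across the gap
  in both directions without leaving the ball, and \<open>a\<close> would be a midpoint.\<close>

lemma extreme_James_cut:
  assumes a: "extreme_pt a James_ball"
  shows "vari a {..p} + vari a {Suc p..} = 1"
proof (rule ccontr)
  assume ne: "\<not> ?thesis"
  have sa: "sqbd a 1" using a by (simp add: extreme_pt_def James_ball_iff)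
  have "vari a {..p} + vari a {Suc p..} \<le> vari a UNIV" by (rule vari_superadd[OF sa]) auto
  also have "\<dots> \<le> 1" by (rule vari_le[OF sa])
  finally have lt: "vari a {..p} + vari a {Suc p..} < 1" using ne by simp
  \<comment> \<open>The 6 comes from \<open>2 * (2 * t + t\<^sup>2) \<le> 6 * t\<close>, valid for
    \<open>t \<le> 1\<close>.\<close>
  define t where "t = min 1 ((1 - (vari a {..p} + vari a {Suc p..})) / 6)"
  have t: "0 < t" "t \<le> 1" "6 * t \<le> 1 - (vari a {..p} + vari a {Suc p..})"
    using lt by (auto simp: t_def min_def)
  have "t\<^sup>2 \<le> t" using t by (simp add: power2_eq_square mult_left_le)
  let ?y = "\<lambda>s k. a k + s * (unit_seq p k - unit_seq (Suc p) k)"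
  have "sqbd (?y t) 1" "sqbd (?y (-t)) 1"
    by (rule perturb_sqbd[OF sa], use t \<open>t\<^sup>2 \<le> t\<close> in \<open>simp\<close>)+
  then have "?y t \<in> James_ball" "?y (-t) \<in> James_ball" by (simp_all add: James_ball_iff)
  moreover have "a k = (1/2) * ?y t k + (1 - 1/2) * ?y (-t) k" for k by (simp add: algebra_simps)
  ultimately have "?y t = ?y (-t)"
    by (intro extreme_ptD[OF a, of _ _ "1/2"]) simp_all
  then have "?y t p = ?y (-t) p" by metis
  then show False using t by (simp add: unit_seq_def)
qed

text \<open>A family that avoids \<open>p\<close> loses at least \<open>e\<close>, so a family with
  a smaller loss has a member through \<open>p\<close>. This member is \<open>J\<close>, and the
  other members lie in \<open>B - J\<close>.\<close>

lemma vari_near_optimal_block: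
  assumes x: "sqbd x c" and e: "0 < e" and p: "vari x (B - {p}) + e \<le> vari x B"
  obtains J where "block J" "J \<subseteq> B" "p \<in> J" "vari x B - e < (sum x J)\<^sup>2 + vari x (B - J)"
proof -
  obtain \<I> where I: "\<I> \<in> families B" "vari x B - e < qsum x \<I>" using vari_approx[OF e] .
  note I' = familiesD[OF I(1)]
  have "\<not> \<Union>\<I> \<subseteq> B - {p}"
  proof
    assume "\<Union>\<I> \<subseteq> B - {p}"
    then have "\<I> \<in> families (B - {p})" by (intro familiesI I'(1-3))
    then have "qsum x \<I> \<le> vari x (B - {p})" by (rule vari_upper[OF x])
    then show False using I(2) p by linarith
  qed
  then obtain J where J: "J \<in> \<I>" "p \<in> J" using I'(4) by blast
  have "\<Union>(\<I> - {J}) \<subseteq> B - J"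
    using disjointD[OF I'(3) _ J(1)] I'(4) by blast
  moreover have "disjoint (\<I> - {J})" using I'(3) by (simp add: disjoint_def)
  ultimately have "\<I> - {J} \<in> families (B - J)" using I'(1,2) by (intro familiesI) auto
  then have "qsum x (\<I> - {J}) \<le> vari x (B - J)" by (rule vari_upper[OF x])
  moreover have "qsum x \<I> = (sum x J)\<^sup>2 + qsum x (\<I> - {J})"
    unfolding qsum_def using sum.remove[OF I'(1) J(1)] by simp
  ultimately show ?thesis using that[OF I'(2)[OF J(1)]] J I'(4) I(2) by force
qed

text \<open>If the right-hand side were smaller by \<open>d > 0\<close>, blocks \<open>J\<close> in \<open>{p..}\<close> and \<open>K\<close> in \<open>{..p}\<close> that are
  nearly optimal contain \<open>p\<close>, and their remaining sums \<open>r\<close> and \<open>l\<close> have the sign of \<open>a p\<close>; but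
  then the block \<open>K \<union> J\<close> makes the norm of \<open>a\<close> exceed \<open>1\<close>.\<close>

lemma extreme_James_vari_step:
  assumes a: "extreme_pt a James_ball"
  shows "vari a {p..} = (a p)\<^sup>2 + vari a {Suc p..}"
proof (rule ccontr)
  assume ne: "\<not> ?thesis"
  have sa: "sqbd a 1" using a by (simp add: extreme_pt_def James_ball_iff)
  define d where "d = vari a {p..} - (a p)\<^sup>2 - vari a {Suc p..}"
  have "(a p)\<^sup>2 \<le> vari a {p}" using vari_block[OF sa, of "{p}" "{p}"] by simp
  moreover have "vari a {p} + vari a {Suc p..} \<le> vari a {p..}"
    by (rule vari_superadd[OF sa]) auto
  ultimately have d: "0 < d" using ne by (simp add: d_def)
  have right: "vari a {..p} = 1 - vari a {Suc p..}" using extreme_James_cut[OF a, of p] by simp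
  \<comment> \<open>Cutting between \<open>p - 1\<close> and \<open>p\<close> gives this. At
    \<open>p = 0\<close> there is no such gap, and the cut after 0 together with superadditivity
    takes its place.\<close>
  have left: "vari a {p..} = 1 - vari a {..<p}"
  proof (cases p)
    case 0
    have "1 = vari a {..p} + vari a {Suc p..}" using extreme_James_cut[OF a] by simp
    also have "\<dots> \<le> vari a {p..}" by (rule vari_superadd[OF sa]) (auto simp: 0)
    finally have "vari a {p..} = 1" using vari_le[OF sa, of "{p..}"] by linarith
    moreover have "vari a {..<p} = 0"
    proof (rule antisym)
      show "vari a {..<p} \<le> 0"
      proof (rule vari_least)
        fix \<I> assume "\<I> \<in> families {..<p}"
        then have "\<I> \<subseteq> {{}}" using familiesD(4)[of \<I> "{..<p}"] 0 by blast
        then show "qsum a \<I> \<le> 0" unfolding qsum_def by (intro sum_nonpos) auto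
      qed
    qed (rule vari_nonneg[OF sa])
    ultimately show ?thesis by simp
  next
    case (Suc q)
    then show ?thesis using extreme_James_cut[OF a, of q] by (simp add: lessThan_Suc_atMost)
  qed
  \<comment> \<open>Any positive \<open>e < d / 2\<close> would serve: the estimates below yield
    \<open>2 * (a p * r) > d - e\<close>, \<open>2 * (a p * l) > d - e\<close> and
    \<open>2 * (l * r) < 2 * e - d\<close>.\<close>
  define e where "e = d / 3"
  have e: "0 < e" using d by (simp add: e_def)
  have "vari a {Suc p..} + e \<le> vari a {p..}" "vari a {..<p} + e \<le> vari a {..p}"
    using d left right zero_le_power2[of "a p"] d_def e_def by linarith+
  moreover have "{p..} - {p} = {Suc p..}" "{..p} - {p} = {..<p}" by auto
  ultimately have "vari a ({p..} - {p}) + e \<le> vari a {p..}" "vari a ({..p} - {p}) + e \<le> vari a {..p}"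
    by simp_all
  then obtain J K where
    J: "block J" "J \<subseteq> {p..}" "p \<in> J" "vari a {p..} - e < (sum a J)\<^sup>2 + vari a ({p..} - J)" and
    K: "block K" "K \<subseteq> {..p}" "p \<in> K" "vari a {..p} - e < (sum a K)\<^sup>2 + vari a ({..p} - K)"
    using vari_near_optimal_block[OF sa e] by metis
  define r l where "r = sum a (J - {p})" and "l = sum a (K - {p})"
  have sJ: "sum a J = a p + r" and sK: "sum a K = a p + l"
    unfolding r_def l_def using J(1,3) K(1,3) by (simp_all add: sum.remove block_finite)
  have bJ: "block (J - {p})"
  proof (rule blockI)
    fix i j k assume *: "i \<in> J - {p}" "k \<in> J - {p}" "i \<le> j" "j \<le> k"
    then have "p < j" using J(2) by force
    then show "j \<in> J - {p}" using block_convex[OF J(1), of i k j] * by simp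
  qed (simp add: block_finite J(1))
  have bK: "block (K - {p})"
  proof (rule blockI)
    fix i j k assume *: "i \<in> K - {p}" "k \<in> K - {p}" "i \<le> j" "j \<le> k"
    then have "j < p" using K(2) by force
    then show "j \<in> K - {p}" using block_convex[OF K(1), of i k j] * by simp
  qed (simp add: block_finite K(1))
  have bU: "block (K \<union> J)"
  proof (rule blockI)
    fix i j k assume *: "i \<in> K \<union> J" "k \<in> K \<union> J" "i \<le> j" "j \<le> k"
    show "j \<in> K \<union> J"
    proof (cases "j \<le> p")
      case True
      then have "i \<le> p" using *(3) by simp
      then have "i \<in> K" using *(1) J(2) K(3) by (metis UnE atLeast_iff le_antisym subsetD)
      then show ?thesis using block_convex[OF K(1) _ K(3) *(3) True] by blast
    next
      case False
      then have "k \<in> J" using *(2,4) K(2) by (meson UnE atMost_iff le_trans subsetD)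
      then show ?thesis using block_convex[OF J(1) J(3) _ _ *(4)] False by simp
    qed
  qed (simp add: block_finite J(1) K(1))
  have U: "sum a (K \<union> J) = l + a p + r"
  proof -
    have "K \<union> J = (K - {p}) \<union> J" using J(3) by blast
    moreover have "(K - {p}) \<inter> J = {}" using K(2) J(2) by force
    ultimately show ?thesis using J(1) K(1) by (simp add: sum.union_disjoint block_finite sJ l_def)
  qed
  have "r\<^sup>2 \<le> vari a (J - {p})" unfolding r_def by (rule vari_block[OF sa bJ]) simp
  moreover have "vari a (J - {p}) + vari a ({p..} - J) \<le> vari a {Suc p..}"
    by (rule vari_superadd[OF sa]) (use J(2,3) in \<open>auto simp: Suc_le_eq order_le_less\<close>)
  moreover have "l\<^sup>2 \<le> vari a (K - {p})" unfolding l_def by (rule vari_block[OF sa bK]) simp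
  moreover have "vari a (K - {p}) + vari a ({..p} - K) \<le> vari a {..<p}"
    by (rule vari_superadd[OF sa]) (use K(2,3) in \<open>auto simp: order_le_less\<close>)
  moreover have "(l + a p + r)\<^sup>2 \<le> vari a (K \<union> J)"
    using vari_block[OF sa bU, of "K \<union> J"] U by simp
  moreover have "vari a (K \<union> J) + vari a ({..p} - K) \<le> vari a ({..p} \<union> J)"
    by (rule vari_superadd[OF sa]) (use J(2,3) K(2,3) in \<open>auto simp: order_le_less\<close>)
  moreover have "vari a ({..p} \<union> J) + vari a ({p..} - J) \<le> vari a UNIV"
    by (rule vari_superadd[OF sa]) (use J(2,3) in auto)
  moreover have "vari a UNIV \<le> 1" by (rule vari_le[OF sa])
  moreover have "(a p + r)\<^sup>2 = (a p)\<^sup>2 + 2 * (a p * r) + r\<^sup>2" "(a p + l)\<^sup>2 = (a p)\<^sup>2 + 2 * (a p * l) + l\<^sup>2"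
    "(l + a p + r)\<^sup>2 = (a p)\<^sup>2 + r\<^sup>2 + l\<^sup>2 + 2 * (a p * r) + 2 * (a p * l) + 2 * (l * r)"
    by (simp_all add: power2_eq_square algebra_simps)
  moreover note J(4)[unfolded sJ] K(4)[unfolded sK] left right d_def e_def d
  ultimately have ar: "0 < a p * r" and al: "0 < a p * l" and lr: "l * r < 0"
    by linarith+
  have "0 < (a p * r) * (a p * l)" using ar al by simp
  also have "\<dots> = (a p)\<^sup>2 * (l * r)" by (simp add: power2_eq_square)
  finally show False using mult_nonneg_nonpos[OF zero_le_power2[of "a p"] less_imp_le[OF lr]] by simp
qed

text \<open>From left to right, the one-step identity telescopes from
  \<open>vari a {0..} = 1\<close>, and the tail variation tends to 0.\<close>

lemma extreme_James_ball_iff: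
  "extreme_pt a James_ball \<longleftrightarrow> sqbd a 1 \<and> (\<lambda>i. (a i)\<^sup>2) sums 1"
proof
  assume a: "extreme_pt a James_ball"
  then have sa: "sqbd a 1" by (simp add: extreme_pt_def James_ball_iff)
  have "1 = vari a {..0} + vari a {Suc 0..}" by (rule extreme_James_cut[OF a, symmetric])
  also have "\<dots> \<le> vari a UNIV" by (rule vari_superadd[OF sa]) auto
  finally have 1: "vari a {0..} = 1" using vari_le[OF sa, of UNIV] by (simp add: atLeast_0)
  have step: "(\<Sum>k<n. (a k)\<^sup>2) = 1 - vari a {n..}" for n
  proof (induction n)
    case (Suc n)
    then show ?case using extreme_James_vari_step[OF a, of n] by simp
  qed (use 1 in simp)
  have "(\<lambda>n. vari a {n..}) \<longlonglongrightarrow> 0"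
  proof (rule LIMSEQ_I)
    fix e :: real assume "0 < e"
    then obtain m where "\<And>n. m \<le> n \<Longrightarrow> vari a {n..} < e" using vari_tail_small[OF sa] by metis
    then show "\<exists>N. \<forall>n\<ge>N. norm (vari a {n..} - 0) < e" using vari_nonneg[OF sa] by auto
  qed
  then have "(\<lambda>n. 1 - vari a {n..}) \<longlonglongrightarrow> 1 - 0" by (intro tendsto_intros)
  then show "sqbd a 1 \<and> (\<lambda>i. (a i)\<^sup>2) sums 1" using sa step by (simp add: sums_def)
next
  assume "sqbd a 1 \<and> (\<lambda>i. (a i)\<^sup>2) sums 1"
  then show "extreme_pt a James_ball" using extreme_James_ball_if by blast
qed

subsection \<open>Functionals given by intervals\<close>

lemma sums_1I:
  fixes f :: "nat \<Rightarrow> real"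
  assumes nonneg: "\<And>k. 0 \<le> f k" and le: "\<And>n. (\<Sum>k<n. f k) \<le> 1"
    and ex: "\<And>e. 0 < e \<Longrightarrow> \<exists>K. 1 - e < (\<Sum>k<K. f k)"
  shows "f sums 1"
  unfolding sums_def
proof (rule LIMSEQ_I)
  fix e :: real assume "0 < e"
  then obtain K where K: "1 - e < (\<Sum>k<K. f k)" using ex by blast
  have "norm ((\<Sum>k<n. f k) - 1) < e" if "K \<le> n" for n
  proof -
    have "(\<Sum>k<K. f k) \<le> (\<Sum>k<n. f k)" using that nonneg by (intro sum_mono2) auto
    then show ?thesis using K le[of n] by simp
  qed
  then show "\<exists>N. \<forall>n\<ge>N. norm ((\<Sum>k<n. f k) - 1) < e" by blast
qed

context
  fixes v :: "nat \<Rightarrow> real" and R :: "nat \<Rightarrow> nat set"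
  assumes R: "\<And>i. v i \<noteq> 0 \<Longrightarrow> nat_interval (R i)"
    and disj: "\<And>i j. v i \<noteq> 0 \<Longrightarrow> v j \<noteq> 0 \<Longrightarrow> i \<noteq> j \<Longrightarrow> R i \<inter> R j = {}"
    and v: "\<And>n. (\<Sum>i<n. (v i)\<^sup>2) \<le> 1"
begin

text \<open>Each product is bounded by half the sum of the squares, which for \<open>c = 1\<close>
  gives the bound 1. Nothing is assumed of \<open>R i\<close> where \<open>v i = 0\<close>, so
  finite families can be padded with zero coefficients.\<close>

lemma abs_interval_sum_le:
  assumes x: "sqbd x c"
  shows "(\<Sum>i<n. \<bar>v i * isum x (R i)\<bar>) \<le> (1 + c) / 2"
proof -
  let ?S = "{i\<in>{..<n}. v i \<noteq> 0}"
  have 1: "(\<Sum>i\<in>?S. (isum x (R i))\<^sup>2) \<le> c"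
    using R disj by (intro sqbd_isum[OF x]) auto
  have "(\<Sum>i<n. \<bar>v i * isum x (R i)\<bar>) = (\<Sum>i\<in>?S. \<bar>v i * isum x (R i)\<bar>)"
    by (intro sum.mono_neutral_right) auto
  also have "\<dots> \<le> (\<Sum>i\<in>?S. ((v i)\<^sup>2 + (isum x (R i))\<^sup>2) / 2)"
  proof (rule sum_mono)
    fix i
    have "0 \<le> (\<bar>v i\<bar> - \<bar>isum x (R i)\<bar>)\<^sup>2" by simp
    then show "\<bar>v i * isum x (R i)\<bar> \<le> ((v i)\<^sup>2 + (isum x (R i))\<^sup>2) / 2"
      by (simp add: power2_diff abs_mult)
  qed
  also have "\<dots> = ((\<Sum>i\<in>?S. (v i)\<^sup>2) + (\<Sum>i\<in>?S. (isum x (R i))\<^sup>2)) / 2"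
    by (simp add: sum.distrib flip: sum_divide_distrib)
  also have "(\<Sum>i\<in>?S. (v i)\<^sup>2) = (\<Sum>i<n. (v i)\<^sup>2)"
    by (intro sum.mono_neutral_left) auto
  finally show ?thesis using v[of n] 1 by simp
qed

lemma interval_sum_summable:
  assumes x: "sqbd x c"
  shows "summable (\<lambda>i. v i * isum x (R i))"
proof (rule summable_rabs_cancel, rule summableI_nonneg_bounded)
  show "(\<Sum>i<n. \<bar>v i * isum x (R i)\<bar>) \<le> (1 + c) / 2" for n by (rule abs_interval_sum_le[OF x])
qed simp

lemma interval_sum_le_1:
  assumes x: "sqbd x 1"
  shows "(\<Sum>i. v i * isum x (R i)) \<le> 1"
proof (rule suminf_le_const[OF interval_sum_summable[OF x]])
  fix n
  have "(\<Sum>i<n. v i * isum x (R i)) \<le> (\<Sum>i<n. \<bar>v i * isum x (R i)\<bar>)" by (intro sum_mono) simp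
  then show "(\<Sum>i<n. v i * isum x (R i)) \<le> 1" using abs_interval_sum_le[OF x, of n] by simp
qed

lemma interval_functional_in_ball:
  "(\<lambda>x. if x \<in> James then \<Sum>i. v i * isum x (R i) else 0) \<in> James_dual_ball" (is "?L \<in> _")
proof (rule James_dual_ballI)
  fix x y assume x: "x \<in> James" and y: "y \<in> James"
  note sx = jnorm_sqbd(1)[OF x] and sy = jnorm_sqbd(1)[OF y]
  have "v i * isum (\<lambda>k. x k + y k) (R i) = v i * isum x (R i) + v i * isum y (R i)" for i
  proof (cases "v i = 0")
    case False
    have "isum x (R i) + isum y (R i) = (\<Sum>k. (if k \<in> R i then x k else 0) + (if k \<in> R i then y k else 0))"
      unfolding isum_def by (intro suminf_add sqbd_summable[OF sx] sqbd_summable[OF sy] R False)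
    also have "\<dots> = isum (\<lambda>k. x k + y k) (R i)"
      unfolding isum_def by (intro suminf_cong) simp
    finally show ?thesis by (simp add: distrib_left[symmetric])
  qed simp
  then show "?L (\<lambda>k. x k + y k) = ?L x + ?L y"
    using x y James_add[OF x y] suminf_add[OF interval_sum_summable[OF sx] interval_sum_summable[OF sy]]
    by simp
next
  fix x and c :: real assume x: "x \<in> James"
  note sx = jnorm_sqbd(1)[OF x]
  have "v i * isum (\<lambda>k. c * x k) (R i) = c * (v i * isum x (R i))" for i
  proof (cases "v i = 0")
    case False
    have "c * isum x (R i) = (\<Sum>k. c * (if k \<in> R i then x k else 0))"
      unfolding isum_def by (rule suminf_mult[OF sqbd_summable[OF sx R[OF False]], symmetric])
    also have "\<dots> = isum (\<lambda>k. c * x k) (R i)"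
      unfolding isum_def by (intro suminf_cong) simp
    finally show ?thesis by simp
  qed simp
  then have "(\<Sum>i. v i * isum (\<lambda>k. c * x k) (R i)) = (\<Sum>i. c * (v i * isum x (R i)))"
    by (simp only:)
  also have "\<dots> = c * (\<Sum>i. v i * isum x (R i))"
    by (rule suminf_mult[OF interval_sum_summable[OF sx]])
  finally show "?L (\<lambda>k. c * x k) = c * ?L x"
    using x James_scale[OF x, of c] by simp
next
  fix x assume "sqbd x 1"
  then show "?L x \<le> 1" using interval_sum_le_1 sqbd_imp_James(1) by simp
qed simp

end

lemma isum_unit_seq: "isum (unit_seq k) I = (if k \<in> I then 1 else 0)"
proof -
  have "isum (unit_seq k) I = (\<Sum>j. if j = k then (if k \<in> I then 1 else 0) else 0)"
    unfolding isum_def unit_seq_def by (intro suminf_cong) simp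
  also have "\<dots> = (if k \<in> I then 1 else 0)"
    by (rule sums_unique[symmetric, OF sums_single])
  finally show ?thesis .
qed

subsection \<open>Functionals that attain their norm at an extreme point\<close>

lemma block_plus_squares:
  assumes x: "sqbd x 1" and A: "block A" and B: "finite B" "A \<inter> B = {}"
  shows "(sum x A)\<^sup>2 + (\<Sum>k\<in>B. (x k)\<^sup>2) \<le> 1"
  using vari_block[OF x A order_refl] vari_squares[OF x B(1) order_refl]
    vari_superadd[OF x B(2), of UNIV] vari_le[OF x, of UNIV] by simp

text \<open>The singletons already exhaust the norm, so replacing those inside \<open>A\<close> by
  the single block \<open>A\<close> cannot gain. For two neighbours this forces opposite
  signs.\<close>

lemma block_square_le:
  assumes x: "sqbd x 1" and sums: "(\<lambda>k. (x k)\<^sup>2) sums 1" and A: "block A"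
  shows "(sum x A)\<^sup>2 \<le> (\<Sum>k\<in>A. (x k)\<^sup>2)"
proof -
  have fin: "finite A" using block_finite[OF A] .
  then obtain m where m: "A \<subseteq> {..<m}" using finite_nat_bounded by blast
  have "(\<Sum>k<n. (x k)\<^sup>2) \<le> 1 - (sum x A)\<^sup>2 + (\<Sum>k\<in>A. (x k)\<^sup>2)" if "m \<le> n" for n
  proof -
    have "A \<subseteq> {..<n}" using m that by auto
    then have "(\<Sum>k<n. (x k)\<^sup>2) = (\<Sum>k\<in>{..<n} - A. (x k)\<^sup>2) + (\<Sum>k\<in>A. (x k)\<^sup>2)"
      using sum.subset_diff[of A "{..<n}" "\<lambda>k. (x k)\<^sup>2"] by simp
    then show ?thesis using block_plus_squares[OF x A, of "{..<n} - A"] by simp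
  qed
  then have "1 \<le> 1 - (sum x A)\<^sup>2 + (\<Sum>k\<in>A. (x k)\<^sup>2)"
    using sums unfolding sums_def by (intro LIMSEQ_le_const2) auto
  then show ?thesis by simp
qed

lemma block_eq_interval:
  assumes "block A"
  obtains a b where "a \<le> b" "A = {a..<b}"
proof (cases "A = {}")
  case True
  then show ?thesis using that[of 0 0] by simp
next
  case False
  have fin: "finite A" using block_finite[OF assms] .
  have "A = {Min A..<Suc (Max A)}"
  proof (intro equalityI subsetI)
    fix k assume "k \<in> A" then show "k \<in> {Min A..<Suc (Max A)}" using fin by (simp add: le_imp_less_Suc)
  next
    fix k assume "k \<in> {Min A..<Suc (Max A)}"
    then show "k \<in> A"
      using block_convex[OF assms Min_in[OF fin False] Max_in[OF fin False], of k] by simp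
  qed
  moreover have "Min A \<le> Suc (Max A)" using fin False by (simp add: le_SucI)
  ultimately show ?thesis using that by blast
qed

text \<open>Compares the norm of \<open>x + \<tau> z\<close> with that of \<open>x\<close> to first order in \<open>\<tau>\<close>; the error
  term accounts for the one block that may reach beyond \<open>N\<close>.\<close>

lemma dual_ball_derivative_le:
  assumes h: "h \<in> James_dual_ball" and x: "sqbd x 1" and hx: "h x = 1"
    and z0: "\<And>k. N \<le> k \<Longrightarrow> z k = 0" and xz: "\<And>k. 0 \<le> x k * z k"
    and key: "\<And>A. block A \<Longrightarrow> A \<subseteq> {..<N} \<Longrightarrow> sum x A * sum z A \<le> (\<Sum>k\<in>A. x k * z k)"
    and bd: "\<And>A. block A \<Longrightarrow> A \<subseteq> {..<N} \<Longrightarrow> \<bar>sum z A\<bar> \<le> 2"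
  shows "h z \<le> (\<Sum>k<N. x k * z k) + 2 * sqrt (1 - (\<Sum>k<N. (x k)\<^sup>2))"
proof (rule field_le_epsilon)
  fix e :: real assume e: "0 < e"
  define d where "d = sqrt (1 - (\<Sum>k<N. (x k)\<^sup>2))"
  define D where "D = (\<Sum>k<N. x k * z k)"
  have d0: "0 \<le> d" unfolding d_def using sqbd_squares[OF x, of "{..<N}"] by simp
  have hd: "h \<in> James_dual" using h by (simp add: James_dual_ball_def)
  have xJ: "x \<in> James" using sqbd_imp_James(1)[OF x] .
  have zcut: "z = (\<lambda>k. if k < N then z k else 0)" using z0 by (auto simp: not_less)
  have zJ: "z \<in> James" by (subst zcut) (rule James_cutoff)
  define M where "M = (jnorm z)\<^sup>2"
  have zM: "sqbd z M" unfolding M_def using jnorm_sqbd(1)[OF zJ] .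
  have M0: "0 \<le> M" by (simp add: M_def)
  have one: "sum x A * sum z A \<le> (\<Sum>k\<in>A \<inter> {..<N}. x k * z k) + (if N \<in> A then 2 * d else 0)"
    if A: "block A" for A
  proof -
    let ?A1 = "A \<inter> {..<N}" and ?A2 = "A \<inter> {N..}"
    have fin: "finite A" using block_finite[OF A] .
    have A1: "block ?A1" using A by (simp add: block_Int)
    have A2: "block ?A2"
    proof (rule blockI)
      fix i j k assume "i \<in> ?A2" "k \<in> ?A2" "i \<le> j" "j \<le> k"
      then show "j \<in> ?A2" using block_convex[OF A, of i k j] by simp
    qed (use fin in simp)
    have "sum x A = sum x (?A1 \<union> ?A2)" by (rule arg_cong[of _ _ "sum x"]) auto
    also have "\<dots> = sum x ?A1 + sum x ?A2" using fin by (intro sum.union_disjoint) auto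
    finally have sx: "sum x A = sum x ?A1 + sum x ?A2" .
    have sz: "sum z A = sum z ?A1"
      using fin z0 not_less by (intro sum.mono_neutral_right) auto
    \<comment> \<open>A block with points on both sides of \<open>N\<close> contains
      \<open>N\<close>, so at most one member of a family has such a cross term. Its part beyond
      \<open>N\<close> is controlled by the squares of \<open>x\<close> missing below
      \<open>N\<close>.\<close>
    have "sum x ?A2 * sum z ?A1 \<le> (if N \<in> A then 2 * d else 0)"
    proof (cases "N \<in> A")
      case True
      have "(sum x ?A2)\<^sup>2 \<le> 1 - (\<Sum>k<N. (x k)\<^sup>2)"
        using block_plus_squares[OF x A2, of "{..<N}"] by (simp add: disjoint_iff)
      then have "\<bar>sum x ?A2\<bar> \<le> d" unfolding d_def by (metis real_sqrt_abs real_sqrt_le_iff)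
      then have "\<bar>sum x ?A2 * sum z ?A1\<bar> \<le> d * 2"
        unfolding abs_mult using bd[OF A1] by (intro mult_mono d0) auto
      then show ?thesis using True by simp
    next
      case False
      have "?A1 = {} \<or> ?A2 = {}"
      proof (rule ccontr)
        assume "\<not> ?thesis"
        then obtain i k where "i \<in> A" "i < N" "k \<in> A" "N \<le> k" by auto
        then show False using block_convex[OF A, of i k N] False by simp
      qed
      then show ?thesis using False by auto
    qed
    then show ?thesis using key[OF A1] by (simp add: sx sz distrib_right)
  qed
  \<comment> \<open>The squared norm of \<open>x + t z\<close> is expanded in \<open>t\<close> and
    compared with the affine part of \<open>(1 + t * h z)\<^sup>2\<close>.\<close>
  have main: "1 + 2 * (t * h z) \<le> 1 + 2 * (t * (D + 2 * d)) + t\<^sup>2 * M" if t: "0 < t" for t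
  proof -
    have "sqbd (\<lambda>k. x k + t * z k) (1 + 2 * (t * (D + 2 * d)) + t\<^sup>2 * M)"
      unfolding sqbd_def
    proof
      fix \<I> assume I: "\<I> \<in> families UNIV"
      have "(\<Sum>A\<in>\<I>. \<Sum>k\<in>A \<inter> {..<N}. x k * z k) = (\<Sum>k\<in>(\<Union>A\<in>\<I>. A \<inter> {..<N}). x k * z k)"
        using familiesD(1)[OF I] disjointD[OF familiesD(3)[OF I]]
        by (intro sum.UNION_disjoint[symmetric]) (simp, simp, blast)
      also have "\<dots> \<le> D"
        unfolding D_def using xz by (intro sum_mono2) auto
      finally have 1: "(\<Sum>A\<in>\<I>. \<Sum>k\<in>A \<inter> {..<N}. x k * z k) \<le> D" .
      have "(\<Sum>A\<in>\<I>. sum x A * sum z A)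
          \<le> (\<Sum>A\<in>\<I>. (\<Sum>k\<in>A \<inter> {..<N}. x k * z k) + (if N \<in> A then 2 * d else 0))"
        using familiesD(2)[OF I] by (intro sum_mono one)
      also have "\<dots> \<le> D + 2 * d"
        unfolding sum.distrib using d0 by (intro add_mono 1 sum_families_point_le[OF I]) simp
      finally have 2: "(\<Sum>A\<in>\<I>. sum x A * sum z A) \<le> D + 2 * d" .
      have sq: "(\<Sum>k\<in>A. x k + t * z k)\<^sup>2
          = (sum x A)\<^sup>2 + 2 * t * (sum x A * sum z A) + t\<^sup>2 * (sum z A)\<^sup>2" for A
        unfolding sum.distrib sum_distrib_left[symmetric] by (simp add: power2_eq_square algebra_simps)
      have "qsum (\<lambda>k. x k + t * z k) \<I> = qsum x \<I> + 2 * t * (\<Sum>A\<in>\<I>. sum x A * sum z A) + t\<^sup>2 * qsum z \<I>"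
        unfolding qsum_def sq by (simp only: sum.distrib sum_distrib_left[symmetric])
      also have "\<dots> = qsum x \<I> + 2 * (t * (\<Sum>A\<in>\<I>. sum x A * sum z A)) + t\<^sup>2 * qsum z \<I>"
        by simp
      also have "\<dots> \<le> 1 + 2 * (t * (D + 2 * d)) + t\<^sup>2 * M"
        using t by (intro add_mono mult_left_mono 2 sqbdD[OF x I] sqbdD[OF zM I]) auto
      finally show "qsum (\<lambda>k. x k + t * z k) \<I> \<le> 1 + 2 * (t * (D + 2 * d)) + t\<^sup>2 * M" .
    qed
    from James_dual_ball_sqbd[OF h this]
    have "(1 + t * h z)\<^sup>2 \<le> 1 + 2 * (t * (D + 2 * d)) + t\<^sup>2 * M"
      by (simp add: James_dual_add[OF hd xJ James_scale[OF zJ]] James_dual_scale[OF hd zJ] hx)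
    moreover have "1 + 2 * (t * h z) \<le> (1 + t * h z)\<^sup>2" by (simp add: power2_sum)
    ultimately show ?thesis by linarith
  qed
  define t where "t = 2 * e / (M + 1)"
  have t: "0 < t" using e M0 by (simp add: t_def)
  have "t * (2 * h z) \<le> t * (2 * (D + 2 * d) + t * M)"
    using main[OF t] by (simp add: algebra_simps power2_eq_square)
  then have "2 * h z \<le> 2 * (D + 2 * d) + t * M" using t by simp
  moreover have "t * M \<le> 2 * e" using e M0 by (simp add: t_def field_simps)
  ultimately show "h z \<le> (\<Sum>k<N. x k * z k) + 2 * sqrt (1 - (\<Sum>k<N. (x k)\<^sup>2)) + e"
    by (simp add: D_def d_def)
qed

text \<open>The derivative bound holds from above for \<open>g\<close> and for \<open>h\<close>. By
  \<open>phi\<close> their convex combination takes exactly the value \<open>\<Sum> x z\<close> on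
  the truncated \<open>z\<close>, so the upper bound for \<open>h\<close> becomes a lower bound for
  \<open>g\<close>. Both errors vanish because the squares of \<open>x\<close> sum to 1.\<close>

lemma support_functional_tendsto:
  assumes g: "g \<in> James_dual_ball" and h: "h \<in> James_dual_ball" and t: "0 < t" "t < 1"
    and x: "sqbd x 1" and sums: "(\<lambda>k. (x k)\<^sup>2) sums 1" and gx: "g x = 1" and hx: "h x = 1"
    and xz: "\<And>k. 0 \<le> x k * z k"
    and key: "\<And>A. block A \<Longrightarrow> sum x A * sum z A \<le> (\<Sum>k\<in>A. x k * z k)"
    and bd: "\<And>A. block A \<Longrightarrow> \<bar>sum z A\<bar> \<le> 2"
    and phi: "\<And>k. z k * (t * g (unit_seq k) + (1 - t) * h (unit_seq k)) = z k * x k"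
  shows "(\<lambda>N. \<Sum>k<N. z k * (g (unit_seq k) - x k)) \<longlonglongrightarrow> 0"
proof -
  define d where "d N = sqrt (1 - (\<Sum>k<N. (x k)\<^sup>2))" for N
  let ?D = "\<lambda>N. \<Sum>k<N. x k * z k"
  let ?z = "\<lambda>N k. if k < N then z k else 0"
  have le: "f (?z N) \<le> ?D N + 2 * d N" if f: "f \<in> James_dual_ball" "f x = 1" for f N
  proof -
    have sz: "sum (?z N) A = sum z A" "(\<Sum>k\<in>A. x k * ?z N k) = (\<Sum>k\<in>A. x k * z k)"
      if "A \<subseteq> {..<N}" for A using that by (auto intro!: sum.cong)
    have "f (?z N) \<le> (\<Sum>k<N. x k * ?z N k) + 2 * sqrt (1 - (\<Sum>k<N. (x k)\<^sup>2))"
      by (rule dual_ball_derivative_le[OF f(1) x f(2)]) (use xz key bd sz in auto)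
    then show ?thesis by (simp add: d_def)
  qed
  have gd: "g \<in> James_dual" and hd: "h \<in> James_dual"
    using g h by (simp_all add: James_dual_ball_def)
  have conv: "t * g (?z N) + (1 - t) * h (?z N) = ?D N" for N
  proof -
    have "t * g (?z N) + (1 - t) * h (?z N)
        = (\<Sum>k<N. z k * (t * g (unit_seq k) + (1 - t) * h (unit_seq k)))"
      unfolding James_dual_cutoff[OF gd] James_dual_cutoff[OF hd] sum_distrib_left sum.distrib[symmetric]
      by (intro sum.cong refl) (simp only: algebra_simps)
    then show ?thesis by (simp add: phi mult.commute)
  qed
  have diff: "(\<Sum>k<N. z k * (g (unit_seq k) - x k)) = g (?z N) - ?D N" for N
    unfolding James_dual_cutoff[OF gd] by (simp add: algebra_simps sum_subtractf)
  have lower: "- (2 * (1 - t) / t) * d N \<le> g (?z N) - ?D N" for N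
  proof -
    have "(1 - t) * h (?z N) \<le> (1 - t) * (?D N + 2 * d N)"
      using le[OF h hx] t by (intro mult_left_mono) auto
    then have "- (2 * (1 - t)) * d N \<le> t * (g (?z N) - ?D N)"
      using conv[of N] by (simp add: algebra_simps)
    then show ?thesis using t by (simp add: field_simps)
  qed
  have "(\<lambda>N. 1 - (\<Sum>k<N. (x k)\<^sup>2)) \<longlonglongrightarrow> 1 - 1"
    using sums unfolding sums_def by (intro tendsto_intros)
  then have d0: "d \<longlonglongrightarrow> 0" unfolding d_def using tendsto_real_sqrt by fastforce
  have upper: "g (?z N) - ?D N \<le> 2 * d N" for N using le[OF g gx, of N] by linarith
  show ?thesis
    unfolding diff
  proof (rule tendsto_sandwich)
    show "(\<lambda>N. - (2 * (1 - t) / t) * d N) \<longlonglongrightarrow> 0" by (rule tendsto_mult_right_zero[OF d0])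
    show "(\<lambda>N. 2 * d N) \<longlonglongrightarrow> 0" by (rule tendsto_mult_right_zero[OF d0])
  qed (intro always_eventually allI lower upper)+
qed

text \<open>The bound \<open>S\<^sub>A z\<^sub>A \<le> \<Sum>\<^sub>A x z\<close> for \<open>z = sgn x - \<eta> sgn (x j) e\<^sub>j\<close>.
  Here \<open>X\<close>, \<open>Y\<close> and \<open>T\<close> are the sums over a block of \<open>x\<close>, \<open>sgn x\<close> and \<open>\<bar>x\<bar>\<close>,
  and \<open>u = \<bar>x j\<bar>\<close>, after normalising \<open>sgn (x j) = 1\<close>.\<close>

lemma shifted_sign_bound:
  fixes X Y T u \<eta> :: real
  assumes "Y = -1 \<or> Y = 0 \<or> Y = 1" and "\<bar>X\<bar> \<le> 1" "\<bar>X\<bar> \<le> T" "- X \<le> T - 2 * u"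
    and "0 \<le> u" "u \<le> T" "0 \<le> \<eta>" "\<eta> \<le> 1/2" "\<eta> \<le> u"
  shows "X * (Y - \<eta>) \<le> T - \<eta> * u"
proof -
  have a: "\<eta> * \<bar>X\<bar> \<le> 1/2 * T" "\<eta> * u \<le> 1/2 * T" "\<eta> * u \<le> 1 * u" "\<eta> * u \<le> \<eta> * T"
    using assms by (intro mult_mono; simp)+
  consider "Y = 1" | "Y = 0" | "Y = -1" "0 \<le> X" | "Y = -1" "X < 0" using assms(1) by linarith
  then show ?thesis
  proof cases
    case 1
    have "X * (1 - \<eta>) \<le> T * (1 - \<eta>)" using assms by (intro mult_right_mono) auto
    then show ?thesis using a(4) 1 by (simp add: algebra_simps)
  next
    case 2
    have "X * (- \<eta>) \<le> \<eta> * \<bar>X\<bar>" using assms(7) by (cases "0 \<le> X") auto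
    then show ?thesis using a(1,2) 2 by simp
  next
    case 3
    have "X * (Y - \<eta>) \<le> 0" using 3 assms(7) by (simp add: mult_nonneg_nonpos)
    then show ?thesis using a(2) assms(3) abs_ge_zero[of X] by linarith
  next
    case 4
    have "\<eta> * (- X) \<le> u * 1" using assms 4 by (intro mult_mono) auto
    then show ?thesis using a(3) 4 assms(4) by (simp add: algebra_simps)
  qed
qed

text \<open>The directions used are \<open>sgn x\<close> and \<open>sgn x + c e\<^sub>j\<close>, cut off at \<open>N\<close>, with a suitable \<open>c \<noteq> 0\<close>.\<close>

lemma norming_point_determines_coefficient:
  assumes g: "g \<in> James_dual_ball" and h: "h \<in> James_dual_ball" and t: "0 < t" "t < 1"
    and x: "sqbd x 1" and sums: "(\<lambda>k. (x k)\<^sup>2) sums 1" and gx: "g x = 1" and hx: "h x = 1"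
    and sg: "\<bar>\<sigma>\<bar> = 1" "\<And>n. (\<Sum>k<n. sgn (x k)) = 0 \<or> (\<Sum>k<n. sgn (x k)) = \<sigma>"
    and phi: "\<And>k. x k \<noteq> 0 \<Longrightarrow> t * g (unit_seq k) + (1 - t) * h (unit_seq k) = x k"
    and phij: "t * g (unit_seq j) + (1 - t) * h (unit_seq j) = x j"
    and j: "x j \<noteq> 0 \<or> (\<forall>k\<le>j. x k = 0) \<or> (\<forall>k\<ge>j. x k = 0)"
  shows "g (unit_seq j) = x j"
proof -
  define P where "P n = (\<Sum>k<n. sgn (x k))" for n
  have P: "P n = 0 \<or> P n = \<sigma>" for n using sg(2) by (simp add: P_def)
  have \<sigma>: "\<sigma> = 1 \<or> \<sigma> = -1" using sg(1) by linarith
  have ivl: "(\<Sum>k\<in>{a..<b}. sgn (x k)) = P b - P a" if "a \<le> b" for a b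
    using sum_diff_nat_ivl[of 0 a b "\<lambda>k. sgn (x k)"] that by (simp add: P_def lessThan_atLeast0)
  have Y: "(\<Sum>k\<in>A. sgn (x k)) = -1 \<or> (\<Sum>k\<in>A. sgn (x k)) = 0 \<or> (\<Sum>k\<in>A. sgn (x k)) = 1"
    if A: "block A" for A
  proof -
    obtain a b where ab: "a \<le> b" "A = {a..<b}" using block_eq_interval[OF A] .
    show ?thesis unfolding ab(2) ivl[OF ab(1)] using P[of a] P[of b] \<sigma> by auto
  qed
  have xs: "x k * sgn (x k) = \<bar>x k\<bar>" for k by (simp add: abs_sgn)
  have XT: "\<bar>sum x A\<bar> \<le> (\<Sum>k\<in>A. \<bar>x k\<bar>)" for A by (rule sum_abs)
  have small: "sum x A * w \<le> (\<Sum>k\<in>A. \<bar>x k\<bar>)" if "\<bar>w\<bar> \<le> 1" for A w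
  proof -
    have "sum x A * w \<le> \<bar>sum x A\<bar> * \<bar>w\<bar>" by (metis abs_ge_self abs_mult)
    also have "\<dots> \<le> \<bar>sum x A\<bar> * 1" using that by (intro mult_left_mono) auto
    finally show ?thesis using XT[of A] by linarith
  qed
  have lim0: "(\<lambda>N. \<Sum>k<N. sgn (x k) * (g (unit_seq k) - x k)) \<longlonglongrightarrow> 0"
  proof (rule support_functional_tendsto[OF g h t x sums gx hx])
    fix A assume A: "block A"
    show "sum x A * (\<Sum>k\<in>A. sgn (x k)) \<le> (\<Sum>k\<in>A. x k * sgn (x k))"
      unfolding xs using Y[OF A] by (intro small) auto
    show "\<bar>\<Sum>k\<in>A. sgn (x k)\<bar> \<le> 2" using Y[OF A] by auto
  qed (use phi in \<open>auto simp: xs sgn_zero_iff\<close>)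
  \<comment> \<open>These are the conditions under which \<open>sgn x + c e_j\<close> is an
    admissible direction in \<open>support_functional_tendsto\<close>.\<close>
  have "\<exists>c. c \<noteq> 0 \<and> 0 \<le> x j * (sgn (x j) + c) \<and> \<bar>c\<bar> \<le> 1 \<and>
     (\<forall>A. block A \<longrightarrow> j \<in> A \<longrightarrow> sum x A * ((\<Sum>k\<in>A. sgn (x k)) + c) \<le> (\<Sum>k\<in>A. \<bar>x k\<bar>) + c * x j)"
  proof (cases "x j = 0")
    case True
    have "\<exists>c. \<bar>c\<bar> = 1 \<and> (\<forall>A. block A \<longrightarrow> j \<in> A \<longrightarrow> \<bar>(\<Sum>k\<in>A. sgn (x k)) + c\<bar> \<le> 1)"
    proof -
      consider "\<forall>k\<le>j. x k = 0" | "\<forall>k\<ge>j. x k = 0" using j True by blast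
      then show ?thesis
      proof cases
        case 1
        \<comment> \<open>All entries up to \<open>j\<close> vanish, so a block through
          \<open>j\<close> has sign sum 0 or \<open>\<sigma>\<close>, and adding
          \<open>- \<sigma>\<close> gives \<open>- \<sigma>\<close> or 0.\<close>
        have "\<bar>(\<Sum>k\<in>A. sgn (x k)) + (- \<sigma>)\<bar> \<le> 1" if A: "block A" "j \<in> A" for A
        proof -
          obtain a b where ab: "a \<le> b" "A = {a..<b}" using block_eq_interval[OF A(1)] .
          have "P a = 0" unfolding P_def using 1 ab(2) A(2) by (intro sum.neutral) auto
          then show ?thesis unfolding ab(2) ivl[OF ab(1)] using P[of b] \<sigma> by auto
        qed
        then show ?thesis using sg(1) by (intro exI[of _ "- \<sigma>"]) auto
      next
        case 2
        \<comment> \<open>The sign that would come next in the alternation: \<open>P j + c\<close>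
          is again 0 or \<open>\<sigma>\<close>.\<close>
        define c where "c = (if P j = 0 then \<sigma> else - \<sigma>)"
        have "\<bar>(\<Sum>k\<in>A. sgn (x k)) + c\<bar> \<le> 1" if A: "block A" "j \<in> A" for A
        proof -
          obtain a b where ab: "a \<le> b" "A = {a..<b}" using block_eq_interval[OF A(1)] .
          have "j \<le> b" using ab(2) A(2) by simp
          then have "P b - P j = (\<Sum>k\<in>{j..<b}. sgn (x k))" by (rule ivl[symmetric])
          also have "\<dots> = 0" using 2 by (intro sum.neutral) auto
          finally have "P b = P j" by simp
          then show ?thesis unfolding ab(2) ivl[OF ab(1)] c_def using P[of a] P[of j] \<sigma> by auto
        qed
        moreover have "\<bar>c\<bar> = 1" using sg(1) by (simp add: c_def)
        ultimately show ?thesis by blast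
      qed
    qed
    then obtain c where c: "\<bar>c\<bar> = 1" "\<And>A. block A \<Longrightarrow> j \<in> A \<Longrightarrow> \<bar>(\<Sum>k\<in>A. sgn (x k)) + c\<bar> \<le> 1"
      by blast
    show ?thesis
    proof (intro exI[of _ c] conjI allI impI)
      fix A assume "block A" "j \<in> A"
      from small[OF c(2)[OF this]] True
      show "sum x A * ((\<Sum>k\<in>A. sgn (x k)) + c) \<le> (\<Sum>k\<in>A. \<bar>x k\<bar>) + c * x j" by simp
    qed (use c(1) True in auto)
  next
    case False
    define s where "s = sgn (x j)"
    \<comment> \<open>The two bounds are those demanded by \<open>shifted_sign_bound\<close>;
      \<open>\<eta>\<close> is positive because \<open>x j\<close> is nonzero.\<close>
    define \<eta> where "\<eta> = min (1/2) \<bar>x j\<bar>"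
    have s: "s * s = 1" "\<bar>s\<bar> = 1" "s = 1 \<or> s = -1" using False by (auto simp: s_def sgn_if)
    have sx: "s * x j = \<bar>x j\<bar>" by (simp add: s_def xs mult.commute)
    have \<eta>: "0 < \<eta>" "\<eta> \<le> 1/2" "\<eta> \<le> \<bar>x j\<bar>" using False by (auto simp: \<eta>_def)
    show ?thesis
    proof (intro exI[of _ "- (\<eta> * s)"] conjI allI impI)
      show "- (\<eta> * s) \<noteq> 0" using \<eta>(1) s(2) by auto
      have "x j * (sgn (x j) + - (\<eta> * s)) = (1 - \<eta>) * \<bar>x j\<bar>"
        using sx by (simp add: s_def[symmetric] algebra_simps)
      then show "0 \<le> x j * (sgn (x j) + - (\<eta> * s))" using \<eta>(2) by simp
      show "\<bar>- (\<eta> * s)\<bar> \<le> 1" using \<eta> s(2) by (simp add: abs_mult)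
      fix A assume A: "block A" "j \<in> A"
      have fin: "finite A" using block_finite[OF A(1)] .
      let ?T = "\<Sum>k\<in>A. \<bar>x k\<bar>" and ?Y = "\<Sum>k\<in>A. sgn (x k)"
      have sX: "\<bar>s * sum x A\<bar> = \<bar>sum x A\<bar>" using s(2) by (simp add: abs_mult)
      have "- (s * sum x A) = - (s * x j) + - (s * sum x (A - {j}))"
        using fin A(2) by (simp add: sum.remove algebra_simps)
      also have "\<dots> \<le> - \<bar>x j\<bar> + (\<Sum>k\<in>A - {j}. \<bar>x k\<bar>)"
      proof -
        have "- (s * sum x (A - {j})) \<le> \<bar>s * sum x (A - {j})\<bar>" by linarith
        also have "\<dots> = \<bar>sum x (A - {j})\<bar>" using s(2) by (simp add: abs_mult)
        finally show ?thesis using XT[of "A - {j}"] sx by linarith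
      qed
      also have "\<dots> = ?T - 2 * \<bar>x j\<bar>" using fin A(2) by (simp add: sum.remove)
      finally have low: "- (s * sum x A) \<le> ?T - 2 * \<bar>x j\<bar>" .
      have uT: "\<bar>x j\<bar> \<le> ?T" using fin A(2) by (intro member_le_sum) auto
      have "(s * sum x A) * (s * ?Y - \<eta>) \<le> ?T - \<eta> * \<bar>x j\<bar>"
      proof (rule shifted_sign_bound)
        show "s * ?Y = -1 \<or> s * ?Y = 0 \<or> s * ?Y = 1" using Y[OF A(1)] s(3) by auto
      qed (use sX sqbd_1_abs[OF x A(1)] XT[of A] low uT \<eta> in auto)
      also have "(s * sum x A) * (s * ?Y - \<eta>) = (s * s) * (sum x A * ?Y) - \<eta> * s * sum x A"
        by (simp add: algebra_simps)
      finally show "sum x A * (?Y + - (\<eta> * s)) \<le> ?T + - (\<eta> * s) * x j"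
        using sx s(1) by (simp add: algebra_simps)
    qed
  qed
  then obtain c where c: "c \<noteq> 0" "0 \<le> x j * (sgn (x j) + c)" "\<bar>c\<bar> \<le> 1"
    "\<And>A. block A \<Longrightarrow> j \<in> A \<Longrightarrow> sum x A * ((\<Sum>k\<in>A. sgn (x k)) + c) \<le> (\<Sum>k\<in>A. \<bar>x k\<bar>) + c * x j"
    by blast
  define z where "z k = sgn (x k) + (if k = j then c else 0)" for k
  have sz: "sum z A = (\<Sum>k\<in>A. sgn (x k)) + (if j \<in> A then c else 0)" if "finite A" for A
    using that by (simp add: z_def sum.distrib)
  have sxz: "(\<Sum>k\<in>A. x k * z k) = (\<Sum>k\<in>A. \<bar>x k\<bar>) + (if j \<in> A then c * x j else 0)" if "finite A" for A
  proof -
    have "x k * z k = \<bar>x k\<bar> + (if k = j then c * x j else 0)" for k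
      using xs[of k] by (simp add: z_def algebra_simps)
    then show ?thesis using that by (simp add: sum.distrib)
  qed
  have lim1: "(\<lambda>N. \<Sum>k<N. z k * (g (unit_seq k) - x k)) \<longlonglongrightarrow> 0"
  proof (rule support_functional_tendsto[OF g h t x sums gx hx])
    fix A assume A: "block A"
    have fin: "finite A" using block_finite[OF A] .
    show "sum x A * sum z A \<le> (\<Sum>k\<in>A. x k * z k)"
      unfolding sz[OF fin] sxz[OF fin] using c(4)[OF A] small[of "\<Sum>k\<in>A. sgn (x k)" A] Y[OF A]
      by (cases "j \<in> A") auto
    show "\<bar>sum z A\<bar> \<le> 2" unfolding sz[OF fin] using Y[OF A] c(3) by auto
  next
    fix k
    show "0 \<le> x k * z k" using c(2) xs[of k] by (simp add: z_def)
    show "z k * (t * g (unit_seq k) + (1 - t) * h (unit_seq k)) = z k * x k"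
      using phi[of k] phij by (cases "x k = 0"; cases "k = j") (auto simp: z_def)
  qed
  \<comment> \<open>The two directions differ only at \<open>j\<close>, so once \<open>N\<close>
    exceeds \<open>j\<close> the difference of the two sums is the constant
    \<open>c * (g (unit_seq j) - x j)\<close>.\<close>
  have "(\<lambda>N. (\<Sum>k<N. z k * (g (unit_seq k) - x k)) - (\<Sum>k<N. sgn (x k) * (g (unit_seq k) - x k)))
      \<longlonglongrightarrow> 0 - 0"
    by (intro tendsto_diff lim0 lim1)
  moreover have "(\<Sum>k<N. z k * (g (unit_seq k) - x k)) - (\<Sum>k<N. sgn (x k) * (g (unit_seq k) - x k))
      = c * (g (unit_seq j) - x j)" if "Suc j \<le> N" for N
  proof -
    have "(\<Sum>k<N. z k * (g (unit_seq k) - x k)) - (\<Sum>k<N. sgn (x k) * (g (unit_seq k) - x k))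
        = (\<Sum>k<N. if k = j then c * (g (unit_seq j) - x j) else 0)"
      unfolding sum_subtractf[symmetric] by (intro sum.cong refl) (simp add: z_def algebra_simps)
    then show ?thesis using that by simp
  qed
  then have "eventually (\<lambda>N. (\<Sum>k<N. z k * (g (unit_seq k) - x k)) -
      (\<Sum>k<N. sgn (x k) * (g (unit_seq k) - x k)) = c * (g (unit_seq j) - x j)) sequentially"
    unfolding eventually_sequentially by blast
  ultimately have "(\<lambda>N::nat. c * (g (unit_seq j) - x j)) \<longlonglongrightarrow> 0"
    using Lim_transform_eventually by fastforce
  then have "c * (g (unit_seq j) - x j) = 0" by (simp add: LIMSEQ_const_iff)
  then show ?thesis using c(1) by simp
qed

lemma interval_family_less:
  assumes fam: "interval_family F I" and "i < j" "j \<in> F" "a \<in> I i" "b \<in> I j"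
  shows "a < b"
  using assms(2-)
proof (induction j arbitrary: b)
  case (Suc j)
  have down: "j \<in> F" using fam Suc.prems(2) unfolding interval_family_def by auto
  have step: "\<And>c d. c \<in> I j \<Longrightarrow> d \<in> I (Suc j) \<Longrightarrow> c < d"
    using fam Suc.prems(2) unfolding interval_family_def by blast
  show ?case
  proof (cases "i = j")
    case True
    then show ?thesis using step Suc.prems by blast
  next
    case False
    obtain c where c: "c \<in> I j"
      using fam down unfolding interval_family_def nat_interval_def by blast
    have "a < c" using Suc.IH[OF _ down Suc.prems(3) c] False Suc.prems(1) by simp
    also have "c < b" using step[OF c Suc.prems(4)] .
    finally show ?thesis .
  qed
qed simp

lemma interval_family_down: "interval_family F I \<Longrightarrow> j \<in> F \<Longrightarrow> i \<le> j \<Longrightarrow> i \<in> F"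
  unfolding interval_family_def by auto

lemma interval_family_disjoint:
  assumes fam: "interval_family F I" and "i \<in> F" "j \<in> F" "i \<noteq> j"
  shows "I i \<inter> I j = {}"
  using interval_family_less[OF fam, of i j] interval_family_less[OF fam, of j i] assms(2-)
  by (metis disjoint_iff less_irrefl linorder_neqE_nat)

lemma alternating_signs:
  assumes a: "sqbd v 1" and sums: "(\<lambda>i. (v i)\<^sup>2) sums 1" and nz: "v i \<noteq> 0" "v (Suc i) \<noteq> 0"
  shows "sgn (v (Suc i)) = - sgn (v i)"
proof -
  have "(sum v {i..<Suc (Suc i)})\<^sup>2 \<le> (\<Sum>k\<in>{i..<Suc (Suc i)}. (v k)\<^sup>2)"
    by (rule block_square_le[OF a sums]) simp
  then have "v i * v (Suc i) \<le> 0" by (simp add: power2_sum)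
  then show ?thesis using nz by (auto simp: mult_le_0_iff sgn_if)
qed

text \<open>Inserting zeros between entries preserves the norm bound and the sum of squares. The
  partial sums of signs take only two values because consecutive entries of \<open>v\<close>
  alternate in sign.\<close>

lemma spread_sequence:
  assumes down: "\<And>i j. j \<in> F \<Longrightarrow> i \<le> j \<Longrightarrow> i \<in> F"
    and r: "\<And>i j. i < j \<Longrightarrow> j \<in> F \<Longrightarrow> r i < (r j :: nat)"
    and v: "sqbd v 1" and sums: "(\<lambda>i. (v i)\<^sup>2) sums 1"
    and nz: "\<And>i. v i \<noteq> 0 \<longleftrightarrow> i \<in> F"
  defines "x \<equiv> push r F v"
  shows "sqbd x 1" "(\<lambda>k. (x k)\<^sup>2) sums 1" "\<And>i. i \<in> F \<Longrightarrow> x (r i) = v i"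
    "\<And>k. k \<notin> r ` F \<Longrightarrow> x k = 0"
    "\<exists>\<sigma>. \<bar>\<sigma>\<bar> = 1 \<and> (\<forall>n. (\<Sum>k<n. sgn (x k)) = 0 \<or> (\<Sum>k<n. sgn (x k)) = (\<sigma>::real))"
proof -
  have inj: "inj_on r F" by (intro inj_onI) (metis less_irrefl linorder_neqE_nat r)
  have fin: "finite {k \<in> F. r k \<in> C}" if "finite C" for C
  proof -
    have "finite (r -` C \<inter> F)" by (rule finite_vimage_IntI[OF that inj])
    also have "r -` C \<inter> F = {k \<in> F. r k \<in> C}" by auto
    finally show ?thesis .
  qed
  show sx: "sqbd x 1" unfolding x_def
  proof (rule sqbd_push[OF v])
    show "mono_on F r" by (intro mono_onI) (metis le_eq_less_or_eq r)
  qed (use down fin in auto)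
  show xr: "x (r i) = v i" if "i \<in> F" for i
  proof -
    have "{k \<in> F. r k = r i} = {i}" using inj that by (auto dest: inj_onD)
    then show ?thesis by (simp add: x_def push_def)
  qed
  show x0: "x k = 0" if "k \<notin> r ` F" for k
  proof -
    have "{i \<in> F. r i = k} = {}" using that by auto
    then show ?thesis unfolding x_def push_def by (simp only: sum.empty)
  qed
  show "(\<lambda>k. (x k)\<^sup>2) sums 1"
  proof (rule sums_1I)
    show "(\<Sum>k<n. (x k)\<^sup>2) \<le> 1" for n by (rule sqbd_squares[OF sx]) simp
    fix e :: real assume "0 < e"
    then have "\<exists>N. \<forall>n\<ge>N. norm ((\<Sum>i<n. (v i)\<^sup>2) - 1) < e"
      using sums unfolding sums_def by (rule LIMSEQ_D[rotated])
    then obtain n where n: "\<bar>(\<Sum>i<n. (v i)\<^sup>2) - 1\<bar> < e" by auto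
    have "finite (r ` (F \<inter> {..<n}))" by simp
    then obtain K where K: "r ` (F \<inter> {..<n}) \<subseteq> {..<K}" using finite_nat_bounded by blast
    have "(\<Sum>i<n. (v i)\<^sup>2) = (\<Sum>i\<in>F \<inter> {..<n}. (v i)\<^sup>2)"
      using nz by (intro sum.mono_neutral_right) auto
    also have "\<dots> = (\<Sum>i\<in>F \<inter> {..<n}. (x (r i))\<^sup>2)" using xr by (intro sum.cong) auto
    also have "\<dots> = (\<Sum>k\<in>r ` (F \<inter> {..<n}). (x k)\<^sup>2)"
      by (rule sum.reindex_cong[symmetric, OF inj_on_subset[OF inj]]) auto
    also have "\<dots> \<le> (\<Sum>k<K. (x k)\<^sup>2)" using K by (intro sum_mono2) auto
    finally show "\<exists>K. 1 - e < (\<Sum>k<K. (x k)\<^sup>2)" using n by (intro exI[of _ K]) linarith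
  qed simp
  have "\<exists>j. v j \<noteq> 0"
  proof (rule ccontr)
    assume "\<not> ?thesis"
    then have "(\<lambda>i. (v i)\<^sup>2) = (\<lambda>_. 0)" by auto
    then show False using sums sums_unique2[OF sums_zero, of 1] by force
  qed
  then have "0 \<in> F" using nz down by blast
  define \<sigma> where "\<sigma> = sgn (v 0)"
  have \<sigma>: "\<bar>\<sigma>\<bar> = 1" using nz[of 0] \<open>0 \<in> F\<close> by (auto simp: \<sigma>_def sgn_if)
  have sgnv: "sgn (v i) = (if even i then \<sigma> else - \<sigma>)" if "i \<in> F" for i
    using that
  proof (induction i)
    case (Suc i)
    have i: "i \<in> F" using down[OF Suc.prems, of i] by simp
    have "sgn (v (Suc i)) = - sgn (v i)"
      using alternating_signs[OF v sums, of i] i Suc.prems nz by simp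
    then show ?case using Suc.IH[OF i] by simp
  qed (simp add: \<sigma>_def)
  \<comment> \<open>\<open>m\<close> counts the entries of \<open>v\<close> placed before position
    \<open>n\<close>; its parity decides the partial sum.\<close>
  have inv: "\<exists>m. (\<Sum>k<n. sgn (x k)) = (if even m then 0 else \<sigma>) \<and> (\<forall>i\<in>F. r i < n \<longleftrightarrow> i < m)" for n
  proof (induction n)
    case 0
    show ?case by (intro exI[of _ 0]) simp
  next
    case (Suc n)
    then obtain m where m: "(\<Sum>k<n. sgn (x k)) = (if even m then 0 else \<sigma>)"
      "\<And>i. i \<in> F \<Longrightarrow> r i < n \<longleftrightarrow> i < m" by blast
    show ?case
    proof (cases "n \<in> r ` F")
      case True
      then obtain i where i: "i \<in> F" "n = r i" by blast
      have "\<not> i < m" using m(2)[OF i(1)] i(2) by simp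
      moreover have "\<not> m < i" using r[OF _ i(1), of m] m(2)[of m] down[OF i(1), of m] i(2) by auto
      ultimately have im: "i = m" by simp
      have "(\<Sum>k<Suc n. sgn (x k)) = (if even (Suc m) then 0 else \<sigma>)"
        using m(1) sgnv[OF i(1)] xr[OF i(1)] i(2) im by auto
      moreover have "r k < Suc n \<longleftrightarrow> k < Suc m" if "k \<in> F" for k
        using m(2)[OF that] inj_onD[OF inj _ that i(1)] i(2) im by (auto simp: less_Suc_eq)
      ultimately show ?thesis by blast
    next
      case False
      have "(\<Sum>k<Suc n. sgn (x k)) = (if even m then 0 else \<sigma>)" using m(1) x0[OF False] by simp
      moreover have "r k < Suc n \<longleftrightarrow> k < m" if "k \<in> F" for k
        using m(2)[OF that] False that by (auto simp: less_Suc_eq)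
      ultimately show ?thesis by blast
    qed
  qed
  show "\<exists>\<sigma>. \<bar>\<sigma>\<bar> = 1 \<and> (\<forall>n. (\<Sum>k<n. sgn (x k)) = 0 \<or> (\<Sum>k<n. sgn (x k)) = (\<sigma>::real))"
    using \<sigma> inv by (intro exI[of _ \<sigma>]) metis
qed

lemma interval_functional_extreme:
  assumes f: "f \<in> James_dual" and fam: "interval_family F I" and nz: "\<And>i. i \<in> F \<Longrightarrow> \<alpha> i \<noteq> (0::real)"
    and lim: "\<And>x. x \<in> James \<Longrightarrow> (\<lambda>n. \<Sum>i\<in>F \<inter> {..<n}. \<alpha> i * isum x (I i)) \<longlonglongrightarrow> f x"
    and ext: "extreme_pt (\<lambda>i. if i \<in> F then \<alpha> i else 0) James_ball"
    and un: "nat_interval (\<Union>i\<in>F. I i)"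
  shows "extreme_pt f James_dual_ball"
proof -
  define v where "v i = (if i \<in> F then \<alpha> i else 0)" for i
  have v: "sqbd v 1" and sums: "(\<lambda>i. (v i)\<^sup>2) sums 1"
    using ext unfolding v_def extreme_James_ball_iff by simp_all
  have vF: "v i \<noteq> 0 \<longleftrightarrow> i \<in> F" for i using nz by (simp add: v_def)
  have ivl: "nat_interval (I i)" if "i \<in> F" for i using fam that unfolding interval_family_def by blast
  have vsum: "(\<Sum>i\<in>F \<inter> {..<n}. \<alpha> i * isum x (I i)) = (\<Sum>i<n. v i * isum x (I i))" for n x
  proof -
    have "(\<Sum>i<n. v i * isum x (I i)) = (\<Sum>i\<in>F \<inter> {..<n}. v i * isum x (I i))"
      using vF by (intro sum.mono_neutral_right) auto
    then show ?thesis by (simp add: v_def)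
  qed
  have lim': "(\<lambda>i. v i * isum x (I i)) sums f x" if "x \<in> James" for x
    using lim[OF that] unfolding sums_def vsum .
  have fball: "f \<in> James_dual_ball"
  proof (rule James_dual_ballI)
    fix x assume x: "sqbd x 1"
    have "f x = (\<Sum>i. v i * isum x (I i))" using sums_unique[OF lim'[OF sqbd_imp_James(1)[OF x]]] .
    also have "\<dots> \<le> 1"
      by (rule interval_sum_le_1[OF _ _ _ x])
        (use ivl vF interval_family_disjoint[OF fam] sqbd_squares[OF v] in auto)
    finally show "f x \<le> 1" .
  qed (use f in \<open>auto simp: James_dual_def\<close>)
  have f_in: "f (unit_seq k) = v i" if "i \<in> F" "k \<in> I i" for i k
  proof -
    have "v j * isum (unit_seq k) (I j) = (if j = i then v i else 0)" for j
      using interval_family_disjoint[OF fam that(1), of j] vF[of j] that(2)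
      by (auto simp: isum_unit_seq)
    then have "(\<lambda>j. if j = i then v i else 0) sums f (unit_seq k)"
      using lim'[OF unit_seq_James, of k] by simp
    then show ?thesis by (rule sums_unique2) (rule sums_single)
  qed
  have f_out: "f (unit_seq k) = 0" if "k \<notin> (\<Union>i\<in>F. I i)" for k
  proof -
    have "v j * isum (unit_seq k) (I j) = 0" for j
      using vF[of j] that by (auto simp: isum_unit_seq)
    then have "(\<lambda>j. 0) sums f (unit_seq k)"
      using lim'[OF unit_seq_James, of k] by (simp only:)
    then show ?thesis by (rule sums_unique2) (rule sums_zero)
  qed
  have main: "g (unit_seq j) = f (unit_seq j)"
    if g: "g \<in> James_dual_ball" and h: "h \<in> James_dual_ball" and t: "0 < t" "t < 1"
      and conv: "\<And>x. f x = t * g x + (1 - t) * h x" for g h t j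
  proof -
    \<comment> \<open>The chosen points depend on \<open>j\<close>: the interval that contains
      \<open>j\<close>, if there is one, is represented by \<open>j\<close> itself.\<close>
    define r where "r i = (if j \<in> I i then j else (SOME k. k \<in> I i))" for i
    have rI: "r i \<in> I i" if "i \<in> F" for i
      using ivl[OF that] unfolding r_def nat_interval_def by (auto intro: someI2)
    define x where "x = push r F v"
    have down: "i \<in> F" if "j \<in> F" "i \<le> j" for i j using interval_family_down[OF fam that] .
    have rless: "r i < r j" if "i < j" "j \<in> F" for i j
      using interval_family_less[OF fam that rI rI] down[of j i] that by simp
    have X: "sqbd x 1" "(\<lambda>k. (x k)\<^sup>2) sums 1" "\<And>i. i \<in> F \<Longrightarrow> x (r i) = v i"
      "\<And>k. k \<notin> r ` F \<Longrightarrow> x k = 0"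
      "\<exists>\<sigma>. \<bar>\<sigma>\<bar> = 1 \<and> (\<forall>n. (\<Sum>k<n. sgn (x k)) = 0 \<or> (\<Sum>k<n. sgn (x k)) = (\<sigma>::real))"
      using spread_sequence[of F r v] down rless v sums vF unfolding x_def by blast+
    have xJ: "x \<in> James" using sqbd_imp_James(1)[OF X(1)] .
    have "v i * isum x (I i) = (v i)\<^sup>2" for i
    proof (cases "i \<in> F")
      case True
      have "x k = (if k = r i then v i else 0)" if "k \<in> I i" for k
      proof (cases "k \<in> r ` F")
        case True
        then obtain j where j: "j \<in> F" "k = r j" by blast
        have "j = i" using interval_family_disjoint[OF fam j(1) \<open>i \<in> F\<close>] rI[OF j(1)] j(2) that by blast
        then show ?thesis using X(3) \<open>i \<in> F\<close> j(2) by simp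
      next
        case False
        then show ?thesis using X(4) \<open>i \<in> F\<close> by auto
      qed
      then have "isum x (I i) = (\<Sum>k. if k = r i then v i else 0)"
        unfolding isum_def using rI[OF True] by (intro suminf_cong) auto
      also have "\<dots> = v i" by (rule sums_unique[symmetric, OF sums_single])
      finally show ?thesis by (simp add: power2_eq_square)
    next
      case False
      then have "v i = 0" using vF[of i] by blast
      then show ?thesis by simp
    qed
    then have "(\<lambda>i. (v i)\<^sup>2) sums f x" using lim'[OF xJ] by (simp only:)
    then have fx: "f x = 1" using sums by (rule sums_unique2)
    have "(g x)\<^sup>2 \<le> 1" "(h x)\<^sup>2 \<le> 1" by (rule James_dual_ball_sqbd[OF _ X(1)], fact)+
    then have le: "g x \<le> 1" "h x \<le> 1" by (simp_all add: abs_square_le_1)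
    have "t * g x \<le> t * 1" "(1 - t) * h x \<le> (1 - t) * 1" using le t by (intro mult_left_mono; simp)+
    moreover have "t * g x + (1 - t) * h x = 1" using conv[of x] fx by simp
    ultimately have "t * g x = t \<and> (1 - t) * h x = 1 - t"
      unfolding mult_1_right by (intro conjI antisym) linarith+
    then have gx: "g x = 1" "h x = 1" using t by simp_all
    obtain \<sigma> where \<sigma>: "\<bar>\<sigma>\<bar> = 1" "\<And>n. (\<Sum>k<n. sgn (x k)) = 0 \<or> (\<Sum>k<n. sgn (x k)) = (\<sigma>::real)"
      using X(5) by blast
    have phi: "f (unit_seq k) = x k" if xk: "x k \<noteq> 0" for k
    proof -
      obtain i where "i \<in> F" "k = r i" using X(4)[of k] xk by blast
      then show ?thesis using f_in rI X(3) by simp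
    qed
    have phij: "f (unit_seq j) = x j" and
      j: "x j \<noteq> 0 \<or> (\<forall>k\<le>j. x k = 0) \<or> (\<forall>k\<ge>j. x k = 0)"
    proof -
      have supp: "k \<in> (\<Union>i\<in>F. I i)" if "x k \<noteq> 0" for k using X(4)[of k] that rI by blast
      have "f (unit_seq j) = x j \<and> (x j \<noteq> 0 \<or> (\<forall>k\<le>j. x k = 0) \<or> (\<forall>k\<ge>j. x k = 0))"
      proof (cases "j \<in> (\<Union>i\<in>F. I i)")
        case True
        then obtain i where i: "i \<in> F" "j \<in> I i" by blast
        then have "r i = j" by (simp add: r_def)
        then show ?thesis using X(3)[OF i(1)] f_in[OF i] vF[of i] i(1) by simp
      next
        case False
        \<comment> \<open>Condition (2) enters here: nonzero entries on both sides would put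
          \<open>j\<close> into the union of the intervals.\<close>
        have "(\<forall>k\<le>j. x k = 0) \<or> (\<forall>k\<ge>j. x k = 0)"
        proof (rule ccontr)
          assume "\<not> ?thesis"
          then obtain k l where "k \<le> j" "x k \<noteq> 0" "j \<le> l" "x l \<noteq> 0" by blast
          then show False using un supp[of k] supp[of l] False unfolding nat_interval_def by blast
        qed
        moreover have "x j = 0" using supp[of j] False by blast
        ultimately show ?thesis using f_out[OF False] by simp
      qed
      then show "f (unit_seq j) = x j" "x j \<noteq> 0 \<or> (\<forall>k\<le>j. x k = 0) \<or> (\<forall>k\<ge>j. x k = 0)" by simp_all
    qed
    have "g (unit_seq j) = x j"
      by (rule norming_point_determines_coefficient[OF g h t X(1,2) gx \<sigma> _ _ j])
        (use phi phij in \<open>simp_all add: conv[symmetric]\<close>)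
    then show ?thesis using phij by simp
  qed
  show ?thesis
    unfolding extreme_pt_def
  proof (intro conjI fball ballI allI impI)
    fix g h and t :: real
    assume g: "g \<in> James_dual_ball" and h: "h \<in> James_dual_ball"
      and *: "0 < t \<and> t < 1 \<and> f = (\<lambda>k. t * g k + (1 - t) * h k)"
    then have t: "0 < t" "t < 1" "0 < 1 - t" "1 - t < 1" by simp_all
    have conv: "f x = t * g x + (1 - t) * h x" for x using * by (metis (no_types))
    have conv': "f x = (1 - t) * h x + (1 - (1 - t)) * g x" for x unfolding conv[of x] by simp
    have "g (unit_seq j) = h (unit_seq j)" for j
      \<comment> \<open>The roles of \<open>g\<close> and \<open>h\<close> are exchanged by passing
        from \<open>t\<close> to \<open>1 - t\<close>.\<close>
      using main[OF g h t(1,2) conv, of j] main[OF h g t(3,4) conv', of j] by (rule trans[OF _ sym])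
    then show "g = h" using g h by (intro James_dual_eqI) (simp_all add: James_dual_ball_def)
  qed
qed

subsection \<open>Separation in the space of finitely supported sequences\<close>

text \<open>The type of real polynomials serves as the vector space of finitely supported sequences.\<close>

definition pair :: "(nat \<Rightarrow> real) \<Rightarrow> real poly \<Rightarrow> real" where
  "pair a p = (\<Sum>k\<le>degree p. a k * coeff p k)"

lemma pair_eq_sum:
  assumes "\<And>k. n \<le> k \<Longrightarrow> coeff p k = 0"
  shows "pair a p = (\<Sum>k<n. a k * coeff p k)"
proof -
  have "pair a p = (\<Sum>k\<in>{..degree p} \<inter> {..<n}. a k * coeff p k)"
    unfolding pair_def using assms not_less by (intro sum.mono_neutral_right) auto
  also have "\<dots> = (\<Sum>k<n. a k * coeff p k)"
    by (intro sum.mono_neutral_left) (auto simp: le_degree)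
  finally show ?thesis .
qed

lemma pair_eq_sum_degree: "degree p < n \<Longrightarrow> pair a p = (\<Sum>k<n. a k * coeff p k)"
  by (rule pair_eq_sum) (simp add: coeff_eq_0)

lemma pair_add: "pair a (p + q) = pair a p + pair a q"
proof -
  define n where "n = Suc (max (degree p) (degree q))"
  have "degree (p + q) < n" using degree_add_le_max[of p q] by (simp add: n_def)
  then show ?thesis
    by (subst (1 2 3) pair_eq_sum_degree[of _ n]) (simp_all add: n_def sum.distrib algebra_simps)
qed

lemma pair_smult: "pair a (smult t p) = t * pair a p"
proof -
  have "degree (smult t p) < Suc (degree p)" using degree_smult_le[of t p] by simp
  then show ?thesis
    by (subst (1 2) pair_eq_sum_degree[of _ "Suc (degree p)"])
      (simp_all add: sum_distrib_left algebra_simps)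
qed

lemma pair_zero [simp]: "pair a 0 = 0"
  by (simp add: pair_def)

lemma pair_minus: "pair a (- p) = - pair a p"
  using pair_smult[of a "-1" p] by simp

lemma pair_diff: "pair a (p - q) = pair a p - pair a q"
  using pair_add[of a p "- q"] by (simp add: pair_minus)

lemma pair_monom [simp]: "pair a (monom t k) = a k * t"
proof -
  have "pair a (monom t k) = (\<Sum>i<Suc k. a i * coeff (monom t k) i)"
    by (rule pair_eq_sum) simp
  also have "\<dots> = (\<Sum>i<Suc k. if i = k then a k * t else 0)" by (intro sum.cong) auto
  finally show ?thesis by simp
qed

lemma pair_pCons: "pair a (pCons s p) = a 0 * s + pair (\<lambda>k. a (Suc k)) p"
proof -
  have "degree (pCons s p) < Suc (Suc (degree p))" using degree_pCons_le[of s p] by simp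
  then have "pair a (pCons s p) = (\<Sum>k<Suc (Suc (degree p)). a k * coeff (pCons s p) k)"
    by (rule pair_eq_sum_degree)
  also have "\<dots> = a 0 * s + (\<Sum>k<Suc (degree p). a (Suc k) * coeff p k)"
    by (simp only: sum.lessThan_Suc_shift coeff_pCons_0 coeff_pCons_Suc)
  finally show ?thesis by (simp add: pair_eq_sum_degree[of p "Suc (degree p)"])
qed

lemma pair_scale_left: "pair (\<lambda>k. t * a k) p = t * pair a p"
  by (simp add: pair_def sum_distrib_left mult.assoc)

lemma pair_add_left: "pair (\<lambda>k. a k + b k) p = pair a p + pair b p"
  by (simp add: pair_def sum.distrib distrib_right)

text \<open>The usual extension by one dimension, from polynomials with coefficients below
  \<open>n\<close> to the new basis vector \<open>monom 1 n\<close>. Subadditivity separates the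
  lower bounds for its value from the upper ones, and \<open>c\<close> is the supremum of the lower
  bounds.\<close>

lemma hahn_banach_step:
  fixes r :: "real poly \<Rightarrow> real"
  assumes sub: "\<And>p q. r (p + q) \<le> r p + r q" and hom: "\<And>t p. 0 < t \<Longrightarrow> r (smult t p) = t * r p"
    and a: "\<And>p. (\<And>k. n \<le> k \<Longrightarrow> coeff p k = 0) \<Longrightarrow> pair a p \<le> r p"
  shows "\<exists>c. \<forall>p. (\<forall>k\<ge>Suc n. coeff p k = 0) \<longrightarrow> pair (a(n := c)) p \<le> r p"
proof -
  let ?E = "monom 1 n :: real poly"
  let ?U = "{u :: real poly. \<forall>k\<ge>n. coeff u k = 0}"
  define c where "c = (SUP u\<in>?U. pair a u - r (u - ?E))"
  have le: "pair a u - r (u - ?E) \<le> r (w + ?E) - pair a w" if "u \<in> ?U" "w \<in> ?U" for u w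
  proof -
    have "pair a (u + w) \<le> r (u + w)" using that by (intro a) simp
    also have "u + w = (u - ?E) + (w + ?E)" by simp
    also have "r \<dots> \<le> r (u - ?E) + r (w + ?E)" by (rule sub)
    finally show ?thesis by (simp add: pair_add)
  qed
  have U0: "0 \<in> ?U" by simp
  have bdd: "bdd_above ((\<lambda>u. pair a u - r (u - ?E)) ` ?U)"
    using le[OF _ U0] by (intro bdd_aboveI2)
  have lower: "pair a u - r (u - ?E) \<le> c" if "u \<in> ?U" for u
    unfolding c_def by (rule cSUP_upper[OF that bdd])
  have upper: "c \<le> r (w + ?E) - pair a w" if "w \<in> ?U" for w
    unfolding c_def using U0 le[OF _ that] by (intro cSUP_least) blast+
  have "pair (a(n := c)) p \<le> r p" if p: "\<forall>k\<ge>Suc n. coeff p k = 0" for p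
  proof -
    define t where "t = coeff p n"
    define u where "u = p - monom t n"
    have "coeff u k = 0" if "n \<le> k" for k
      using p that by (cases "k = n") (simp_all add: u_def t_def)
    then have u: "u \<in> ?U" by simp
    have p_eq: "p = u + smult t ?E" by (simp add: u_def smult_monom)
    have su: "smult s u \<in> ?U" for s using u by simp
    have "pair (a(n := c)) p = pair (a(n := c)) u + c * t"
      by (subst p_eq) (simp add: pair_add pair_smult)
    also have "pair (a(n := c)) u = pair a u"
      using u by (subst (1 2) pair_eq_sum[of n]) auto
    finally have eq: "pair (a(n := c)) p = pair a u + c * t" .
    consider "t = 0" | "0 < t" | "0 < - t" by linarith
    then show ?thesis
    proof cases
      case 1
      then show ?thesis using eq a[of u] u p_eq by simp
    next
      case 2
      have "c * t \<le> (r (smult (1/t) u + ?E) - pair a (smult (1/t) u)) * t"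
        using upper[OF su, of "1/t"] 2 by (intro mult_right_mono) auto
      also have "\<dots> = r (smult t (smult (1/t) u + ?E)) - pair a u"
        using 2 by (simp add: hom pair_smult algebra_simps)
      also have "smult t (smult (1/t) u + ?E) = p"
        using 2 by (subst p_eq) (simp add: smult_add_right)
      finally show ?thesis using eq by simp
    next
      case 3
      have "(pair a (smult (1/(-t)) u) - r (smult (1/(-t)) u - ?E)) * (-t) \<le> c * (-t)"
        using lower[OF su, of "1/(-t)"] 3 by (intro mult_right_mono) auto
      moreover have "(pair a (smult (1/(-t)) u) - r (smult (1/(-t)) u - ?E)) * (-t)
          = pair a u - r (smult (-t) (smult (1/(-t)) u - ?E))"
        unfolding hom[OF 3] pair_smult using 3 by (simp add: algebra_simps)
      moreover have "smult (-t) (smult (1/(-t)) u - ?E) = p"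
        using 3 by (subst p_eq) (simp add: smult_diff_right)
      ultimately show ?thesis using eq by simp
    qed
  qed
  then show ?thesis by blast
qed

lemma hahn_banach_poly:
  fixes r :: "real poly \<Rightarrow> real"
  assumes sub: "\<And>p q. r (p + q) \<le> r p + r q" and hom: "\<And>t p. 0 < t \<Longrightarrow> r (smult t p) = t * r p"
    and r0: "r 0 = 0"
  obtains a where "\<And>p. pair a p \<le> r p"
proof -
  let ?P = "\<lambda>n a. \<forall>p. (\<forall>k\<ge>n. coeff p k = 0) \<longrightarrow> pair a p \<le> r p"
  have P0: "?P 0 (\<lambda>_. 0)"
  proof (intro allI impI)
    fix p :: "real poly" assume "\<forall>k\<ge>0. coeff p k = 0"
    then have "p = 0" by (simp add: poly_eq_iff)
    then show "pair (\<lambda>_. 0) p \<le> r p" by (simp add: r0)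
  qed
  have "\<exists>f. \<forall>n. ?P n (f n) \<and> (\<forall>k. k \<noteq> n \<longrightarrow> f (Suc n) k = f n k)"
  proof (rule dependent_nat_choice)
    show "\<exists>a. ?P 0 a" using exI[of "?P 0" "\<lambda>_. 0"] P0 by blast
    fix a n assume "?P n a"
    then obtain c where "?P (Suc n) (a(n := c))"
      using hahn_banach_step[of r n a, OF sub hom] by blast
    then show "\<exists>b. ?P (Suc n) b \<and> (\<forall>k. k \<noteq> n \<longrightarrow> b k = a k)"
      by (intro exI[of _ "a(n := c)"]) simp
  qed
  then obtain f where f: "\<And>n. ?P n (f n)" and fS: "\<And>n k. k \<noteq> n \<Longrightarrow> f (Suc n) k = f n k" by blast
  \<comment> \<open>Entry \<open>k\<close> is fixed in step \<open>Suc k\<close> and never changes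
    afterwards, so the diagonal collects the final values.\<close>
  define a where "a k = f (Suc k) k" for k
  have fa: "f n k = a k" if "k < n" for n k
    using that by (induction n) (auto simp: less_Suc_eq a_def fS)
  have "pair a p \<le> r p" for p
  proof -
    have "pair a p = pair (f (Suc (degree p))) p"
      unfolding pair_def using fa by (intro sum.cong) auto
    also have "\<dots> \<le> r p" using f[of "Suc (degree p)"] by (simp add: coeff_eq_0)
    finally show ?thesis .
  qed
  then show ?thesis by (rule that)
qed

text \<open>A linear functional below the maximum of two sublinear ones splits accordingly:
  Hahn--Banach applied to \<open>x \<mapsto> inf\<^sub>y (max (P\<^sub>1 (x + y)) (P\<^sub>2 y) - \<Phi> y)\<close>.\<close>

lemma split_below_max:
  fixes P1 P2 \<Phi> :: "real poly \<Rightarrow> real"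
  assumes sub1: "\<And>p q. P1 (p + q) \<le> P1 p + P1 q" and sub2: "\<And>p q. P2 (p + q) \<le> P2 p + P2 q"
    and hom1: "\<And>t p. 0 < t \<Longrightarrow> P1 (smult t p) = t * P1 p"
    and hom2: "\<And>t p. 0 < t \<Longrightarrow> P2 (smult t p) = t * P2 p"
    and add: "\<And>p q. \<Phi> (p + q) = \<Phi> p + \<Phi> q" and scale: "\<And>t p. \<Phi> (smult t p) = t * \<Phi> p"
    and zero: "P1 0 = 0" "P2 0 = 0" and le: "\<And>p. \<Phi> p \<le> max (P1 p) (P2 p)"
  obtains a where "\<And>u y. pair a u + (\<Phi> y - pair a y) \<le> max (P1 u) (P2 y)"
proof -
  define q where "q x y = max (P1 (x + y)) (P2 y) - \<Phi> y" for x y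
  define r where "r x = (INF y. q x y)" for x
  \<comment> \<open>This lower bound, independent of \<open>y\<close>, makes the infimum
    \<open>r x\<close> finite; it is where the domination of \<open>\<Phi>\<close> by the maximum is
    used.\<close>
  have low: "- max (P1 (- x)) 0 \<le> q x y" for x y
  proof -
    have "P1 y \<le> P1 (x + y) + P1 (- x)" using sub1[of "x + y" "- x"] by simp
    then show ?thesis unfolding q_def using le[of y] by linarith
  qed
  have r_le: "r x \<le> q x y" for x y
    unfolding r_def using low by (intro cINF_lower bdd_belowI2) auto
  have r_ge: "m \<le> r x" if "\<And>y. m \<le> q x y" for m x
    unfolding r_def using that by (intro cINF_greatest) auto
  have q_add: "q (x + x') (y + y') \<le> q x y + q x' y'" for x x' y y'
    using sub1[of "x + y" "x' + y'"] sub2[of y y'] add[of y y']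
    unfolding q_def by (simp add: add.assoc add.left_commute) linarith
  have q_scale: "q (smult t x) (smult t y) = t * q x y" if "0 < t" for t x y
  proof -
    have "P1 (smult t x + smult t y) = t * P1 (x + y)"
      using hom1[OF that, of "x + y"] by (simp add: smult_add_right)
    then show ?thesis
      unfolding q_def scale hom2[OF that] using that by (simp add: right_diff_distrib max_mult_distrib_left)
  qed
  obtain a where a: "\<And>p. pair a p \<le> r p"
  proof (rule hahn_banach_poly[of r])
    fix x x'
    have "r (x + x') - r x' \<le> r x"
    proof (rule r_ge)
      fix y
      have "r (x + x') - q x y \<le> r x'"
        by (rule r_ge) (use r_le[of "x + x'"] q_add[of x x' y] in \<open>smt (verit)\<close>)
      then show "r (x + x') - r x' \<le> q x y" by simp
    qed
    then show "r (x + x') \<le> r x + r x'" by simp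
  next
    show "r 0 = 0"
    proof (rule antisym)
      show "r 0 \<le> 0" using r_le[of 0 0] scale[of 0 0] by (simp add: q_def zero)
      show "0 \<le> r 0" using low[of 0] by (intro r_ge) (simp add: zero)
    qed
  next
    have hom_le: "t * r x \<le> r (smult t x)" if t: "0 < t" for t x
    proof (rule r_ge)
      fix y
      have "t * r x \<le> t * q x (smult (1/t) y)" using t by (intro mult_left_mono r_le) simp
      also have "\<dots> = q (smult t x) y" using q_scale[OF t, of x "smult (1/t) y"] t by simp
      finally show "t * r x \<le> q (smult t x) y" .
    qed
    fix t :: real and x assume t: "0 < t"
    have "(1/t) * r (smult t x) \<le> r (smult (1/t) (smult t x))" using t by (intro hom_le) simp
    then have "r (smult t x) \<le> t * r x" using t by (simp add: field_simps)
    then show "r (smult t x) = t * r x" using hom_le[OF t, of x] by simp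
  qed blast
  have "pair a u + (\<Phi> y - pair a y) \<le> max (P1 u) (P2 y)" for u y
  proof -
    have "pair a (u - y) \<le> q (u - y) y" using a r_le order_trans by blast
    then show ?thesis by (simp add: q_def pair_diff)
  qed
  then show ?thesis by (rule that)
qed

subsection \<open>Extreme points of closed convex hulls of sequences\<close>

text \<open>The closed convex hull in the product topology, written as an intersection of
  half-spaces given by finitely supported vectors.\<close>

definition seq_hull :: "(nat \<Rightarrow> real) set \<Rightarrow> (nat \<Rightarrow> real) set" where
  "seq_hull A = {\<phi>. \<forall>p c. (\<forall>w\<in>A. pair w p \<le> c) \<longrightarrow> pair \<phi> p \<le> c}"

lemma seq_hullD: "\<phi> \<in> seq_hull A \<Longrightarrow> (\<And>w. w \<in> A \<Longrightarrow> pair w p \<le> c) \<Longrightarrow> pair \<phi> p \<le> c"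
  by (simp add: seq_hull_def)

lemma seq_hull_mono: "A \<subseteq> B \<Longrightarrow> seq_hull A \<subseteq> seq_hull B"
  unfolding seq_hull_def by blast

lemma seq_hull_nonempty:
  assumes "\<phi> \<in> seq_hull A"
  shows "A \<noteq> {}"
proof
  assume "A = {}"
  then have "pair \<phi> 0 \<le> -1" using seq_hullD[OF assms, of 0 "-1"] by simp
  then show False by simp
qed

lemma extreme_pt_subset: "extreme_pt z S \<Longrightarrow> T \<subseteq> S \<Longrightarrow> z \<in> T \<Longrightarrow> extreme_pt z T"
  unfolding extreme_pt_def by blast

text \<open>Prepending the constant entry \<open>1\<close> to every sequence makes its first coordinate record the mass
  of the part of a functional carried by \<open>A\<close>.\<close>

lemma sup_pair_sublinear:
  assumes ne: "A \<noteq> {}" and bd: "\<And>k. \<exists>B. \<forall>w\<in>A. \<bar>w k\<bar> \<le> (B::real)"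
  defines "P \<equiv> \<lambda>p. SUP w\<in>A. pair (case_nat 1 w) p"
  shows "\<And>w p. w \<in> A \<Longrightarrow> pair (case_nat 1 w) p \<le> P p"
    and "\<And>c p. (\<And>w. w \<in> A \<Longrightarrow> pair (case_nat 1 w) p \<le> c) \<Longrightarrow> P p \<le> c"
    and "\<And>p q. P (p + q) \<le> P p + P q" and "\<And>t p. 0 < t \<Longrightarrow> P (smult t p) = t * P p"
    and "\<And>s. P [:s:] = s"
proof -
  obtain B where B: "\<And>k w. w \<in> A \<Longrightarrow> \<bar>w k\<bar> \<le> B k" using bd by metis
  have bdd: "bdd_above ((\<lambda>w. pair (case_nat 1 w) p) ` A)" for p
  proof (rule bdd_aboveI2)
    fix w assume w: "w \<in> A"
    show "pair (case_nat 1 w) p \<le> (\<Sum>k\<le>degree p. case_nat 1 B k * \<bar>coeff p k\<bar>)"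
      unfolding pair_def
    proof (rule sum_mono)
      fix k
      have "\<bar>case_nat 1 w k\<bar> \<le> case_nat 1 B k" using B[OF w] by (cases k) auto
      then have "\<bar>case_nat 1 w k\<bar> * \<bar>coeff p k\<bar> \<le> case_nat 1 B k * \<bar>coeff p k\<bar>"
        by (rule mult_right_mono) simp
      then show "case_nat 1 w k * coeff p k \<le> case_nat 1 B k * \<bar>coeff p k\<bar>"
        by (metis abs_ge_self abs_mult order_trans)
    qed
  qed
  show up: "pair (case_nat 1 w) p \<le> P p" if "w \<in> A" for w p
    unfolding P_def by (rule cSUP_upper[OF that bdd])
  show least: "P p \<le> c" if "\<And>w. w \<in> A \<Longrightarrow> pair (case_nat 1 w) p \<le> c" for c p
    unfolding P_def by (rule cSUP_least[OF ne that])
  show "P (p + q) \<le> P p + P q" for p q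
    by (rule least) (simp add: pair_add add_mono up)
  have hom_le: "P (smult t p) \<le> t * P p" if "0 < t" for t p
    by (rule least) (simp add: pair_smult mult_left_mono up that less_imp_le)
  show "P (smult t p) = t * P p" if t: "0 < t" for t p
  proof (rule antisym[OF hom_le[OF t]])
    have "P (smult (1/t) (smult t p)) \<le> (1/t) * P (smult t p)" using t by (intro hom_le) simp
    then show "t * P p \<le> P (smult t p)" using t by (simp add: field_simps)
  qed
  obtain w where w: "w \<in> A" using ne by blast
  show "P [:s:] = s" for s
  proof (rule antisym)
    show "P [:s:] \<le> s" by (rule least) (simp add: pair_pCons)
    show "s \<le> P [:s:]" using up[OF w, of "[:s:]"] by (simp add: pair_pCons)
  qed
qed

text \<open>The maximum of the support functions of \<open>A\<close> and \<open>A'\<close> dominates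
  \<open>\<phi>\<close>. Splitting below this maximum writes \<open>\<phi>\<close> as a part of mass
  \<open>\<mu>\<close> carried by \<open>A\<close> plus a part of mass \<open>1 - \<mu>\<close>
  carried by \<open>A'\<close>. If both masses are positive, extremality identifies the normalised
  parts with each other, hence with \<open>\<phi>\<close>.\<close>

lemma extreme_hull_Un:
  assumes bd: "\<And>k. \<exists>B. \<forall>w\<in>A \<union> A'. \<bar>w k\<bar> \<le> (B::real)"
    and ext: "extreme_pt \<phi> (seq_hull (A \<union> A'))"
  shows "\<phi> \<in> seq_hull A \<or> \<phi> \<in> seq_hull A'"
proof (cases "A = {} \<or> A' = {}")
  case True
  then show ?thesis using ext unfolding extreme_pt_def by auto
next
  case False
  define P1 where "P1 p = (SUP w\<in>A. pair (case_nat 1 w) p)" for p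
  define P2 where "P2 p = (SUP w\<in>A'. pair (case_nat 1 w) p)" for p
  have ne: "A \<noteq> {}" "A' \<noteq> {}" and bd1: "\<exists>B. \<forall>w\<in>A. \<bar>w k\<bar> \<le> B" and bd2: "\<exists>B. \<forall>w\<in>A'. \<bar>w k\<bar> \<le> B" for k
    using False bd[of k] by auto
  note P1 = sup_pair_sublinear[OF ne(1) bd1, folded P1_def]
  note P2 = sup_pair_sublinear[OF ne(2) bd2, folded P2_def]
  have \<phi>: "\<phi> \<in> seq_hull (A \<union> A')" using ext by (simp add: extreme_pt_def)
  have dom: "pair (case_nat 1 \<phi>) p \<le> max (P1 p) (P2 p)" for p
  proof -
    obtain s q where p: "p = pCons s q" by (cases p)
    have "pair \<phi> q \<le> max (P1 p) (P2 p) - s"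
    proof (rule seq_hullD[OF \<phi>])
      fix w assume "w \<in> A \<union> A'"
      then have "pair (case_nat 1 w) p \<le> max (P1 p) (P2 p)"
        using P1(1)[of w p] P2(1)[of w p] by (auto simp: le_max_iff_disj)
      then show "pair w q \<le> max (P1 p) (P2 p) - s" by (simp add: p pair_pCons)
    qed
    then show ?thesis by (simp add: p pair_pCons)
  qed
  obtain a where a: "\<And>u y. pair a u + (pair (case_nat 1 \<phi>) y - pair a y) \<le> max (P1 u) (P2 y)"
    by (rule split_below_max[OF P1(3) P2(3) P1(4) P2(4) pair_add pair_smult _ _ dom])
      (use P1(5)[of 0] P2(5)[of 0] in auto)
  define \<mu> where "\<mu> = a 0"
  define a' where "a' k = a (Suc k)" for k
  define b' where "b' k = \<phi> k - a (Suc k)" for k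
  have pa: "pair a (pCons s q) = \<mu> * s + pair a' q" for s q
    unfolding \<mu>_def a'_def by (rule pair_pCons)
  have \<phi>_split: "\<phi> k = a' k + b' k" for k by (simp add: a'_def b'_def)
  have pb: "pair (case_nat 1 \<phi>) (pCons s q) - pair a (pCons s q) = (1 - \<mu>) * s + pair b' q" for s q
  proof -
    have "pair \<phi> q = pair a' q + pair b' q"
      unfolding pair_add_left[symmetric] using \<phi>_split by presburger
    then show ?thesis unfolding pa by (subst pair_pCons) (simp add: algebra_simps)
  qed
  have z: "P1 [:s:] = s" "P2 [:s:] = s" "P1 0 = 0" "P2 0 = 0" for s
    using P1(5)[of s] P2(5)[of s] P1(5)[of 0] P2(5)[of 0] by simp_all
  \<comment> \<open>The constants -1 in one argument and 0 in the other read off the bounds on the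
    mass, since \<open>P1\<close> and \<open>P2\<close> fix constants.\<close>
  have l0: "0 \<le> \<mu>" using a[of "[:-1:]" 0] z by (simp add: pa)
  have l1: "\<mu> \<le> 1" using a[of 0 "[:-1:]"] z pb[of "-1" 0] by simp
  \<comment> \<open>A leading coefficient \<open>- c\<close> turns the bound \<open>c\<close> on
    \<open>A\<close> into the bound 0, which \<open>P1\<close> passes on to
    \<open>a\<close>.\<close>
  have a_le: "pair a' q \<le> \<mu> * c" if "\<And>w. w \<in> A \<Longrightarrow> pair w q \<le> c" for q c
  proof -
    have "P1 (pCons (- c) q) \<le> 0" by (rule P1(2)) (use that in \<open>simp add: pair_pCons\<close>)
    then have "pair a (pCons (- c) q) \<le> 0" using a[of "pCons (- c) q" 0] z by simp
    then show ?thesis by (simp add: pa)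
  qed
  have b_le: "pair b' q \<le> (1 - \<mu>) * c" if "\<And>w. w \<in> A' \<Longrightarrow> pair w q \<le> c" for q c
  proof -
    have "P2 (pCons (- c) q) \<le> 0" by (rule P2(2)) (use that in \<open>simp add: pair_pCons\<close>)
    then have "(1 - \<mu>) * (- c) + pair b' q \<le> 0" using a[of 0 "pCons (- c) q"] z pb[of "- c" q] by simp
    then show ?thesis by simp
  qed
  have pair_\<phi>: "pair \<phi> q = pair a' q + pair b' q" for q
    using pb[of 0 q] unfolding pa by (subst (asm) pair_pCons) simp
  consider "\<mu> = 0" | "\<mu> = 1" | "0 < \<mu>" "\<mu> < 1" using l0 l1 by linarith
  then show ?thesis
  proof cases
    case 1
    \<comment> \<open>Without mass the part carried by \<open>A\<close> is nowhere positive, so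
      bounds for \<open>b'\<close> carry over to \<open>\<phi>\<close>.\<close>
    have "pair a' q \<le> 0" for q
    proof -
      have "pair a' q \<le> \<mu> * P1 (pCons 0 q)"
        by (rule a_le) (use P1(1)[of _ "pCons 0 q"] in \<open>simp add: pair_pCons\<close>)
      then show ?thesis by (simp add: 1)
    qed
    note neg = this
    have "\<phi> \<in> seq_hull A'"
      unfolding seq_hull_def
    proof (intro CollectI allI impI)
      fix p c assume "\<forall>w\<in>A'. pair w p \<le> c"
      then have "pair b' p \<le> (1 - \<mu>) * c" by (intro b_le) blast
      then show "pair \<phi> p \<le> c" using neg[of p] 1 unfolding pair_\<phi> by simp
    qed
    then show ?thesis ..
  next
    case 2
    have "pair b' q \<le> 0" for q
    proof -
      have "pair b' q \<le> (1 - \<mu>) * P2 (pCons 0 q)"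
        by (rule b_le) (use P2(1)[of _ "pCons 0 q"] in \<open>simp add: pair_pCons\<close>)
      then show ?thesis by (simp add: 2)
    qed
    note neg = this
    have "\<phi> \<in> seq_hull A"
      unfolding seq_hull_def
    proof (intro CollectI allI impI)
      fix p c assume "\<forall>w\<in>A. pair w p \<le> c"
      then have "pair a' p \<le> \<mu> * c" by (intro a_le) blast
      then show "pair \<phi> p \<le> c" using neg[of p] 2 unfolding pair_\<phi> by simp
    qed
    then show ?thesis ..
  next
    case 3
    let ?a = "\<lambda>k. (1/\<mu>) * a' k" and ?b = "\<lambda>k. (1/(1-\<mu>)) * b' k"
    have aA: "?a \<in> seq_hull A"
      unfolding seq_hull_def
    proof (intro CollectI allI impI)
      fix p c assume "\<forall>w\<in>A. pair w p \<le> c"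
      then have "pair a' p \<le> \<mu> * c" by (intro a_le) blast
      then show "pair ?a p \<le> c" using 3 unfolding pair_scale_left by (simp add: field_simps)
    qed
    have bA: "?b \<in> seq_hull A'"
      unfolding seq_hull_def
    proof (intro CollectI allI impI)
      fix p c assume "\<forall>w\<in>A'. pair w p \<le> c"
      then have "pair b' p \<le> (1 - \<mu>) * c" by (intro b_le) blast
      then show "pair ?b p \<le> c" using 3 unfolding pair_scale_left by (simp add: field_simps)
    qed
    have split: "\<phi> k = \<mu> * ?a k + (1 - \<mu>) * ?b k" for k using 3 \<phi>_split[of k] by simp
    have eq: "?a = ?b"
    proof (rule extreme_ptD[OF ext _ _ 3 split])
      show "?a \<in> seq_hull (A \<union> A')" using aA seq_hull_mono[of A "A \<union> A'"] by blast
      show "?b \<in> seq_hull (A \<union> A')" using bA seq_hull_mono[of A' "A \<union> A'"] by blast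
    qed
    have "\<phi> k = ?a k" for k
    proof -
      have "\<phi> k = \<mu> * ?a k + (1 - \<mu>) * ?a k"
        using split[of k] fun_cong[OF eq, of k] by (simp only:)
      then show ?thesis unfolding distrib_right[symmetric] by simp
    qed
    then have "\<phi> = ?a" by (rule HOL.ext)
    then show ?thesis using aA by simp
  qed
qed

text \<open>In the induction, \<open>\<phi>\<close> stays extreme in the smaller hull as soon as it
  belongs to it.\<close>

lemma extreme_hull_Union:
  assumes "finite \<A>" and bd: "\<And>k. \<exists>B. \<forall>w\<in>\<Union>\<A>. \<bar>w k\<bar> \<le> (B::real)"
    and "extreme_pt \<phi> (seq_hull (\<Union>\<A>))"
  shows "\<exists>A\<in>\<A>. \<phi> \<in> seq_hull A"
  using assms
proof (induction \<A> rule: finite_induct)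
  case empty
  then have "\<phi> \<in> seq_hull {}" by (simp add: extreme_pt_def)
  then show ?case using seq_hull_nonempty by blast
next
  case (insert A \<A>)
  have ext: "extreme_pt \<phi> (seq_hull (A \<union> \<Union>\<A>))" using insert.prems(2) by simp
  consider "\<phi> \<in> seq_hull A" | "\<phi> \<in> seq_hull (\<Union>\<A>)"
    using extreme_hull_Un[OF _ ext] insert.prems(1) by auto
  then show ?case
  proof cases
    case 2
    have "extreme_pt \<phi> (seq_hull (\<Union>\<A>))"
      by (rule extreme_pt_subset[OF ext seq_hull_mono 2]) simp
    moreover have "\<exists>B. \<forall>w\<in>\<Union>\<A>. \<bar>w k\<bar> \<le> B" for k using insert.prems(1)[of k] by auto
    ultimately show ?thesis using insert.IH by blast
  qed blast
qed

text \<open>Splitting \<open>W\<close> into finitely many pieces of small diameter in the first \<open>n\<close> coordinates replaces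
  the compactness argument in Milman's theorem.\<close>

lemma extreme_hull_approx:
  assumes bd: "\<And>w k. w \<in> W \<Longrightarrow> \<bar>w k\<bar> \<le> (1::real)" and ext: "extreme_pt \<phi> (seq_hull W)" and e: "0 < e"
  shows "\<exists>w\<in>W. \<forall>k<n. \<bar>\<phi> k - w k\<bar> \<le> e"
proof -
  have "\<exists>A\<subseteq>W. \<phi> \<in> seq_hull A \<and> (\<forall>k<n. \<forall>w\<in>A. \<forall>w'\<in>A. \<bar>w k - w' k\<bar> \<le> e)"
  proof (induction n)
    case 0
    show ?case using ext by (intro exI[of _ W]) (simp add: extreme_pt_def)
  next
    case (Suc n)
    then obtain A where A: "A \<subseteq> W" "\<phi> \<in> seq_hull A"
      "\<And>k w w'. k < n \<Longrightarrow> w \<in> A \<Longrightarrow> w' \<in> A \<Longrightarrow> \<bar>w k - w' k\<bar> \<le> e" by blast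
    define T where "T j = {w \<in> A. \<lfloor>w n / e\<rfloor> = j}" for j
    let ?J = "{\<lfloor>- 1 / e\<rfloor>..\<lfloor>1 / e\<rfloor>}"
    have "\<lfloor>w n / e\<rfloor> \<in> ?J" if "w \<in> A" for w
    proof -
      have "- 1 \<le> w n" "w n \<le> 1" using bd[of w n] that A(1) by (auto simp: abs_le_iff)
      then have "- 1 / e \<le> w n / e" "w n / e \<le> 1 / e" using e by (simp_all only: divide_le_cancel) auto
      then show ?thesis by (simp add: floor_mono)
    qed
    then have UT: "\<Union>(T ` ?J) = A" by (auto simp: T_def)
    have "\<exists>B\<in>T ` ?J. \<phi> \<in> seq_hull B"
    proof (rule extreme_hull_Union)
      show "extreme_pt \<phi> (seq_hull (\<Union>(T ` ?J)))"
        unfolding UT by (rule extreme_pt_subset[OF ext seq_hull_mono[OF A(1)] A(2)])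
      show "\<exists>B. \<forall>w\<in>\<Union>(T ` ?J). \<bar>w k\<bar> \<le> B" for k
        unfolding UT using bd A(1) by (intro exI[of _ 1]) blast
    qed simp
    then obtain j where j: "\<phi> \<in> seq_hull (T j)" by blast
    have "\<bar>w k - w' k\<bar> \<le> e" if "k < Suc n" "w \<in> T j" "w' \<in> T j" for k w w'
    proof (cases "k = n")
      case True
      have "of_int j \<le> w n / e" "w n / e < of_int j + 1" "of_int j \<le> w' n / e" "w' n / e < of_int j + 1"
        using that(2,3) by (simp_all add: T_def floor_eq_iff)
      then have "of_int j * e \<le> w n" "w n \<le> of_int j * e + e" "of_int j * e \<le> w' n" "w' n \<le> of_int j * e + e"
        using e by (simp_all add: field_simps)
      then show ?thesis unfolding True by linarith
    next
      case False
      then show ?thesis using A(3)[of k w w'] that by (simp add: T_def)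
    qed
    then show ?case using A(1) j by (intro exI[of _ "T j"]) (auto simp: T_def)
  qed
  then obtain A where A: "A \<subseteq> W" "\<phi> \<in> seq_hull A"
    "\<And>k w w'. k < n \<Longrightarrow> w \<in> A \<Longrightarrow> w' \<in> A \<Longrightarrow> \<bar>w k - w' k\<bar> \<le> e" by blast
  obtain w where w: "w \<in> A" using seq_hull_nonempty[OF A(2)] by blast
  have "\<bar>\<phi> k - w k\<bar> \<le> e" if k: "k < n" for k
  proof -
    have "\<And>w'. w' \<in> A \<Longrightarrow> pair w' (monom 1 k) \<le> w k + e"
      and "\<And>w'. w' \<in> A \<Longrightarrow> pair w' (monom (-1) k) \<le> - w k + e"
      using A(3)[OF k w] by (fastforce simp: abs_le_iff)+
    then have "pair \<phi> (monom 1 k) \<le> w k + e" "pair \<phi> (monom (-1) k) \<le> - w k + e"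
      using seq_hullD[OF A(2)] by blast+
    then show ?thesis by (simp add: abs_le_iff)
  qed
  then show ?thesis using w A(1) by blast
qed

subsection \<open>Runs of a sequence\<close>

text \<open>For \<open>w = \<Sum> \<alpha>\<^sub>i I\<^sub>i\<^sup>*\<close>, \<open>run_sum w n\<close> is the sum of the \<open>\<alpha>\<^sub>i\<^sup>2\<close> over the runs that start before \<open>n\<close>;
  counting runs of value \<open>0\<close> does no harm.\<close>

definition run_start :: "(nat \<Rightarrow> real) \<Rightarrow> nat \<Rightarrow> bool" where
  "run_start w k \<longleftrightarrow> k = 0 \<or> w (k - 1) \<noteq> w k"

definition run_sum :: "(nat \<Rightarrow> real) \<Rightarrow> nat \<Rightarrow> real" where
  "run_sum w n = (\<Sum>k<n. if run_start w k then (w k)\<^sup>2 else 0)"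

text \<open>The set \<open>W\<close> of functionals in coordinates.\<close>

definition run_seqs :: "(nat \<Rightarrow> real) set" where
  "run_seqs = {w. \<forall>n. run_sum w n \<le> 1}"

primrec run_index :: "(nat \<Rightarrow> real) \<Rightarrow> nat \<Rightarrow> nat" where
  "run_index w 0 = 0"
| "run_index w (Suc n) = run_index w n + (if w (Suc n) = w n then 0 else 1)"

lemma run_seqs_abs_le_1:
  assumes "w \<in> run_seqs"
  shows "\<bar>w k\<bar> \<le> 1"
proof -
  have mono: "run_sum w n \<le> run_sum w (Suc n)" for n by (simp add: run_sum_def)
  have "(w k)\<^sup>2 \<le> run_sum w (Suc k)"
  proof (induction k)
    case 0
    show ?case by (simp add: run_sum_def run_start_def)
  next
    case (Suc k)
    show ?case
    proof (cases "w k = w (Suc k)")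
      case True
      then show ?thesis using Suc mono[of "Suc k"] by simp
    next
      case False
      have "0 \<le> run_sum w (Suc k)" unfolding run_sum_def by (intro sum_nonneg) simp
      moreover have "run_sum w (Suc (Suc k)) = run_sum w (Suc k) + (w (Suc k))\<^sup>2"
        using False by (simp add: run_sum_def run_start_def)
      ultimately show ?thesis by simp
    qed
  qed
  also have "\<dots> \<le> 1" using assms by (simp add: run_seqs_def)
  finally show ?thesis by (simp add: abs_square_le_1)
qed

text \<open>Where neighbouring entries of \<open>\<phi>\<close> differ, those of close approximants
  differ too. So every run start of \<open>\<phi>\<close> is eventually one of the approximants, and
  \<open>run_sum\<close> cannot jump up in the limit.\<close>

lemma run_seqs_closed:
  assumes approx: "\<And>n e. 0 < e \<Longrightarrow> \<exists>w\<in>run_seqs. \<forall>k<n. \<bar>\<phi> k - w k\<bar> \<le> e"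
  shows "\<phi> \<in> run_seqs"
  unfolding run_seqs_def
proof (intro CollectI allI)
  fix n
  have "\<exists>w. w \<in> run_seqs \<and> (\<forall>k<n. \<bar>\<phi> k - w k\<bar> \<le> inverse (real (Suc m)))" for m
    using approx[of "inverse (real (Suc m))" n] by auto
  then obtain w where w: "\<And>m. w m \<in> run_seqs" "\<And>m k. k < n \<Longrightarrow> \<bar>\<phi> k - w m k\<bar> \<le> inverse (real (Suc m))"
    by metis
  have lim: "(\<lambda>m. w m k) \<longlonglongrightarrow> \<phi> k" if "k < n" for k
  proof (rule LIM_zero_cancel, rule Lim_null_comparison)
    show "eventually (\<lambda>m. norm (w m k - \<phi> k) \<le> inverse (real (Suc m))) sequentially"
      using w(2)[OF that] by (intro always_eventually allI) (simp add: abs_minus_commute)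
    show "(\<lambda>m. inverse (real (Suc m))) \<longlonglongrightarrow> 0" by (rule LIMSEQ_inverse_real_of_nat)
  qed
  have "eventually (\<lambda>m. run_start \<phi> k \<longrightarrow> run_start (w m) k) sequentially" if "k < n" for k
  proof (cases "run_start \<phi> k \<and> k \<noteq> 0")
    case True
    then have "(\<lambda>m. w m (k - 1) - w m k) \<longlonglongrightarrow> \<phi> (k - 1) - \<phi> k" "\<phi> (k - 1) - \<phi> k \<noteq> 0"
      using that by (auto intro!: tendsto_diff lim simp: run_start_def)
    then have "eventually (\<lambda>m. w m (k - 1) - w m k \<noteq> 0) sequentially"
      by (rule tendsto_imp_eventually_ne)
    then show ?thesis by eventually_elim (simp add: run_start_def)
  qed (auto simp: run_start_def)
  then have "eventually (\<lambda>m. \<forall>k\<in>{..<n}. run_start \<phi> k \<longrightarrow> run_start (w m) k) sequentially"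
    by (intro eventually_ball_finite) auto
  then have ev: "eventually (\<lambda>m. (\<Sum>k<n. if run_start \<phi> k then (w m k)\<^sup>2 else 0) \<le> 1) sequentially"
  proof eventually_elim
    case (elim m)
    then have "(\<Sum>k<n. if run_start \<phi> k then (w m k)\<^sup>2 else 0) \<le> run_sum (w m) n"
      unfolding run_sum_def by (intro sum_mono) auto
    then show ?case using w(1)[of m] unfolding run_seqs_def by (force intro: order_trans)
  qed
  have "(\<lambda>m. if run_start \<phi> k then (w m k)\<^sup>2 else 0) \<longlonglongrightarrow> (if run_start \<phi> k then (\<phi> k)\<^sup>2 else 0)"
    if "k < n" for k using lim[OF that] by (cases "run_start \<phi> k") (auto intro!: tendsto_intros)
  then have "(\<lambda>m. \<Sum>k<n. if run_start \<phi> k then (w m k)\<^sup>2 else 0) \<longlonglongrightarrow> run_sum \<phi> n"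
    unfolding run_sum_def by (intro tendsto_sum) simp
  then show "run_sum \<phi> n \<le> 1" by (rule tendsto_upperbound[OF _ ev]) simp
qed

text \<open>Each nonzero run starts in some block, and no block contains two such starts, so these
  starts inject into the family. Adjacent blocks with equal values merge, which only lowers the
  sum.\<close>

lemma step_sequence_in_run_seqs:
  assumes I: "\<I> \<in> families UNIV" and c: "(\<Sum>I\<in>\<I>. (c I)\<^sup>2) \<le> 1"
  shows "(\<lambda>k. \<Sum>I\<in>\<I>. if k \<in> I then c I else 0) \<in> run_seqs" (is "?w \<in> _")
  unfolding run_seqs_def
proof (intro CollectI allI)
  fix n
  have fin: "finite \<I>" using familiesD(1)[OF I] .
  have w_in: "?w k = c I" if "I \<in> \<I>" "k \<in> I" for k I
  proof -
    have "?w k = (\<Sum>J\<in>\<I>. if J = I then c I else 0)"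
      using disjointD[OF familiesD(3)[OF I]] that by (intro sum.cong) auto
    then show ?thesis using that(1) fin by simp
  qed
  define S where "S = {k. k < n \<and> run_start ?w k \<and> ?w k \<noteq> 0}"
  have "\<exists>I\<in>\<I>. k \<in> I" if "k \<in> S" for k
  proof (rule ccontr)
    assume "\<not> ?thesis"
    then have "?w k = 0" by (intro sum.neutral) auto
    then show False using that by (simp add: S_def)
  qed
  then obtain J where J: "\<And>k. k \<in> S \<Longrightarrow> J k \<in> \<I>" "\<And>k. k \<in> S \<Longrightarrow> k \<in> J k" by metis
  have no: False if "k \<in> S" "l \<in> S" "J k = J l" "k < l" for k l
  proof -
    have "l - 1 \<in> J l"
      using block_convex[OF familiesD(2)[OF I J(1)[OF that(2)]], of k l "l - 1"] J(2)[of k] J(2)[of l] that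
      by simp
    then have "?w (l - 1) = ?w l" using w_in[OF J(1)[OF that(2)]] J(2)[OF that(2)] by simp
    then show False using that(2,4) by (simp add: S_def run_start_def)
  qed
  have inj: "inj_on J S" by (intro inj_onI) (metis linorder_neqE_nat no)
  have "run_sum ?w n = (\<Sum>k\<in>S. (?w k)\<^sup>2)"
    unfolding run_sum_def S_def by (rule sum.mono_neutral_cong_right) auto
  also have "\<dots> = (\<Sum>k\<in>S. (c (J k))\<^sup>2)"
    using w_in J by (intro sum.cong refl) metis
  also have "\<dots> = (\<Sum>I\<in>J ` S. (c I)\<^sup>2)" by (simp add: sum.reindex[OF inj])
  also have "\<dots> \<le> (\<Sum>I\<in>\<I>. (c I)\<^sup>2)" using J(1) fin by (intro sum_mono2) auto
  finally show "run_sum ?w n \<le> 1" using c by simp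
qed

lemma mono_run_index: "mono (run_index w)"
  by (rule mono_iff_le_Suc[THEN iffD2]) simp

lemma run_index_down: "i \<le> run_index w k \<Longrightarrow> i \<in> range (run_index w)"
proof (induction k)
  case 0
  then have "i = run_index w 0" by simp
  then show ?case by (rule range_eqI)
next
  case (Suc k)
  show ?case
  proof (cases "i = run_index w (Suc k)")
    case False
    then have "i \<le> run_index w k" using Suc.prems by (auto split: if_splits)
    then show ?thesis by (rule Suc.IH)
  qed (rule range_eqI)
qed

lemma run_index_eq_imp: 
  assumes "run_index w k = run_index w l"
  shows "w k = w l"
proof -
  have *: "run_index w k = run_index w l \<Longrightarrow> w k = w l" if "k \<le> l" for k l
    using that
  proof (induction l rule: dec_induct)
    case (step l)
    have "run_index w k \<le> run_index w l" using monoD[OF mono_run_index] step.hyps(1) .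
    then have "w (Suc l) = w l" "run_index w k = run_index w l"
      using step.prems by (auto split: if_splits)
    then show ?case using step.IH by simp
  qed simp
  show ?thesis
  proof (cases "k \<le> l")
    case True
    show ?thesis by (rule *[OF True assms])
  next
    case False
    then have "l \<le> k" by simp
    from *[OF this assms[symmetric]] show ?thesis by (rule sym)
  qed
qed

lemma run_index_jump:
  "Suc i \<le> run_index w k \<Longrightarrow> \<exists>n. run_index w n = i \<and> run_index w (Suc n) = Suc i"
proof (induction k)
  case (Suc k)
  show ?case
  proof (cases "Suc i \<le> run_index w k")
    case False
    then have "run_index w k = i \<and> run_index w (Suc k) = Suc i"
      using Suc.prems by (auto split: if_splits)
    then show ?thesis by blast
  qed (rule Suc.IH)
qed simp

text \<open>The default 0 pads the list of values when the sequence is eventually constant and has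
  only finitely many runs.\<close>

definition run_value :: "(nat \<Rightarrow> real) \<Rightarrow> nat \<Rightarrow> real" where
  "run_value w i = (if i \<in> range (run_index w) then w (LEAST k. run_index w k = i) else 0)"

lemma run_value_index [simp]: "run_value w (run_index w k) = w k"
  unfolding run_value_def by simp (rule run_index_eq_imp, rule LeastI, rule refl)

lemma run_value_neq_Suc:
  assumes "Suc i \<in> range (run_index w)"
  shows "run_value w i \<noteq> run_value w (Suc i)"
proof -
  obtain k where "Suc i = run_index w k" using assms by blast
  then have "Suc i \<le> run_index w k" by simp
  then obtain n where n: "run_index w n = i" "run_index w (Suc n) = Suc i" using run_index_jump by blast
  then have "w (Suc n) \<noteq> w n" by (auto split: if_splits)
  then show ?thesis using n run_value_index by metis
qed

lemma sum_run_value: "(\<Sum>i\<le>run_index w n. (run_value w i)\<^sup>2) = run_sum w (Suc n)"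
proof (induction n)
  case 0
  show ?case using run_value_index[of w 0] by (simp add: run_sum_def run_start_def)
next
  case (Suc n)
  have eq: "run_sum w (Suc (Suc n)) = run_sum w (Suc n) + (if w n = w (Suc n) then 0 else (w (Suc n))\<^sup>2)"
    by (simp add: run_sum_def run_start_def)
  show ?case
  proof (cases "w (Suc n) = w n")
    case True
    then show ?thesis using Suc eq by simp
  next
    case False
    then have "run_index w (Suc n) = Suc (run_index w n)" by simp
    then show ?thesis using Suc eq False run_value_index[of w "Suc n"] by simp
  qed
qed

lemma sum_run_value_le_1:
  assumes "w \<in> run_seqs"
  shows "(\<Sum>i<N. (run_value w i)\<^sup>2) \<le> 1"
proof (induction N)
  case (Suc N)
  show ?case
  proof (cases "N \<in> range (run_index w)")
    case True
    then obtain n where n: "N = run_index w n" by blast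
    have "(\<Sum>i<Suc N. (run_value w i)\<^sup>2) = run_sum w (Suc n)"
      unfolding n sum_run_value[symmetric] by (simp add: lessThan_Suc_atMost)
    then show ?thesis using assms by (simp add: run_seqs_def)
  next
    case False
    then show ?thesis using Suc by (simp add: run_value_def)
  qed
qed simp

subsection \<open>The unit ball of the dual space in coordinates\<close>

text \<open>The sequences \<open>k \<mapsto> f (e\<^sub>k)\<close> of the functionals \<open>f\<close> in the dual unit ball.\<close>

definition James_polar :: "(nat \<Rightarrow> real) set" where
  "James_polar = {\<phi>. \<forall>x n. sqbd x 1 \<longrightarrow> (\<Sum>k<n. \<phi> k * x k) \<le> 1}"

lemma James_polarD: "\<phi> \<in> James_polar \<Longrightarrow> sqbd x 1 \<Longrightarrow> (\<Sum>k<n. \<phi> k * x k) \<le> 1"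
  by (simp add: James_polar_def)

lemma James_polar_le:
  assumes \<phi>: "\<phi> \<in> James_polar" and x: "sqbd x c" and s: "0 < s" "c \<le> s\<^sup>2"
  shows "\<bar>\<Sum>k<n. \<phi> k * x k\<bar> \<le> s"
proof -
  have *: "u * (\<Sum>k<n. \<phi> k * x k) \<le> 1" if "u\<^sup>2 = (1/s)\<^sup>2" for u
  proof -
    have "sqbd (\<lambda>k. u * x k) (u\<^sup>2 * c)" by (rule sqbd_scale[OF x])
    moreover have "u\<^sup>2 * c \<le> 1" unfolding that using s by (simp add: power_divide divide_simps)
    ultimately have "sqbd (\<lambda>k. u * x k) 1" by (rule sqbd_mono)
    then have "(\<Sum>k<n. \<phi> k * (u * x k)) \<le> 1" by (rule James_polarD[OF \<phi>])
    then show ?thesis by (simp add: sum_distrib_left mult.left_commute)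
  qed
  show ?thesis using *[of "1/s"] *[of "- (1/s)"] s(1) by (simp add: abs_le_iff field_simps)
qed

lemma sum_compose_push:
  assumes "\<And>k. k < n \<Longrightarrow> \<rho> k < m"
  shows "(\<Sum>k<n. v (\<rho> k) * x k) = (\<Sum>i<m. v i * push \<rho> {..<n} x i)"
proof -
  have "(\<Sum>k<n. v (\<rho> k) * x k) = (\<Sum>i<m. \<Sum>k\<in>{k\<in>{..<n}. \<rho> k = i}. v (\<rho> k) * x k)"
    using assms by (intro sum.group[symmetric]) auto
  also have "\<dots> = (\<Sum>i<m. v i * push \<rho> {..<n} x i)"
    unfolding push_def sum_distrib_left by (intro sum.cong refl) simp
  finally show ?thesis .
qed

lemma sqbd_push_lessThan: "sqbd x c \<Longrightarrow> mono \<rho> \<Longrightarrow> sqbd (push \<rho> {..<n} x) c"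
  by (rule sqbd_push) (auto intro: mono_on_subset)

lemma sum_mult_le_squares:
  fixes v X :: "nat \<Rightarrow> real"
  shows "2 * (\<Sum>i<m. v i * X i) \<le> (\<Sum>i<m. (v i)\<^sup>2) + (\<Sum>i<m. (X i)\<^sup>2)"
proof -
  have "0 \<le> (\<Sum>i<m. (v i - X i)\<^sup>2)" by (intro sum_nonneg) simp
  then show ?thesis by (simp add: power2_diff sum.distrib sum_subtractf sum_distrib_left mult.assoc)
qed

text \<open>Moved to the other side of the pairing, \<open>\<rho>\<close> acts by
  \<open>push\<close>, which keeps \<open>x\<close> in the ball; the squares of the pushed entries
  then sum to at most 1. Allowing every monotone \<open>\<rho>\<close> also covers the relabelled
  sequences by which zero runs are excluded later.\<close>

lemma compose_mono_in_polar:
  fixes \<rho> :: "nat \<Rightarrow> nat"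
  assumes \<rho>: "mono \<rho>" and v: "\<And>n. (\<Sum>i<n. (v i)\<^sup>2) \<le> 1"
  shows "(\<lambda>k. v (\<rho> k)) \<in> James_polar"
  unfolding James_polar_def
proof (intro CollectI allI impI)
  fix x n assume x: "sqbd x 1"
  have m: "\<rho> k < Suc (\<rho> n)" if "k < n" for k using monoD[OF \<rho>, of k n] that by simp
  let ?X = "push \<rho> {..<n} x"
  have "(\<Sum>i<Suc (\<rho> n). (?X i)\<^sup>2) \<le> 1"
    by (rule sqbd_squares[OF sqbd_push_lessThan[OF x \<rho>]]) simp
  moreover have "(\<Sum>k<n. v (\<rho> k) * x k) = (\<Sum>i<Suc (\<rho> n). v i * ?X i)"
    by (rule sum_compose_push) (rule m)
  ultimately show "(\<Sum>k<n. v (\<rho> k) * x k) \<le> 1"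
    using sum_mult_le_squares[of v ?X "Suc (\<rho> n)"] v[of "Suc (\<rho> n)"] by linarith
qed

lemma run_seqs_subset_polar: "run_seqs \<subseteq> James_polar"
proof
  fix w assume "w \<in> run_seqs"
  then have "(\<lambda>k. run_value w (run_index w k)) \<in> James_polar"
    by (intro compose_mono_in_polar mono_run_index sum_run_value_le_1)
  then show "w \<in> James_polar" by simp
qed

text \<open>The substance is that \<open>run_seqs\<close> is norming: a bound \<open>c\<close> for
  all pairings with a finitely supported vector bounds its squared James norm by
  \<open>c\<^sup>2\<close>.\<close>

lemma polar_eq_hull: "James_polar = seq_hull run_seqs"
proof (intro equalityI subsetI)
  fix \<phi> assume \<phi>: "\<phi> \<in> seq_hull run_seqs"
  show "\<phi> \<in> James_polar"
    unfolding James_polar_def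
  proof (intro CollectI allI impI)
    fix x n assume x: "sqbd x 1"
    define p where "p = (\<Sum>k<n. monom (x k) k)"
    have p: "coeff p k = (if k < n then x k else 0)" for k
      by (simp add: p_def coeff_sum)
    have pw: "pair w p = (\<Sum>k<n. w k * x k)" for w
      by (subst pair_eq_sum[of n]) (simp_all add: p)
    show "(\<Sum>k<n. \<phi> k * x k) \<le> 1"
      unfolding pw[symmetric]
      by (rule seq_hullD[OF \<phi>], unfold pw, rule James_polarD[OF _ x])
        (use run_seqs_subset_polar in blast)
  qed
next
  fix \<phi> assume \<phi>: "\<phi> \<in> James_polar"
  show "\<phi> \<in> seq_hull run_seqs"
    unfolding seq_hull_def
  proof (intro CollectI allI impI)
    fix p c assume le: "\<forall>w\<in>run_seqs. pair w p \<le> c"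
    define n where "n = Suc (degree p)"
    have pw: "pair w p = (\<Sum>k<n. w k * coeff p k)" for w
      by (rule pair_eq_sum_degree) (simp add: n_def)
    have c0: "0 \<le> c"
    proof -
      have "(\<lambda>_. 0) \<in> run_seqs" by (simp add: run_seqs_def run_sum_def cong: if_cong)
      then have "pair (\<lambda>_. 0) p \<le> c" using le by blast
      then show ?thesis by (simp add: pair_def)
    qed
    have sq: "sqbd (coeff p) (c\<^sup>2)"
      unfolding sqbd_def
    proof
      fix \<I> assume I: "\<I> \<in> families UNIV"
      define R where "R = sqrt (qsum (coeff p) \<I>)"
      have R2: "R\<^sup>2 = qsum (coeff p) \<I>" unfolding R_def by (simp add: qsum_nonneg)
      show "qsum (coeff p) \<I> \<le> c\<^sup>2"
      proof (cases "R = 0")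
        case True
        then show ?thesis using R2 by simp
      next
        case False
        then have R: "0 < R" unfolding R_def using qsum_nonneg[of "coeff p" \<I>] by simp
        \<comment> \<open>The normalised block sums give equality in the Cauchy-Schwarz inequality,
          so the pairing with \<open>p\<close> equals \<open>R\<close>.\<close>
        let ?c = "\<lambda>I. sum (coeff p) I / R"
        let ?w = "\<lambda>k. \<Sum>I\<in>\<I>. if k \<in> I then ?c I else 0"
        have "(\<Sum>I\<in>\<I>. (?c I)\<^sup>2) = qsum (coeff p) \<I> / R\<^sup>2"
          by (simp only: qsum_def power_divide sum_divide_distrib[symmetric])
        then have "?w \<in> run_seqs" using R R2 by (intro step_sequence_in_run_seqs I) simp
        then have "pair ?w p \<le> c" using le by blast
        moreover have "pair ?w p = R"
        proof -
          have "pair ?w p = (\<Sum>k<n. \<Sum>I\<in>\<I>. if k \<in> I then ?c I * coeff p k else 0)"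
            unfolding pw sum_distrib_right by (intro sum.cong refl) simp
          also have "\<dots> = (\<Sum>I\<in>\<I>. \<Sum>k<n. if k \<in> I then ?c I * coeff p k else 0)"
            by (rule sum.swap)
          also have "\<dots> = (\<Sum>I\<in>\<I>. (sum (coeff p) I)\<^sup>2 / R)"
          proof (intro sum.cong refl)
            fix I assume "I \<in> \<I>"
            then have fin: "finite I" using familiesD(2)[OF I] block_finite by blast
            have "(\<Sum>k<n. if k \<in> I then ?c I * coeff p k else 0) = (\<Sum>k\<in>{..<n} \<inter> I. ?c I * coeff p k)"
              by (rule sum.inter_restrict[symmetric]) simp
            also have "\<dots> = (\<Sum>k\<in>I. ?c I * coeff p k)"
              using fin by (intro sum.mono_neutral_left) (auto simp: n_def le_degree less_Suc_eq_le)
            finally show "(\<Sum>k<n. if k \<in> I then ?c I * coeff p k else 0) = (sum (coeff p) I)\<^sup>2 / R"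
              unfolding sum_distrib_left[symmetric] by (simp add: power2_eq_square)
          qed
          also have "\<dots> = qsum (coeff p) \<I> / R" by (simp only: qsum_def sum_divide_distrib[symmetric])
          also have "\<dots> = R" using R by (simp add: R2[symmetric] power2_eq_square)
          finally show ?thesis .
        qed
        ultimately have "R\<^sup>2 \<le> c\<^sup>2" using R by (intro power_mono) auto
        then show ?thesis by (simp add: R2)
      qed
    qed
    show "pair \<phi> p \<le> c"
    proof (rule field_le_epsilon)
      fix e :: real assume e: "0 < e"
      \<comment> \<open>\<open>James_polar_le\<close> asks for a positive bound, while
        \<open>c\<close> may be 0.\<close>
      have "c\<^sup>2 \<le> (c + e)\<^sup>2" using c0 e by (intro power_mono) auto
      then have "\<bar>pair \<phi> p\<bar> \<le> c + e"
        unfolding pw using c0 e by (intro James_polar_le[OF \<phi> sq]) auto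
      then show "pair \<phi> p \<le> c + e" by simp
    qed
  qed
qed

lemma extreme_polar_in_run_seqs:
  assumes "extreme_pt \<phi> James_polar"
  shows "\<phi> \<in> run_seqs"
  by (rule run_seqs_closed, rule extreme_hull_approx[OF _ assms[unfolded polar_eq_hull]])
    (rule run_seqs_abs_le_1)

lemma polar_summable:
  assumes \<phi>: "\<phi> \<in> James_polar" and x: "sqbd x c"
  shows "summable (\<lambda>k. \<phi> k * x k)"
  unfolding summable_Cauchy
proof (intro allI impI)
  fix e :: real assume e: "0 < e"
  then obtain m where m: "\<And>n. m \<le> n \<Longrightarrow> vari x {n..} < (e/2)\<^sup>2"
    using vari_tail_small[OF x, of "(e/2)\<^sup>2"] by (metis half_gt_zero zero_less_power)
  have "norm (\<Sum>k\<in>{p..<n}. \<phi> k * x k) < e" if "m \<le> p" for p n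
  proof -
    have "\<bar>\<Sum>k<n. \<phi> k * (if k < p then 0 else x k)\<bar> \<le> e/2"
      using m[OF that] e by (intro James_polar_le[OF \<phi> sqbd_tail[OF x]]) auto
    also have "(\<Sum>k<n. \<phi> k * (if k < p then 0 else x k)) = (\<Sum>k\<in>{p..<n}. \<phi> k * x k)"
      by (rule sum.mono_neutral_cong_right) auto
    finally show ?thesis using e by simp
  qed
  then show "\<exists>N. \<forall>p\<ge>N. \<forall>n. norm (\<Sum>k\<in>{p..<n}. \<phi> k * x k) < e" by blast
qed

lemma polar_functional:
  assumes \<phi>: "\<phi> \<in> James_polar"
  obtains f where "f \<in> James_dual_ball" "\<And>k. f (unit_seq k) = \<phi> k"
proof
  let ?f = "\<lambda>x. if x \<in> James then \<Sum>k. \<phi> k * x k else 0"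
  note summ = polar_summable[OF \<phi> jnorm_sqbd(1)]
  show "?f \<in> James_dual_ball"
  proof (rule James_dual_ballI)
    fix x y assume xy: "x \<in> James" "y \<in> James"
    show "?f (\<lambda>k. x k + y k) = ?f x + ?f y"
      using xy James_add[OF xy] suminf_add[OF summ[OF xy(1)] summ[OF xy(2)]]
      by (simp add: distrib_left)
  next
    fix x and c :: real assume x: "x \<in> James"
    show "?f (\<lambda>k. c * x k) = c * ?f x"
      using x James_scale[OF x, of c] suminf_mult[OF summ[OF x], of c] by (simp add: mult.left_commute)
  next
    fix x assume x: "sqbd x 1"
    have "(\<Sum>k. \<phi> k * x k) \<le> 1"
      by (rule suminf_le_const[OF polar_summable[OF \<phi> x] James_polarD[OF \<phi> x]])
    then show "?f x \<le> 1" by simp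
  qed simp
  show "?f (unit_seq k) = \<phi> k" for k
  proof -
    have "(\<lambda>j. \<phi> j * unit_seq k j) = (\<lambda>j. if j = k then \<phi> j else 0)" by (auto simp: unit_seq_def)
    moreover have "(\<Sum>j. if j = k then \<phi> j else 0) = \<phi> k" by (rule sums_unique[symmetric, OF sums_single])
    ultimately show ?thesis using unit_seq_James by simp
  qed
qed

text \<open>Every sequence in the polar comes from a functional in the dual ball, so a convex
  representation of the coordinates lifts to one of \<open>f\<close>.\<close>

lemma extreme_dual_ball_imp_polar:
  assumes ext: "extreme_pt f James_dual_ball"
  shows "extreme_pt (\<lambda>k. f (unit_seq k)) James_polar"
  unfolding extreme_pt_def
proof (intro conjI ballI allI impI)
  have fb: "f \<in> James_dual_ball" and fd: "f \<in> James_dual"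
    using ext by (simp_all add: extreme_pt_def James_dual_ball_def)
  show "(\<lambda>k. f (unit_seq k)) \<in> James_polar"
    unfolding James_polar_def
  proof (intro CollectI allI impI)
    fix x n assume "sqbd x 1"
    from James_dual_ball_sqbd[OF fb sqbd_cutoff[OF this, of n]]
    have "f (\<lambda>k. if k < n then x k else 0) \<le> 1" by (simp add: abs_square_le_1)
    then show "(\<Sum>k<n. f (unit_seq k) * x k) \<le> 1" by (simp add: James_dual_cutoff[OF fd] mult.commute)
  qed
  fix a b and t :: real
  assume "a \<in> James_polar" "b \<in> James_polar"
    and *: "0 < t \<and> t < 1 \<and> (\<lambda>k. f (unit_seq k)) = (\<lambda>k. t * a k + (1 - t) * b k)"
  then obtain g h where g: "g \<in> James_dual_ball" "\<And>k. g (unit_seq k) = a k"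
    and h: "h \<in> James_dual_ball" "\<And>k. h (unit_seq k) = b k" by (metis polar_functional)
  have gd: "g \<in> James_dual" and hd: "h \<in> James_dual" using g h by (simp_all add: James_dual_ball_def)
  have coef: "f (unit_seq k) = t * a k + (1 - t) * b k" for k using * by (metis (no_types))
  have "f x = t * g x + (1 - t) * h x" for x
  proof (cases "x \<in> James")
    case True
    have "(\<lambda>n. t * (\<Sum>k<n. x k * g (unit_seq k)) + (1 - t) * (\<Sum>k<n. x k * h (unit_seq k)))
        \<longlonglongrightarrow> t * g x + (1 - t) * h x"
      by (intro tendsto_intros James_dual_expand gd hd True)
    also have "(\<lambda>n. t * (\<Sum>k<n. x k * g (unit_seq k)) + (1 - t) * (\<Sum>k<n. x k * h (unit_seq k)))
        = (\<lambda>n. \<Sum>k<n. x k * f (unit_seq k))"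
      unfolding sum_distrib_left sum.distrib[symmetric] coef g(2) h(2)
      by (intro HOL.ext sum.cong refl) (simp add: algebra_simps)
    finally show ?thesis using James_dual_expand[OF fd True] by (intro LIMSEQ_unique)
  next
    case False
    then show ?thesis using fd gd hd by (simp add: James_dual_def)
  qed
  then have "g = h" using * by (intro extreme_ptD[OF ext g(1) h(1), of t]) simp_all
  then show "a = b" using g(2) h(2) by (metis HOL.ext)
qed

text \<open>With a deficit \<open>d\<close> on the whole ball, the first coordinate could be changed
  by \<open>d\<close> in both directions, since entries of vectors in the ball are at most 1 in
  absolute value.\<close>

lemma extreme_polar_norming:
  assumes ext: "extreme_pt \<phi> James_polar" and d: "0 < d"
  obtains x n where "sqbd x 1" "1 - d < (\<Sum>k<n. \<phi> k * x k)"
proof -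
  have "\<exists>x n. sqbd x 1 \<and> 1 - d < (\<Sum>k<n. \<phi> k * x k)"
  proof (rule ccontr)
    assume "\<not> ?thesis"
    then have le: "(\<Sum>k<n. \<phi> k * x k) \<le> 1 - d" if "sqbd x 1" for x n
      using that by (meson not_le)
    have polar: "(\<lambda>k. \<phi> k + s * unit_seq 0 k) \<in> James_polar" if s: "\<bar>s\<bar> = d" for s
      unfolding James_polar_def
    proof (intro CollectI allI impI)
      fix x n assume x: "sqbd x 1"
      have "\<bar>x 0\<bar> \<le> 1" using sqbd_1_abs[OF x, of "{0}"] by simp
      then have "\<bar>s * x 0\<bar> \<le> d" using s by (simp add: abs_mult mult_left_le)
      moreover have "(\<Sum>k<n. s * unit_seq 0 k * x k) = (\<Sum>k<n. if k = 0 then s * x 0 else 0)"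
        by (intro sum.cong) (auto simp: unit_seq_def)
      moreover have "(\<Sum>k<n. (\<phi> k + s * unit_seq 0 k) * x k)
          = (\<Sum>k<n. \<phi> k * x k) + (\<Sum>k<n. s * unit_seq 0 k * x k)"
        by (simp only: distrib_right sum.distrib)
      ultimately show "(\<Sum>k<n. (\<phi> k + s * unit_seq 0 k) * x k) \<le> 1"
        using le[OF x, of n] d by (auto split: if_splits)
    qed
    have "(\<lambda>k. \<phi> k + d * unit_seq 0 k) = (\<lambda>k. \<phi> k + (- d) * unit_seq 0 k)"
      by (rule extreme_ptD[OF ext polar polar, of _ _ "1/2"]) (use d in \<open>simp_all add: algebra_simps\<close>)
    from fun_cong[OF this, of 0] show False using d by (simp add: unit_seq_def)
  qed
  then show ?thesis using that by blast
qed

subsection \<open>Extreme points are given by interval families\<close>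

text \<open>\<open>\<rho>\<close> numbers the runs and \<open>v\<close> lists their values. By the
  last clause a zero run is either the initial one or the last one.\<close>

lemma extreme_polar_structure:
  assumes ext: "extreme_pt \<phi> James_polar"
  shows "\<exists>\<rho> v. mono \<rho> \<and> (\<forall>i k. i \<le> \<rho> k \<longrightarrow> i \<in> range \<rho>) \<and> (\<forall>k. \<phi> k = v (\<rho> k)) \<and>
    (\<forall>i. i \<notin> range \<rho> \<longrightarrow> v i = (0::real)) \<and> sqbd v 1 \<and> (\<lambda>i. (v i)\<^sup>2) sums 1 \<and>
    (\<forall>i. v (Suc i) = 0 \<longrightarrow> Suc (Suc i) \<notin> range \<rho>)"
proof -
  define \<rho> where "\<rho> = run_index \<phi>"
  define v where "v = run_value \<phi>"
  have \<rho>: "mono \<rho>" unfolding \<rho>_def by (rule mono_run_index)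
  have down: "i \<in> range \<rho>" if "i \<le> \<rho> k" for i k using run_index_down that unfolding \<rho>_def by blast
  have \<phi>v: "\<phi> k = v (\<rho> k)" for k by (simp add: \<rho>_def v_def)
  have v0: "v i = 0" if "i \<notin> range \<rho>" for i using that by (simp add: v_def \<rho>_def run_value_def)
  have v1: "(\<Sum>i<N. (v i)\<^sup>2) \<le> 1" for N
    unfolding v_def by (rule sum_run_value_le_1[OF extreme_polar_in_run_seqs[OF ext]])
  \<comment> \<open>The sums of a nearly norming \<open>x\<close> over the runs pair with
    \<open>v\<close> exactly as \<open>x\<close> pairs with \<open>\<phi>\<close>.\<close>
  have near: "\<exists>X. sqbd X 1 \<and> (\<exists>M0. \<forall>m\<ge>M0. 1 - d < (\<Sum>i<m. v i * X i))" if d: "0 < d" for d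
  proof -
    obtain x n where x: "sqbd x 1" "1 - d < (\<Sum>k<n. \<phi> k * x k)"
      using extreme_polar_norming[OF ext d] .
    have "1 - d < (\<Sum>i<m. v i * push \<rho> {..<n} x i)" if "Suc (\<rho> n) \<le> m" for m
    proof -
      have "\<rho> k < m" if "k < n" for k using monoD[OF \<rho>, of k n] that \<open>Suc (\<rho> n) \<le> m\<close> by simp
      then have "(\<Sum>k<n. v (\<rho> k) * x k) = (\<Sum>i<m. v i * push \<rho> {..<n} x i)"
        by (rule sum_compose_push)
      then show ?thesis using x(2) by (simp add: \<phi>v)
    qed
    then show ?thesis using sqbd_push_lessThan[OF x(1) \<rho>] by blast
  qed
  have "\<exists>X. \<forall>n. sqbd (X n) 1 \<and> (\<exists>M0. \<forall>m\<ge>M0. 1 - inverse (real (Suc n)) < (\<Sum>i<m. v i * X n i))"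
    by (rule choice) (use near in simp)
  then obtain X where X: "\<And>n. sqbd (X n) 1"
    and Xv: "\<And>n. \<exists>M0. \<forall>m\<ge>M0. 1 - inverse (real (Suc n)) < (\<Sum>i<m. v i * X n i)" by blast
  \<comment> \<open>Uniform convexity of l2: both vectors have square sum at most 1 and their inner
    product is nearly 1.\<close>
  have close: "(X n i - v i)\<^sup>2 \<le> 2 * inverse (real (Suc n))" for n i
  proof -
    obtain M0 where M0: "\<And>m. M0 \<le> m \<Longrightarrow> 1 - inverse (real (Suc n)) < (\<Sum>j<m. v j * X n j)"
      using Xv by blast
    define m where "m = max M0 (Suc i)"
    have "(X n i - v i)\<^sup>2 \<le> (\<Sum>j<m. (X n j - v j)\<^sup>2)"
      by (rule member_le_sum) (auto simp: m_def)
    also have "\<dots> = (\<Sum>j<m. (X n j)\<^sup>2) + (\<Sum>j<m. (v j)\<^sup>2) - 2 * (\<Sum>j<m. v j * X n j)"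
      by (simp add: power2_diff sum.distrib sum_subtractf sum_distrib_left algebra_simps)
    also have "\<dots> \<le> 1 + 1 - 2 * (1 - inverse (real (Suc n)))"
      using sqbd_squares[OF X, of "{..<m}" n] v1[of m] M0[of m] by (simp add: m_def)
    finally show ?thesis by simp
  qed
  have "(\<lambda>n. X n i) \<longlonglongrightarrow> v i" for i
  proof (rule LIM_zero_cancel)
    have "(\<lambda>n. (X n i - v i)\<^sup>2) \<longlonglongrightarrow> 0"
    proof (rule tendsto_sandwich[of "\<lambda>_. 0"])
      show "(\<lambda>n. 2 * inverse (real (Suc n))) \<longlonglongrightarrow> 0"
        by (rule tendsto_mult_right_zero[OF LIMSEQ_inverse_real_of_nat])
      show "\<forall>\<^sub>F n in sequentially. (X n i - v i)\<^sup>2 \<le> 2 * inverse (real (Suc n))"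
        by (intro always_eventually allI close)
    qed simp_all
    then show "(\<lambda>n. X n i - v i) \<longlonglongrightarrow> 0" by (simp only: power_tendsto_0_iff[OF pos2])
  qed
  then have sv: "sqbd v 1" using X by (rule sqbd_lim)
  have sums: "(\<lambda>i. (v i)\<^sup>2) sums 1"
  proof (rule sums_1I)
    fix e :: real assume "0 < e"
    then obtain X M0 where X: "sqbd X 1" and M0: "\<And>m. M0 \<le> m \<Longrightarrow> 1 - e/2 < (\<Sum>i<m. v i * X i)"
      using near[of "e/2"] by auto
    have "1 - e < (\<Sum>i<M0. (v i)\<^sup>2)"
      using M0[of M0] sqbd_squares[OF X, of "{..<M0}"] sum_mult_le_squares[of v X M0] by simp
    then show "\<exists>K. 1 - e < (\<Sum>i<K. (v i)\<^sup>2)" by blast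
  qed (use v1 in auto)
  have gap: "Suc (Suc i) \<notin> range \<rho>" if vi: "v (Suc i) = 0" for i
  proof
    assume r2: "Suc (Suc i) \<in> range \<rho>"
    then obtain l where l: "Suc (Suc i) = \<rho> l" by blast
    have r1: "Suc i \<in> range \<rho>" using down[of "Suc i" l] l by simp
    define a b where "a = v i" and "b = v (Suc (Suc i))"
    have a: "a \<noteq> 0" unfolding a_def using run_value_neq_Suc[of i \<phi>] r1 vi by (simp add: v_def \<rho>_def)
    have b: "b \<noteq> 0" unfolding b_def using run_value_neq_Suc[of "Suc i" \<phi>] r2 vi by (simp add: v_def \<rho>_def)
    have "(sum v {i..<Suc (Suc (Suc i))})\<^sup>2 \<le> (\<Sum>k\<in>{i..<Suc (Suc (Suc i))}. (v k)\<^sup>2)"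
      by (rule block_square_le[OF sv sums]) simp
    then have "a * b \<le> 0" by (simp add: vi a_def b_def power2_sum)
    \<comment> \<open>\<open>b / (b - a)\<close> is the weight \<open>t\<close> with
      \<open>t * a + (1 - t) * b = 0\<close>; opposite signs of \<open>a\<close> and
      \<open>b\<close> place it strictly between 0 and 1.\<close>
    then have sgn: "0 < b / (b - a)" "b / (b - a) < 1" "a \<noteq> b"
      using a b by (auto simp: mult_le_0_iff divide_simps)
    \<comment> \<open>The zero run is relabelled as part of its left neighbour, and by
      \<open>\<rho>2\<close> as part of its right one. Both labellings stay monotone.\<close>
    define \<rho>1 where "\<rho>1 k = (if \<rho> k = Suc i then i else \<rho> k)" for k
    define \<rho>2 where "\<rho>2 k = (if \<rho> k = Suc i then Suc (Suc i) else \<rho> k)" for k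
    have "mono \<rho>1" "mono \<rho>2"
    proof -
      show "mono \<rho>1"
      proof (rule monoI)
        fix k l :: nat assume "k \<le> l"
        then have "\<rho> k \<le> \<rho> l" by (rule monoD[OF \<rho>])
        then show "\<rho>1 k \<le> \<rho>1 l" by (auto simp: \<rho>1_def)
      qed
      show "mono \<rho>2"
      proof (rule monoI)
        fix k l :: nat assume "k \<le> l"
        then have "\<rho> k \<le> \<rho> l" by (rule monoD[OF \<rho>])
        then show "\<rho>2 k \<le> \<rho>2 l" by (auto simp: \<rho>2_def)
      qed
    qed
    then have polar: "(\<lambda>k. v (\<rho>1 k)) \<in> James_polar" "(\<lambda>k. v (\<rho>2 k)) \<in> James_polar"
      using v1 by (auto intro: compose_mono_in_polar)
    have comb: "b / (b - a) * a + (1 - b / (b - a)) * b = 0"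
      using sgn(3) by (simp add: field_simps)
    have "(\<lambda>k. v (\<rho>1 k)) = (\<lambda>k. v (\<rho>2 k))"
    proof (rule extreme_ptD[OF ext polar sgn(1,2)])
      fix k
      show "\<phi> k = b / (b - a) * v (\<rho>1 k) + (1 - b / (b - a)) * v (\<rho>2 k)"
      proof (cases "\<rho> k = Suc i")
        case True
        then show ?thesis using comb by (simp add: \<phi>v \<rho>1_def \<rho>2_def vi a_def b_def)
      next
        case False
        then show ?thesis by (simp add: \<phi>v \<rho>1_def \<rho>2_def algebra_simps)
      qed
    qed
    moreover obtain k where "Suc i = \<rho> k" using r1 by blast
    ultimately have "v i = v (Suc (Suc i))"
      using fun_cong[of _ _ k] by (fastforce simp: \<rho>1_def \<rho>2_def)
    then show False using sgn(3) by (simp add: a_def b_def)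
  qed
  show ?thesis
    by (intro exI[of _ \<rho>] exI[of _ v] conjI allI impI \<rho> \<phi>v sv sums) (fact down v0 gap)+
qed

lemma extreme_imp_interval_family:
  assumes f: "f \<in> James_dual" and ext: "extreme_pt f James_dual_ball"
  shows "\<exists>F I \<alpha>. interval_family F I \<and> (\<forall>i\<in>F. \<alpha> i \<noteq> (0::real)) \<and>
       (\<forall>x\<in>James. (\<lambda>n. \<Sum>i\<in>F \<inter> {..<n}. \<alpha> i * isum x (I i)) \<longlonglongrightarrow> f x) \<and>
       extreme_pt (\<lambda>i. if i \<in> F then \<alpha> i else 0) James_ball \<and>
       nat_interval (\<Union>i\<in>F. I i)"
proof -
  obtain \<rho> v where \<rho>: "mono \<rho>" and down: "\<And>i k. i \<le> \<rho> k \<Longrightarrow> i \<in> range \<rho>"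
    and \<phi>v: "\<And>k. f (unit_seq k) = v (\<rho> k)" and v0: "\<And>i. i \<notin> range \<rho> \<Longrightarrow> v i = 0"
    and sv: "sqbd v 1" and sums: "(\<lambda>i. (v i)\<^sup>2) sums 1"
    and gap: "\<And>i. v (Suc i) = 0 \<Longrightarrow> Suc (Suc i) \<notin> range \<rho>"
    using extreme_polar_structure[OF extreme_dual_ball_imp_polar[OF ext]] by (elim exE conjE) blast
  \<comment> \<open>An initial run of value 0 is dropped by shifting the numbering by one.\<close>
  define s where "s = (if v 0 = 0 then Suc 0 else 0)"
  define u where "u i = v (i + s)" for i
  define R where "R i = {k. \<rho> k = i + s}" for i
  define F where "F = {i. u i \<noteq> 0}"
  have no_gap: "v j \<noteq> 0" if vi: "v i \<noteq> 0" and ij: "i < j" and vl: "v l \<noteq> 0" and jl: "j < l" for i j l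
  proof
    assume "v j = 0"
    then have "Suc j \<notin> range \<rho>" using gap[of "j - 1"] ij by simp
    moreover obtain k where "l = \<rho> k" using v0[of l] vl by blast
    ultimately show False using down[of "Suc j" k] jl by simp
  qed
  have F_down: "i \<in> F" if "j \<in> F" "i \<le> j" for i j
  proof (rule ccontr)
    assume "i \<notin> F"
    then have vi: "v (i + s) = 0" by (simp add: F_def u_def)
    have vj: "v (j + s) \<noteq> 0" using that(1) by (simp add: F_def u_def)
    have ij: "i + s < j + s" using vi vj that(2) by (metis add_le_cancel_right le_neq_implies_less)
    show False
    proof (cases "i + s = 0")
      case True
      then show False using vi by (auto simp: s_def split: if_splits)
    next
      case False
      then obtain m where m: "i + s = Suc m" by (cases "i + s") auto
      obtain k where k: "j + s = \<rho> k" using v0[of "j + s"] vj by blast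
      have "Suc (Suc m) \<notin> range \<rho>" using gap[of m] vi m by simp
      then show False using down[of "Suc (Suc m)" k] ij k m by simp
    qed
  qed
  have "\<exists>j. v j \<noteq> 0"
  proof (rule ccontr)
    assume "\<not> ?thesis"
    then have "(\<lambda>i. 0) sums (1::real)" using sums by simp
    from sums_unique2[OF this sums_zero] show False by simp
  qed
  then obtain j where j: "v j \<noteq> 0" by blast
  have "s \<le> j" using j by (cases j) (auto simp: s_def)
  then have "j - s \<in> F" using j by (simp add: F_def u_def)
  then have F0: "0 \<in> F" using F_down by blast
  have F_form: "F = UNIV \<or> (\<exists>k\<ge>1. F = {..<k})"
  proof (cases "F = UNIV")
    case False
    define k where "k = (LEAST i. i \<notin> F)"
    obtain i where "i \<notin> F" using False by blast
    then have k: "k \<notin> F" unfolding k_def by (rule LeastI[of "\<lambda>i. i \<notin> F"])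
    have "i \<in> F" if "i < k" for i using not_less_Least[of i "\<lambda>i. i \<notin> F"] that by (auto simp: k_def)
    moreover have "i < k" if "i \<in> F" for i using F_down[OF that, of k] k by (meson not_le)
    ultimately have "F = {..<k}" by auto
    moreover have "k \<ge> 1" using k F0 by (cases k) auto
    ultimately show ?thesis by blast
  qed simp
  have R_ivl: "nat_interval (R i)" if "i \<in> F" for i
  proof -
    have "\<exists>k. k \<in> R i" using v0[of "i + s"] that by (force simp: F_def u_def R_def)
    moreover have "b \<in> R i" if "a \<in> R i" "c \<in> R i" "a \<le> b" "b \<le> c" for a b c
      using monoD[OF \<rho> that(3)] monoD[OF \<rho> that(4)] that(1,2) by (simp add: R_def)
    ultimately show ?thesis unfolding nat_interval_def by blast
  qed
  have fam: "interval_family F R"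
    unfolding interval_family_def
  proof (intro conjI ballI allI impI F_form R_ivl)
    fix i a b assume "a \<in> R i" "b \<in> R (Suc i)"
    then have "\<rho> a < \<rho> b" by (simp add: R_def)
    then show "a < b" using monoD[OF \<rho>, of b a] by (meson not_le)
  qed
  have R_disj: "R i \<inter> R j = {}" if "i \<noteq> j" for i j using that by (auto simp: R_def)
  have u_ext: "sqbd u 1 \<and> (\<lambda>i. (u i)\<^sup>2) sums 1"
  proof
    have "sqbd (push (\<lambda>k. k - s) {s..} v) 1"
    proof (rule sqbd_push[OF sv])
      show "mono_on {s..} (\<lambda>k. k - s)" by (intro mono_onI diff_le_mono)
      show "finite {k \<in> {s..}. k - s \<in> C}" if "finite C" for C
      proof (rule finite_subset)
        show "{k \<in> {s..}. k - s \<in> C} \<subseteq> (\<lambda>i. i + s) ` C"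
          by (auto simp: image_iff intro!: bexI[where P = "\<lambda>i. _ = i + s"] le_add_diff_inverse2[symmetric])
      qed (use that in simp)
    qed auto
    moreover have "push (\<lambda>k. k - s) {s..} v = u"
    proof
      fix i
      have "{k \<in> {s..}. k - s = i} = {i + s}" by auto
      then show "push (\<lambda>k. k - s) {s..} v i = u i" by (simp add: push_def u_def)
    qed
    ultimately show "sqbd u 1" by simp
    have "(\<lambda>i. (v (i + s))\<^sup>2) sums (1 - (\<Sum>i<s. (v i)\<^sup>2))" by (rule sums_split_initial_segment[OF sums])
    moreover have "(\<Sum>i<s. (v i)\<^sup>2) = 0" by (simp add: s_def)
    ultimately show "(\<lambda>i. (u i)\<^sup>2) sums 1" by (simp add: u_def)
  qed
  have u_le: "(\<Sum>i<n. (u i)\<^sup>2) \<le> 1" for n using sqbd_squares u_ext by blast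
  have R_ivl': "nat_interval (R i)" if "u i \<noteq> 0" for i using R_ivl that by (simp add: F_def)
  define L where "L x = (if x \<in> James then \<Sum>i. u i * isum x (R i) else 0)" for x
  have LJ: "L \<in> James_dual_ball"
    unfolding L_def by (rule interval_functional_in_ball[OF R_ivl' R_disj u_le])
  have "L (unit_seq k) = f (unit_seq k)" for k
  proof -
    have "u i * isum (unit_seq k) (R i) = (if i = \<rho> k - s then v (\<rho> k) else 0)" for i
    proof (cases "s \<le> \<rho> k")
      case True
      then show ?thesis by (auto simp: isum_unit_seq R_def u_def)
    next
      case False
      \<comment> \<open>Truncated subtraction makes \<open>\<rho> k - s\<close> the index 0 of a
        different run, which is harmless because the value attached to it is
        \<open>v 0 = 0\<close>.\<close>
      then have "\<rho> k = 0" "v 0 = 0" by (auto simp: s_def split: if_splits)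
      then show ?thesis using False by (auto simp: isum_unit_seq R_def)
    qed
    then have "L (unit_seq k) = (\<Sum>i. if i = \<rho> k - s then v (\<rho> k) else 0)"
      using unit_seq_James by (simp add: L_def)
    also have "\<dots> = v (\<rho> k)" by (rule sums_unique[symmetric, OF sums_single])
    finally show ?thesis by (simp add: \<phi>v)
  qed
  then have Lf: "L = f" using LJ f by (intro James_dual_eqI) (simp_all add: James_dual_ball_def)
  have lim: "(\<lambda>n. \<Sum>i\<in>F \<inter> {..<n}. u i * isum x (R i)) \<longlonglongrightarrow> f x" if x: "x \<in> James" for x
  proof -
    have "(\<Sum>i\<in>F \<inter> {..<n}. u i * isum x (R i)) = (\<Sum>i<n. u i * isum x (R i))" for n
      by (intro sum.mono_neutral_left) (auto simp: F_def)
    moreover have "summable (\<lambda>i. u i * isum x (R i))"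
      by (rule interval_sum_summable[OF R_ivl' R_disj u_le jnorm_sqbd(1)[OF x]])
    ultimately show ?thesis
      using summable_LIMSEQ[of "\<lambda>i. u i * isum x (R i)"] x unfolding Lf[symmetric] L_def by simp
  qed
  have "(\<lambda>i. if i \<in> F then u i else 0) = u" by (auto simp: F_def)
  then have ext_u: "extreme_pt (\<lambda>i. if i \<in> F then u i else 0) James_ball"
    using u_ext by (simp add: extreme_James_ball_iff)
  have un: "(\<Union>i\<in>F. R i) = {k. v (\<rho> k) \<noteq> 0}"
  proof (intro equalityI subsetI)
    fix k assume "k \<in> {k. v (\<rho> k) \<noteq> 0}"
    then have vk: "v (\<rho> k) \<noteq> 0" by simp
    then have "s \<le> \<rho> k" by (cases "\<rho> k") (auto simp: s_def)
    then have "k \<in> R (\<rho> k - s)" "\<rho> k - s \<in> F" using vk by (simp_all add: R_def F_def u_def)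
    then show "k \<in> (\<Union>i\<in>F. R i)" by blast
  qed (auto simp: R_def F_def u_def)
  have "b \<in> {k. v (\<rho> k) \<noteq> 0}"
    if "a \<in> {k. v (\<rho> k) \<noteq> 0}" "c \<in> {k. v (\<rho> k) \<noteq> 0}" "a \<le> b" "b \<le> c" for a b c
  proof (cases "\<rho> b = \<rho> a \<or> \<rho> b = \<rho> c")
    case True
    then show ?thesis using that(1,2) by auto
  next
    case False
    then have "\<rho> a < \<rho> b" "\<rho> b < \<rho> c"
      using monoD[OF \<rho> that(3)] monoD[OF \<rho> that(4)] by auto
    then show ?thesis using no_gap[of "\<rho> a" "\<rho> b" "\<rho> c"] that(1,2) by simp
  qed
  moreover have "(\<Union>i\<in>F. R i) \<noteq> {}" using F0 R_ivl[OF F0] by (auto simp: nat_interval_def)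
  ultimately have "nat_interval (\<Union>i\<in>F. R i)" unfolding nat_interval_def un by blast
  then show ?thesis
    using fam lim ext_u by (intro exI[of _ F] exI[of _ R] exI[of _ u]) (auto simp: F_def)
qed

theorem theorem5p10:
  fixes f :: "(nat \<Rightarrow> real) \<Rightarrow> real"
  assumes "f \<in> James_dual"
  shows "extreme_pt f James_dual_ball \<longleftrightarrow>
    (\<exists>F I \<alpha>. interval_family F I \<and> (\<forall>i\<in>F. \<alpha> i \<noteq> (0::real)) \<and>
       (\<forall>x\<in>James. (\<lambda>n. \<Sum>i\<in>F \<inter> {..<n}. \<alpha> i * isum x (I i)) \<longlonglongrightarrow> f x) \<and>
       extreme_pt (\<lambda>i. if i \<in> F then \<alpha> i else 0) James_ball \<and>
       nat_interval (\<Union>i\<in>F. I i))"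
  using extreme_imp_interval_family[OF assms] interval_functional_extreme[OF assms] by blast

end
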